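(* Let $\lambda>0$, $\alpha>0$, and let $U$ be a spectrally positive Lévy process with $\mathbb{E}[U(1)]=1$ and $u_2,u_3<\infty$. Let the initial workload $Q(0)\ge 0$ satisfy $\mathbb{E}[Q(0)^2]<\infty$. Let $\mu_T^\star=\arg\min_{\mu\ge 0}\Pi_T(\mu)$ and let $\mu_\infty^\star=\lambda+\sqrt{\lambda u_2/(2\alpha)}$ be the minimizer of $\Pi_\infty(\mu)=\frac{\lambda u_2}{2(\mu-\lambda)}+\alpha\mu$ over $\mu>\lambda$. Then, as $T\to\infty$, $$\mu_T^\star=\mu_\infty^\star+\frac{\mu_\bullet}{T}+o(1/T),$$ where $$\mu_\bullet=\frac{\mathbb{E}[Q(0)^2]}{\sqrt{8\lambda u_2\alpha}}-\frac{u_3}{3u_2}-3\sqrt{\frac{\alpha\lambda u_2}{8}}.$$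
   Context: Spectrally positive means that the Lévy measure of $U$ gives no mass to $(-\infty,0)$ (no negative jumps). For $k\ge 2$, $u_k=\mathbb{E}[(U(1)-\mathbb{E}U(1))^k]$. For server speed $\mu$ put $X_\mu(t)=U(\lambda t)-\mu t$; with initial workload $Q(0)\ge 0$ independent of $U$ (its law not depending on $\mu$ or $T$), the workload process is $Q_\mu(t)=\max\{Q(0)+X_\mu(t),\ \sup_{s\in[0,t]}[X_\mu(t)-X_\mu(s)]\}$, $t\ge0$. For $T>0$ the finite-horizon cost is $\Pi_T(\mu)=\frac1T\int_0^T\mathbb{E}[Q_\mu(t)]\,dt+\alpha\mu$. The stationary cost is $\Pi_\infty(\mu)=\mathbb{E}[Q_\mu(\infty)]+\alpha\mu$, where for $\mu>\lambda$ the random variable $Q_\mu(\infty)$ is the limit in distribution of $Q_\mu(t)$ and $\mathbb{E}[Q_\mu(\infty)]=\frac{\lambda u_2}{2(\mu-\lambda)}$. *)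

theory Defs
  imports "HOL-Probability.Probability" "HOL-Library.Landau_Symbols"
begin

text \<open>Real-valued paths are functions on all of \<^typ>\<open>real\<close>; only their values on the time axis
  \<open>[0, \<infinity>)\<close> matter.\<close>

definition cadlag :: "(real \<Rightarrow> real) \<Rightarrow> bool" where
  "cadlag f \<longleftrightarrow>
     (\<forall>t\<ge>0. (f \<longlongrightarrow> f t) (at_right t)) \<and> (\<forall>t>0. \<exists>l. (f \<longlongrightarrow> l) (at_left t))"

definition jump :: "(real \<Rightarrow> real) \<Rightarrow> real \<Rightarrow> real" where
  "jump f t = f t - Lim (at_left t) f"

text \<open>Every path, not merely almost every path, is required to be cadlag, so that suprema over time
  intervals are measurable without completing the probability space. Stochastic continuity follows
  from right-continuity and stationarity.\<close>

locale levy_process = prob_space M for M :: "'a measure" +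
  fixes U :: "real \<Rightarrow> 'a \<Rightarrow> real"
  assumes random_variable: "\<And>t. 0 \<le> t \<Longrightarrow> random_variable borel (U t)"
    and start: "AE \<omega> in M. U 0 \<omega> = 0"
    and indep_increments:
      "\<And>(t :: nat \<Rightarrow> real) n. 0 \<le> t 0 \<Longrightarrow> mono t \<Longrightarrow>
         indep_vars (\<lambda>_. borel) (\<lambda>i \<omega>. U (t (Suc i)) \<omega> - U (t i) \<omega>) {..<n}"
    and stationary_increments:
      "\<And>s h. 0 \<le> s \<Longrightarrow> 0 \<le> h \<Longrightarrow>
         distr M borel (\<lambda>\<omega>. U (s + h) \<omega> - U s \<omega>) = distr M borel (U h)"
    and cadlag_paths: "\<And>\<omega>. \<omega> \<in> space M \<Longrightarrow> cadlag (\<lambda>t. U t \<omega>)"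

text \<open>The Levy measure of \<open>B\<close> is the expected number of jumps per unit of time with (nonzero) size
  in \<open>B\<close>.\<close>

definition levy_measure :: "'a measure \<Rightarrow> (real \<Rightarrow> 'a \<Rightarrow> real) \<Rightarrow> real set \<Rightarrow> ennreal" where
  "levy_measure M U B =
     (\<integral>\<^sup>+\<omega>. emeasure (count_space UNIV) {t \<in> {0<..1}. jump (\<lambda>s. U s \<omega>) t \<in> B - {0}} \<partial>M)"

definition spectrally_positive :: "'a measure \<Rightarrow> (real \<Rightarrow> 'a \<Rightarrow> real) \<Rightarrow> bool" where
  "spectrally_positive M U \<longleftrightarrow> levy_measure M U {..<0} = 0"

definition central_moment :: "'a measure \<Rightarrow> ('a \<Rightarrow> real) \<Rightarrow> nat \<Rightarrow> real" where
  "central_moment M X k = (\<integral>\<omega>. (X \<omega> - (\<integral>\<omega>'. X \<omega>' \<partial>M)) ^ k \<partial>M)"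

text \<open>Independence of a real random variable and a whole process. The library's \<open>indep_var\<close> needs
  both variables to have the same value type, hence the formulation with generated
  sigma-algebras.\<close>

definition indep_of_process :: "'a measure \<Rightarrow> ('a \<Rightarrow> real) \<Rightarrow> (real \<Rightarrow> 'a \<Rightarrow> real) \<Rightarrow> bool" where
  "indep_of_process M X U \<longleftrightarrow>
     prob_space.indep_set M
       (sets (vimage_algebra (space M) X borel))
       (sets (vimage_algebra (space M) (\<lambda>\<omega>. \<lambda>t\<in>{0..}. U t \<omega>) (PiM {0..} (\<lambda>_. borel))))"

definition net_input :: "(real \<Rightarrow> 'a \<Rightarrow> real) \<Rightarrow> real \<Rightarrow> real \<Rightarrow> real \<Rightarrow> 'a \<Rightarrow> real" where
  "net_input U lam \<mu> t \<omega> = U (lam * t) \<omega> - \<mu> * t"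

definition workload ::
  "(real \<Rightarrow> 'a \<Rightarrow> real) \<Rightarrow> ('a \<Rightarrow> real) \<Rightarrow> real \<Rightarrow> real \<Rightarrow> real \<Rightarrow> 'a \<Rightarrow> real" where
  "workload U Q0 lam \<mu> t \<omega> =
     max (Q0 \<omega> + net_input U lam \<mu> t \<omega>)
         (SUP s\<in>{0..t}. net_input U lam \<mu> t \<omega> - net_input U lam \<mu> s \<omega>)"

definition finite_horizon_cost ::
  "'a measure \<Rightarrow> (real \<Rightarrow> 'a \<Rightarrow> real) \<Rightarrow> ('a \<Rightarrow> real) \<Rightarrow> real \<Rightarrow> real \<Rightarrow> real \<Rightarrow> real \<Rightarrow> real" where
  "finite_horizon_cost M U Q0 lam \<alpha> T \<mu> =
     1 / T * (LBINT t:{0..T}. (\<integral>\<omega>. workload U Q0 lam \<mu> t \<omega> \<partial>M)) + \<alpha> * \<mu>"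

definition stationary_cost :: "real \<Rightarrow> real \<Rightarrow> real \<Rightarrow> real \<Rightarrow> real" where
  "stationary_cost lam \<alpha> u2 \<mu> = lam * u2 / (2 * (\<mu> - lam)) + \<alpha> * \<mu>"

definition mu_infinity :: "real \<Rightarrow> real \<Rightarrow> real \<Rightarrow> real" where
  "mu_infinity lam \<alpha> u2 = lam + sqrt (lam * u2 / (2 * \<alpha>))"

definition mu_bullet :: "real \<Rightarrow> real \<Rightarrow> real \<Rightarrow> real \<Rightarrow> real \<Rightarrow> real" where
  "mu_bullet lam \<alpha> u2 u3 q2 =
     q2 / sqrt (8 * lam * u2 * \<alpha>) - u3 / (3 * u2) - 3 * sqrt (\<alpha> * lam * u2 / 8)"

end

theory Submission
  imports Defs
begin

text \<open>Squaring the reflection recursion gives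
  \<open>E Q(T)^2 = E Q(0)^2 - 2 (\<mu> - lam) \<integral>\<^sub>0\<^sup>T E Q(t) dt + lam u2 T\<close>, since a process without negative jumps
  does not overshoot the boundary when it is reflected. Hence \<open>T\<close> times the finite-horizon cost
  equals \<open>T\<close> times the stationary cost plus \<open>(E Q(0)^2 - E Q(T)^2) / (2 (\<mu> - lam))\<close>. Cubing the
  recursion identifies the limit of \<open>E Q(T)^2\<close> as
  \<open>lam u3 / (3 (\<mu> - lam)) + (lam u2)^2 / (2 (\<mu> - lam)^2)\<close>. The path functional \<open>Q(T)\<close> is a supremum of
  affine functions of \<open>\<mu>\<close>, so costs and second moments are convex in \<open>\<mu>\<close>; therefore difference
  quotients of the second moments converge too, the cost rescaled around its stationary minimizer at
  distance \<open>1 / T\<close> converges to a parabola, and so do its minimizers. All identities are derived for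
  the Lindley recursion on dyadic time grids and passed to the limit by monotone convergence.\<close>

text \<open>Only three moments of the input are available, and these control just two moments of the
  stationary workload: the third moments of the grid chain are finite at each time but may diverge,
  so its cubed recursion cannot simply be passed to the limit. They are compared with third moments
  truncated at a level \<open>K\<close>, whose growth per step is as small as desired while the gap
  between the two stays bounded.

  On a grid the reflection does overshoot, by an amount governed by the cubed negative part of one
  increment. Its mean is shown to be of smaller order than the mesh directly from the paths: absence
  of negative jumps rules out large downward grid steps, independence turns this into a rate for a
  single step, and a comparison with time 1 controls the far tail. No decomposition of the process
  into jumps and a Gaussian part is used.

  The mean workload is not monotone in time when the initial workload is positive. It is the
  difference of two nondecreasing functions, the mean for an empty start and minus the mean excess
  over it, and this supplies integrability, measurability and convergence of Riemann sums.\<close>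

section \<open>Real analysis\<close>

text \<open>Subtracting \<open>s * f 1\<close> leaves an additive function that vanishes on a fine
  grid and is bounded on a short interval, hence bounded everywhere; its multiples
  \<open>real n * g s\<close> are values too, so it is 0. Applied to moments of \<open>U s\<close>
  as functions of time.\<close>

lemma additive_bounded_imp_linear:
  fixes f :: "real \<Rightarrow> real"
  assumes add: "\<And>s t. 0 \<le> s \<Longrightarrow> 0 \<le> t \<Longrightarrow> f (s + t) = f s + f t"
    and "0 < e" and bnd: "\<And>s. 0 \<le> s \<Longrightarrow> s \<le> e \<Longrightarrow> \<bar>f s\<bar> \<le> B" and "0 \<le> s"
  shows "f s = s * f 1"
proof -
  define g where "g s = f s - s * f 1" for s
  have g_add: "g (s + t) = g s + g t" if "0 \<le> s" "0 \<le> t" for s t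
    using add[OF that] by (simp add: g_def algebra_simps)
  have g_mult: "g (real n * s) = real n * g s" if "0 \<le> s" for n s
  proof (induction n)
    case 0
    then show ?case using g_add[of 0 0] by simp
  next
    case (Suc n)
    then show ?case using g_add[of "real n * s" s] that by (simp add: algebra_simps)
  qed
  have g1: "g 1 = 0" by (simp add: g_def)
  define C where "C = B + e * \<bar>f 1\<bar>"
  have g_small: "\<bar>g s\<bar> \<le> C" if "0 \<le> s" "s \<le> e" for s
  proof -
    have "\<bar>s * f 1\<bar> \<le> e * \<bar>f 1\<bar>" using that by (simp add: abs_mult mult_right_mono)
    then show ?thesis using bnd[OF that] unfolding g_def C_def by linarith
  qed
  \<comment> \<open>With \<open>1 / N < e\<close>, every \<open>s\<close> is a multiple of
    \<open>1 / N\<close>, where \<open>g\<close> vanishes, plus a remainder in the interval on which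
    \<open>g\<close> is bounded.\<close>
  obtain N :: nat where N: "1 / e < real N" using reals_Archimedean2 by blast
  have N0: "0 < real N" using N \<open>0 < e\<close> by (meson less_trans zero_less_divide_1_iff)
  have gN: "g (real k / real N) = 0" for k
  proof -
    have "real N * g (real k / real N) = g (real N * (real k / real N))"
      using g_mult[of "real k / real N" N] by simp
    also have "\<dots> = g (real k * 1)" using N0 by simp
    also have "\<dots> = 0" using g_mult[of 1 k] g1 by simp
    finally show ?thesis using N0 by simp
  qed
  have g_bnd: "\<bar>g s\<bar> \<le> C" if "0 \<le> s" for s
  proof -
    define k where "k = nat \<lfloor>s * real N\<rfloor>"
    have k: "real k \<le> s * real N" "s * real N < real k + 1"
      using that N0 unfolding k_def by (auto simp: of_nat_nat)
    define r where "r = s - real k / real N"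
    have "r \<ge> 0" using k N0 by (simp add: r_def field_simps)
    have "s < (real k + 1) / real N" using k(2) N0 by (simp add: pos_less_divide_eq)
    then have "r < 1 / real N" by (simp add: r_def add_divide_distrib)
    also have "1 / real N < e" using N N0 \<open>0 < e\<close> by (simp add: field_simps)
    finally have "r \<le> e" by simp
    have "g s = g (real k / real N) + g r"
      using g_add[of "real k / real N" r] \<open>r \<ge> 0\<close> N0 by (simp add: r_def)
    then show ?thesis using gN g_small[OF \<open>r \<ge> 0\<close> \<open>r \<le> e\<close>] by simp
  qed
  have "g s = 0"
  proof (rule ccontr)
    assume "g s \<noteq> 0"
    then obtain n :: nat where n: "C / \<bar>g s\<bar> < real n" using reals_Archimedean2 by blast
    have "C < real n * \<bar>g s\<bar>" using n \<open>g s \<noteq> 0\<close> by (simp add: field_simps)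
    also have "\<dots> = \<bar>g (real n * s)\<bar>" using g_mult[OF \<open>0 \<le> s\<close>] by (simp add: abs_mult)
    also have "\<dots> \<le> C" using g_bnd \<open>0 \<le> s\<close> by simp
    finally show False by simp
  qed
  then show ?thesis by (simp add: g_def)
qed

text \<open>If the minimizer lay outside the interval, one endpoint would lie between it and
  \<open>b\<close>, and convexity would bound the value there by the smaller values at both. Three
  function values thus locate a minimizer without derivatives.\<close>

lemma convex_minimizer_between:
  fixes f :: "real \<Rightarrow> real"
  assumes cvx: "convex_on S f" and S: "a \<in> S" "c \<in> S" "m \<in> S" and "a < b" "b < c"
    and less: "f b < f a" "f b < f c" and min: "\<And>x. x \<in> S \<Longrightarrow> f m \<le> f x"
  shows "a < m" "m < c"
proof -
  have ivl: "convex S" using cvx by (simp add: convex_on_def)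
  have bS: "b \<in> S" using ivl S(1,2) \<open>a < b\<close> \<open>b < c\<close>
    by (meson convex_contains_segment closed_segment_eq_real_ivl less_imp_le atLeastAtMost_iff subsetD
        is_interval_convex_1 mem_is_interval_1_I)
  have mb: "f m \<le> f b" using min bS by blast
  have key: "f y \<le> max (f x) (f z)" if "x \<in> S" "z \<in> S" "x \<le> y" "y \<le> z" "x < z" for x y z
  proof -
    define t where "t = (y - x) / (z - x)"
    have t: "0 \<le> t" "t \<le> 1" using that by (auto simp: t_def)
    have y: "y = (1 - t) * x + t * z"
    proof -
      have "t * (z - x) = y - x" using that by (simp add: t_def)
      then show ?thesis by (simp add: algebra_simps)
    qed
    have "f ((1 - t) *\<^sub>R x + t *\<^sub>R z) \<le> (1 - t) * f x + t * f z"
      using convex_onD[OF cvx t] that by blast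
    also have "\<dots> \<le> (1 - t) * max (f x) (f z) + t * max (f x) (f z)"
      using t by (intro add_mono mult_left_mono) auto
    also have "\<dots> = max (f x) (f z)" by (simp add: algebra_simps)
    finally show ?thesis using y by simp
  qed
  show "a < m"
  proof (rule ccontr)
    assume "\<not> a < m"
    then have "f a \<le> max (f m) (f b)" using key[of m b a] S bS \<open>a < b\<close> by simp
    then show False using mb less by linarith
  qed
  show "m < c"
  proof (rule ccontr)
    assume "\<not> m < c"
    then have "f c \<le> max (f b) (f m)" using key[of b m c] S bS \<open>b < c\<close> by simp
    then show False using mb less by linarith
  qed
qed

lemma convex_slope_le:
  fixes f :: "real \<Rightarrow> real"
  assumes cvx: "convex_on S f" and S: "x \<in> S" "z \<in> S" and "x < y" "y < z"
  shows "(f y - f x) / (y - x) \<le> (f z - f x) / (z - x)"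
    and "(f z - f x) / (z - x) \<le> (f z - f y) / (z - y)"
proof -
  define t where "t = (y - x) / (z - x)"
  have t: "0 \<le> t" "t \<le> 1" "0 < t" "t < 1" using assms by (auto simp: t_def)
  have yx: "y - x = t * (z - x)" using assms by (simp add: t_def)
  then have y: "y = (1 - t) * x + t * z" by (simp add: algebra_simps)
  have zy: "z - y = (1 - t) * (z - x)" using y by (simp add: algebra_simps)
  have f: "f y \<le> (1 - t) * f x + t * f z"
    using convex_onD[OF cvx t(1,2) S] y by simp
  then have 1: "f y - f x \<le> t * (f z - f x)" and 2: "(1 - t) * (f z - f x) \<le> f z - f y"
    by (simp_all add: algebra_simps)
  have zx: "z - x > 0" using assms by simp
  show "(f y - f x) / (y - x) \<le> (f z - f x) / (z - x)"
  proof -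
    have "(f y - f x) / (y - x) \<le> (t * (f z - f x)) / (t * (z - x))"
      unfolding yx using 1 t zx by (intro divide_right_mono) auto
    also have "\<dots> = (f z - f x) / (z - x)" using t by simp
    finally show ?thesis .
  qed
  show "(f z - f x) / (z - x) \<le> (f z - f y) / (z - y)"
  proof -
    have "(f z - f x) / (z - x) = ((1 - t) * (f z - f x)) / ((1 - t) * (z - x))" using t by simp
    also have "\<dots> \<le> (f z - f y) / ((1 - t) * (z - x))"
      using 2 t zx by (intro divide_right_mono) auto
    finally show ?thesis using zy by simp
  qed
qed

text \<open>The slope over the shrinking step \<open>y / T\<close> is squeezed between slopes of
  fixed chords left and right of \<open>x\<close>, whose limits are close to \<open>D\<close>.
  Convexity thereby replaces any rate of convergence of \<open>F T\<close> to
  \<open>G\<close>.\<close>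

lemma convex_difference_quotient_tendsto:
  fixes F :: "real \<Rightarrow> real \<Rightarrow> real"
  assumes cvx: "\<And>T. 0 < T \<Longrightarrow> convex_on {l<..} (F T)" and "l < x"
    and lim: "\<And>z. l < z \<Longrightarrow> ((\<lambda>T. F T z) \<longlongrightarrow> G z) at_top"
    and der: "(G has_real_derivative D) (at x)"
  shows "((\<lambda>T. T * (F T (x + y / T) - F T x)) \<longlongrightarrow> D * y) at_top"
proof -
  \<comment> \<open>Stated for arbitrary functions and on an interval symmetric about
    \<open>x\<close>, so that it applies again, for negative \<open>y\<close>, to the reflection
    \<open>z \<mapsto> 2 * x - z\<close>; a half-line would not be preserved.\<close>
  have pos: "((\<lambda>T. T * (F T (x + y / T) - F T x)) \<longlongrightarrow> D * y) at_top"
    if der: "(G has_real_derivative D) (at x)" and "l < x" "y > 0"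
      and lim: "\<And>z. \<bar>z - x\<bar> < x - l \<Longrightarrow> ((\<lambda>T. F T z) \<longlongrightarrow> G z) at_top"
      and cvx: "\<And>T. 0 < T \<Longrightarrow> convex_on {z. \<bar>z - x\<bar> < x - l} (F T)"
    for G :: "real \<Rightarrow> real" and D l x y and F :: "real \<Rightarrow> real \<Rightarrow> real"
  proof (rule tendstoI)
    fix e :: real assume "e > 0"
    \<comment> \<open>The chord of \<open>G\<close> and the convergence of \<open>F T\<close> cost
      one \<open>e'\<close> each; multiplying by \<open>y\<close> gives \<open>e\<close>.\<close>
    define e' where "e' = e / (2 * y)"
    have "e' > 0" using \<open>e > 0\<close> \<open>y > 0\<close> by (simp add: e'_def)
    have "((\<lambda>h. (G (x + h) - G x) / h) \<longlongrightarrow> D) (at 0)"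
      using der by (simp add: DERIV_def)
    then have "\<forall>\<^sub>F h in at 0. dist ((G (x + h) - G x) / h) D < e'"
      using \<open>e' > 0\<close> by (rule tendstoD)
    then obtain d where d: "d > 0" "\<And>h. h \<noteq> 0 \<Longrightarrow> \<bar>h\<bar> < d \<Longrightarrow> \<bar>(G (x + h) - G x) / h - D\<bar> < e'"
      unfolding eventually_at by (auto simp: dist_real_def)
    define \<eta> where "\<eta> = min (d / 2) ((x - l) / 2)"
    have \<eta>: "\<eta> > 0" "\<eta> < d" "\<eta> < x - l" using d \<open>l < x\<close> unfolding \<eta>_def by (auto simp: min_def)
    have G1: "\<bar>(G (x + \<eta>) - G x) / \<eta> - D\<bar> < e'" using d(2)[of \<eta>] \<eta> by simp
    have "\<bar>(G (x + - \<eta>) - G x) / (- \<eta>) - D\<bar> < e'" using d(2)[of "- \<eta>"] \<eta> by simp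
    then have G2: "\<bar>(G x - G (x - \<eta>)) / \<eta> - D\<bar> < e'" using \<eta> by (simp add: field_simps)
    have l1: "((\<lambda>T. (F T (x + \<eta>) - F T x) / \<eta>) \<longlongrightarrow> (G (x + \<eta>) - G x) / \<eta>) at_top"
      using \<eta> \<open>l < x\<close> by (intro tendsto_intros lim) auto
    have l2: "((\<lambda>T. (F T x - F T (x - \<eta>)) / \<eta>) \<longlongrightarrow> (G x - G (x - \<eta>)) / \<eta>) at_top"
      using \<eta> \<open>l < x\<close> by (intro tendsto_intros lim) auto
    have E1: "\<forall>\<^sub>F T in at_top. dist ((F T (x + \<eta>) - F T x) / \<eta>) ((G (x + \<eta>) - G x) / \<eta>) < e'"
      using l1 \<open>e' > 0\<close> by (rule tendstoD)
    have E2: "\<forall>\<^sub>F T in at_top. dist ((F T x - F T (x - \<eta>)) / \<eta>) ((G x - G (x - \<eta>)) / \<eta>) < e'"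
      using l2 \<open>e' > 0\<close> by (rule tendstoD)
    have E3: "\<forall>\<^sub>F T in at_top. T > y / \<eta>" by (rule eventually_gt_at_top)
    show "\<forall>\<^sub>F T in at_top. dist (T * (F T (x + y / T) - F T x)) (D * y) < e"
      using E1 E2 E3
    proof eventually_elim
      case (elim T)
      have T: "T > 0" using elim(3) \<open>y > 0\<close> \<eta> by (meson divide_pos_pos less_trans)
      have yT: "0 < y / T" "y / T < \<eta>" using T \<open>y > 0\<close> elim(3) \<eta> by (auto simp: field_simps)
      define A where "A = (F T (x + y / T) - F T x) / (y / T)"
      have AT: "T * (F T (x + y / T) - F T x) = A * y" using T \<open>y > 0\<close> by (simp add: A_def)
      have "A \<le> (F T (x + \<eta>) - F T x) / \<eta>"
        using convex_slope_le(1)[OF cvx[OF T], of x "x + \<eta>" "x + y / T"] \<eta> yT \<open>l < x\<close>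
        by (simp add: A_def)
      then have u: "A < D + 2 * e'" using elim(1) G1 unfolding dist_real_def by linarith
      \<comment> \<open>Slopes are compared for nested chords with a common endpoint, so the chord
        from \<open>x - \<eta>\<close> to \<open>x + y / T\<close> serves as the intermediate
        one.\<close>
      have s: "(F T x - F T (x - \<eta>)) / \<eta> \<le> (F T (x + y / T) - F T (x - \<eta>)) / (y / T + \<eta>)"
        using convex_slope_le(1)[OF cvx[OF T], of "x - \<eta>" "x + y / T" x] \<eta> yT \<open>l < x\<close>
        by (simp add: algebra_simps)
      have "(F T (x + y / T) - F T (x - \<eta>)) / (y / T + \<eta>) \<le> A"
        using convex_slope_le(2)[OF cvx[OF T], of "x - \<eta>" "x + y / T" x] \<eta> yT \<open>l < x\<close>
        by (simp add: A_def algebra_simps)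
      then have o: "A > D - 2 * e'" using s elim(2) G2 unfolding dist_real_def by linarith
      have "\<bar>A - D\<bar> < 2 * e'" using u o by linarith
      then have "\<bar>A - D\<bar> * y < 2 * e' * y" using \<open>y > 0\<close> by simp
      also have "2 * e' * y = e" using \<open>y > 0\<close> by (simp add: e'_def)
      finally have "\<bar>(A - D) * y\<bar> < e" using \<open>y > 0\<close> by (simp add: abs_mult)
      then show ?case unfolding AT dist_real_def by (simp add: left_diff_distrib)
    qed
  qed
  have cvx': "convex_on {z. \<bar>z - x\<bar> < x - l} (F T)" if "0 < T" for T
  proof (rule convex_on_subset[OF cvx[OF that]])
    show "convex {z. \<bar>z - x\<bar> < x - l}"
      using convex_ball[of x "x - l"] by (simp add: ball_def dist_real_def abs_minus_commute)
  qed auto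
  consider "y > 0" | "y = 0" | "y < 0" by linarith
  then show ?thesis
  proof cases
    case 1
    show ?thesis by (rule pos[OF der \<open>l < x\<close> 1 _ cvx']) (auto intro: lim)
  next
    case 2
    then show ?thesis by simp
  next
    case 3
    let ?F = "\<lambda>T z. F T (2 * x - z)" and ?G = "\<lambda>z. G (2 * x - z)"
    have d: "(?G has_real_derivative - D) (at x)"
    proof -
      have "((\<lambda>z. G (2 * x - z)) has_real_derivative D * (0 - 1)) (at x)"
        by (rule DERIV_chain2[where g = "\<lambda>z. 2 * x - z" and f = G])
           (auto intro!: derivative_eq_intros simp: der)
      then show ?thesis by simp
    qed
    have c: "convex_on {z. \<bar>z - x\<bar> < x - l} (?F T)" if "0 < T" for T
    proof (rule convex_onI)
      show "convex {z. \<bar>z - x\<bar> < x - l}" using cvx'[OF that] by (simp add: convex_on_def)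
      fix t u v :: real assume t: "0 < t" "t < 1"
        and uv: "u \<in> {z. \<bar>z - x\<bar> < x - l}" "v \<in> {z. \<bar>z - x\<bar> < x - l}"
      have eq: "2 * x - ((1 - t) *\<^sub>R u + t *\<^sub>R v) = (1 - t) *\<^sub>R (2 * x - u) + t *\<^sub>R (2 * x - v)"
        by (simp add: algebra_simps)
      show "?F T ((1 - t) *\<^sub>R u + t *\<^sub>R v) \<le> (1 - t) * ?F T u + t * ?F T v"
        unfolding eq using t uv by (intro convex_onD[OF cvx'[OF that]]) auto
    qed
    have "((\<lambda>T. T * (?F T (x + (- y) / T) - ?F T x)) \<longlongrightarrow> (- D) * (- y)) at_top"
      using 3 by (intro pos[OF d \<open>l < x\<close> _ _ c]) (auto intro: lim)
    then show ?thesis by (simp add: algebra_simps)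
  qed
qed

section \<open>Cadlag paths and the Lindley recursion on a grid\<close>

text \<open>One radius serves both sides of \<open>s\<close>. At \<open>s = 0\<close> there is
  nothing on the left and \<open>l\<close> is an arbitrary value, which is why its identification
  with the left limit is conditional.\<close>

lemma cadlag_near:
  assumes "cadlag f" "0 \<le> s" "0 < e"
  obtains r l where "0 < r" "\<And>u. s \<le> u \<Longrightarrow> u < s + r \<Longrightarrow> \<bar>f u - f s\<bar> < e"
    "\<And>u. 0 \<le> u \<Longrightarrow> s - r < u \<Longrightarrow> u < s \<Longrightarrow> \<bar>f u - l\<bar> < e"
    "0 < s \<Longrightarrow> l = Lim (at_left s) f"
proof -
  have "(f \<longlongrightarrow> f s) (at_right s)" using assms by (simp add: cadlag_def)
  then have "\<forall>\<^sub>F u in at_right s. dist (f u) (f s) < e" using \<open>0 < e\<close> by (rule tendstoD)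
  then obtain b where b: "b > s" "\<And>u. s < u \<Longrightarrow> u < b \<Longrightarrow> \<bar>f u - f s\<bar> < e"
    unfolding eventually_at_right_field by (auto simp: dist_real_def)
  show thesis
  proof (cases "s = 0")
    case True
    show thesis
    proof (rule that[of "b - s" 0])
      show "\<bar>f u - f s\<bar> < e" if "s \<le> u" "u < s + (b - s)" for u
        using that b(2)[of u] \<open>0 < e\<close> by (cases "u = s") auto
    qed (use b True in auto)
  next
    case False
    then have "0 < s" using assms by simp
    then obtain l where l: "(f \<longlongrightarrow> l) (at_left s)" using assms by (auto simp: cadlag_def)
    then have "\<forall>\<^sub>F u in at_left s. dist (f u) l < e" using \<open>0 < e\<close> by (rule tendstoD)
    then obtain a where a: "a < s" "\<And>u. a < u \<Longrightarrow> u < s \<Longrightarrow> \<bar>f u - l\<bar> < e"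
      unfolding eventually_at_left_field by (auto simp: dist_real_def)
    show thesis
    proof (rule that[of "min (b - s) (s - a)" l])
      show "\<bar>f u - f s\<bar> < e" if "s \<le> u" "u < s + min (b - s) (s - a)" for u
        using that b(2)[of u] \<open>0 < e\<close> by (cases "u = s") auto
      show "l = Lim (at_left s) f" using tendsto_Lim[OF _ l] by simp
    qed (use a b in auto)
  qed
qed

text \<open>Compactness by bisection. The intervals are cut with \<open>{0..}\<close> because those
  around 0 reach into negative times, where nothing is known about the path.\<close>

lemma cadlag_bounded:
  assumes "cadlag f" "0 \<le> t"
  shows "bounded (f ` {0..t})"
proof -
  let ?P = "\<lambda>a b. bounded (f ` ({a..b} \<inter> {0..}))"
  have "?P 0 t"
  proof (rule Bolzano[where P = ?P, OF \<open>0 \<le> t\<close>])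
    fix a b c :: real assume "?P a b" "?P b c" "a \<le> b" "b \<le> c"
    have "f ` ({a..c} \<inter> {0..}) \<subseteq> f ` ({a..b} \<inter> {0..}) \<union> f ` ({b..c} \<inter> {0..})" by force
    then show "?P a c" using \<open>?P a b\<close> \<open>?P b c\<close> by (meson bounded_Un bounded_subset)
  next
    fix x :: real assume "0 \<le> x" "x \<le> t"
    obtain r l where r: "0 < r" "\<And>u. x \<le> u \<Longrightarrow> u < x + r \<Longrightarrow> \<bar>f u - f x\<bar> < 1"
      "\<And>u. 0 \<le> u \<Longrightarrow> x - r < u \<Longrightarrow> u < x \<Longrightarrow> \<bar>f u - l\<bar> < 1"
      using cadlag_near[OF assms(1) \<open>0 \<le> x\<close>, of 1] by (metis zero_less_one)
    have "?P a b" if "a \<le> x" "x \<le> b" "b - a < r" for a b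
    proof (rule boundedI)
      fix y assume "y \<in> f ` ({a..b} \<inter> {0..})"
      then obtain u where u: "y = f u" "a \<le> u" "u \<le> b" "0 \<le> u" by auto
      show "norm y \<le> \<bar>f x\<bar> + \<bar>l\<bar> + 1"
        using r(2)[of u] r(3)[of u] u that by (cases "u < x") auto
    qed
    then show "\<exists>d>0. \<forall>a b. a \<le> x \<and> x \<le> b \<and> b - a < d \<longrightarrow> ?P a b" using \<open>0 < r\<close> by blast
  qed
  then show ?thesis by (rule bounded_subset) auto
qed

lemma cadlag_bdd_above:
  assumes "cadlag f" "0 \<le> t"
  shows "bdd_above ((\<lambda>s. f t - f s) ` {0..t})"
proof -
  have "bounded (f ` {0..t})" by (rule cadlag_bounded[OF assms])
  then obtain B where "\<forall>y\<in>f ` {0..t}. norm y \<le> B" unfolding bounded_iff by blast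
  then show ?thesis by (intro bdd_aboveI[of _ "f t + B"]) force
qed

text \<open>One half of uniform continuity. Across a point \<open>s\<close> the path goes from near
  the left limit to near \<open>f s\<close>, which is no smaller, so near each point decreases are
  small; a Lebesgue number of the resulting cover makes this uniform.\<close>

lemma cadlag_no_negative_jumps_increment:
  assumes f: "cadlag f" and "0 < e" and nojump: "\<And>s. 0 < s \<Longrightarrow> s \<le> T \<Longrightarrow> 0 \<le> jump f s"
  obtains d where "0 < d"
    "\<And>u v. 0 \<le> u \<Longrightarrow> u < v \<Longrightarrow> v \<le> T \<Longrightarrow> v - u < d \<Longrightarrow> - e \<le> f v - f u"
proof -
  define good where "good s r \<longleftrightarrow>
    0 < r \<and> (\<forall>u v. 0 \<le> u \<longrightarrow> u < v \<longrightarrow> s - r < u \<longrightarrow> v < s + r \<longrightarrow> - e \<le> f v - f u)" for s r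
  have ex: "\<exists>r. good s r" if s: "0 \<le> s" "s \<le> T" for s
  proof -
    obtain r l where r: "0 < r" "\<And>u. s \<le> u \<Longrightarrow> u < s + r \<Longrightarrow> \<bar>f u - f s\<bar> < e / 2"
      "\<And>u. 0 \<le> u \<Longrightarrow> s - r < u \<Longrightarrow> u < s \<Longrightarrow> \<bar>f u - l\<bar> < e / 2"
      "0 < s \<Longrightarrow> l = Lim (at_left s) f"
      using cadlag_near[OF f s(1), of "e / 2"] \<open>0 < e\<close> by (metis half_gt_zero)
    have "- e \<le> f v - f u" if "0 \<le> u" "u < v" "s - r < u" "v < s + r" for u v
    proof -
      consider "v < s" | "u < s" "s \<le> v" | "s \<le> u" by linarith
      then show ?thesis
      proof cases
        case 1
        then show ?thesis using r(3)[of u] r(3)[of v] that by linarith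
      next
        case 2
        then have "0 < s" using that by simp
        then have "l \<le> f s" using nojump[of s] s r(4) by (simp add: jump_def)
        then show ?thesis using 2 r(3)[of u] r(2)[of v] that by linarith
      next
        case 3
        then show ?thesis using r(2)[of u] r(2)[of v] that by linarith
      qed
    qed
    then show ?thesis using \<open>0 < r\<close> by (auto simp: good_def)
  qed
  then obtain R where R: "\<And>s. s \<in> {0..T} \<Longrightarrow> good s (R s)" by (metis atLeastAtMost_iff)
  have cov: "{0..T} \<subseteq> \<Union> ((\<lambda>s. ball s (R s)) ` {0..T})"
    using R by (force simp: good_def)
  obtain d where d: "0 < d" "\<And>x. x \<in> {0..T} \<Longrightarrow> \<exists>G\<in>(\<lambda>s. ball s (R s)) ` {0..T}. ball x d \<subseteq> G"
    using Heine_Borel_lemma[OF compact_Icc cov] by (metis (no_types, lifting) imageE open_ball)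
  show thesis
  proof (rule that[OF \<open>0 < d\<close>])
    fix u v assume uv: "0 \<le> u" "u < v" "v \<le> T" "v - u < d"
    obtain s where s: "s \<in> {0..T}" "ball u d \<subseteq> ball s (R s)" using d(2)[of u] uv by auto
    have "u \<in> ball u d" "v \<in> ball u d" using uv \<open>0 < d\<close> by (auto simp: dist_real_def)
    then have "u \<in> ball s (R s)" "v \<in> ball s (R s)" using s(2) by blast+
    then have "s - R s < u" "v < s + R s" by (auto simp: dist_real_def)
    then show "- e \<le> f v - f u" using R[OF s(1)] uv by (auto simp: good_def)
  qed
qed

lemma cadlag_rescale:
  assumes "cadlag f" "0 < c"
  shows "cadlag (\<lambda>t. f (c * t) - m * t)"
  unfolding cadlag_def
proof safe
  fix t :: real assume "0 \<le> t"
  have lim: "filterlim (\<lambda>t. c * t) (at_right (c * t)) (at_right t)"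
    unfolding filterlim_at
  proof
    show "\<forall>\<^sub>F u in at_right t. c * u \<in> {c * t<..} \<and> c * u \<noteq> c * t"
      using \<open>0 < c\<close> by (intro eventually_at_rightI[of t "t + 1"]) auto
  qed (rule tendsto_mult_left[OF tendsto_ident_at])
  have "(f \<longlongrightarrow> f (c * t)) (at_right (c * t))" using assms \<open>0 \<le> t\<close> by (simp add: cadlag_def)
  then have "((\<lambda>t. f (c * t)) \<longlongrightarrow> f (c * t)) (at_right t)" using lim by (rule filterlim_compose)
  then show "((\<lambda>t. f (c * t) - m * t) \<longlongrightarrow> f (c * t) - m * t) (at_right t)"
    by (intro tendsto_intros)
next
  fix t :: real assume "0 < t"
  have lim: "filterlim (\<lambda>t. c * t) (at_left (c * t)) (at_left t)"
    unfolding filterlim_at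
  proof
    show "\<forall>\<^sub>F u in at_left t. c * u \<in> {..<c * t} \<and> c * u \<noteq> c * t"
      using \<open>0 < c\<close> by (intro eventually_at_leftI[of "t - 1"]) auto
  qed (rule tendsto_mult_left[OF tendsto_ident_at])
  have "0 < c * t" using \<open>0 < c\<close> \<open>0 < t\<close> by simp
  then obtain l where "(f \<longlongrightarrow> l) (at_left (c * t))" using assms unfolding cadlag_def by blast
  then have "((\<lambda>t. f (c * t)) \<longlongrightarrow> l) (at_left t)" using lim by (rule filterlim_compose)
  then have "((\<lambda>t. f (c * t) - m * t) \<longlongrightarrow> l - m * t) (at_left t)"
    by (intro tendsto_intros)
  then show "\<exists>l. ((\<lambda>t. f (c * t) - m * t) \<longlongrightarrow> l) (at_left t)" by blast
qed

primrec lindley :: "real \<Rightarrow> (nat \<Rightarrow> real) \<Rightarrow> nat \<Rightarrow> real" where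
  "lindley q x 0 = q"
| "lindley q x (Suc n) = max 0 (lindley q x n + x n)"

text \<open>The offset \<open>s\<close> lets the recursion start late; comparing such a start with
  one at time 0 is the source of monotonicity in time.\<close>

definition grid_increment :: "(real \<Rightarrow> real) \<Rightarrow> real \<Rightarrow> real \<Rightarrow> nat \<Rightarrow> real" where
  "grid_increment f s h i = f (s + real (Suc i) * h) - f (s + real i * h)"

definition grid_lindley :: "real \<Rightarrow> (real \<Rightarrow> real) \<Rightarrow> real \<Rightarrow> real \<Rightarrow> nat \<Rightarrow> real" where
  "grid_lindley q f s h = lindley q (grid_increment f s h)"

lemma grid_lindley_simps [simp]:
  "grid_lindley q f s h 0 = q"
  "grid_lindley q f s h (Suc n) = max 0 (grid_lindley q f s h n + grid_increment f s h n)"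
  by (simp_all add: grid_lindley_def)

lemma grid_lindley_nonneg: "0 \<le> q \<Longrightarrow> 0 \<le> grid_lindley q f s h n"
  by (cases n) auto

lemma grid_lindley_ge_start: "q + (f (s + real n * h) - f s) \<le> grid_lindley q f s h n"
  by (induction n) (auto simp: grid_increment_def)

lemma grid_lindley_ge:
  assumes "0 \<le> q" "i \<le> n"
  shows "f (s + real n * h) - f (s + real i * h) \<le> grid_lindley q f s h n"
  using \<open>i \<le> n\<close>
proof (induction n rule: dec_induct)
  case base
  then show ?case using grid_lindley_nonneg[OF \<open>0 \<le> q\<close>] by simp
next
  case (step n)
  then show ?case by (auto simp: grid_increment_def)
qed

text \<open>Together with the two preceding lower bounds this solves the recursion: its value is the
  largest of finitely many increments, the one over the whole time being raised by
  \<open>q\<close>.\<close>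

lemma grid_lindley_cases:
  "grid_lindley q f s h n = q + (f (s + real n * h) - f s) \<or>
   (\<exists>i\<le>n. grid_lindley q f s h n = f (s + real n * h) - f (s + real i * h))"
proof (induction n)
  case (Suc n)
  show ?case
  proof (cases "grid_lindley q f s h n + grid_increment f s h n \<le> 0")
    case True
    then show ?thesis by (intro disjI2 exI[of _ "Suc n"]) simp
  next
    case False
    then have *: "grid_lindley q f s h (Suc n) = grid_lindley q f s h n + grid_increment f s h n"
      by simp
    from Suc show ?thesis
    proof (elim disjE exE conjE)
      assume "grid_lindley q f s h n = q + (f (s + real n * h) - f s)"
      then show ?thesis unfolding * by (intro disjI1) (simp add: grid_increment_def)
    next
      fix i assume "i \<le> n" "grid_lindley q f s h n = f (s + real n * h) - f (s + real i * h)"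
      then show ?thesis unfolding * by (intro disjI2 exI[of _ i]) (simp add: grid_increment_def)
    qed
  qed
qed simp

text \<open>A finer grid reaches the same time and maximizes over more starting points. Along dyadic
  meshes the approximations therefore increase, which opens the way to monotone convergence.\<close>

lemma grid_lindley_refine:
  assumes "0 \<le> q" "0 < k"
  shows "grid_lindley q f s h n \<le> grid_lindley q f s (h / real k) (k * n)"
proof -
  have e: "real (k * i) * (h / real k) = real i * h" for i
    using \<open>0 < k\<close> by simp
  show ?thesis
    using grid_lindley_cases[of q f s h n]
  proof (elim disjE exE conjE)
    assume "grid_lindley q f s h n = q + (f (s + real n * h) - f s)"
    then show ?thesis using grid_lindley_ge_start[of q f s "k * n" "h / real k"] unfolding e by simp
  next
    fix i assume "i \<le> n" "grid_lindley q f s h n = f (s + real n * h) - f (s + real i * h)"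
    then show ?thesis
      using grid_lindley_ge[OF \<open>0 \<le> q\<close>, of "k * i" "k * n" f s "h / real k"] unfolding e by simp
  qed
qed

lemma grid_lindley_dyadic_mono:
  assumes "0 \<le> q" "m \<le> m'"
  shows "grid_lindley q f s (H / 2 ^ m) (j * 2 ^ m) \<le> grid_lindley q f s (H / 2 ^ m') (j * 2 ^ m')"
proof -
  have "(2::nat) ^ m' = 2 ^ (m' - m) * 2 ^ m" "(2::real) ^ m' = 2 ^ m * 2 ^ (m' - m)"
    using \<open>m \<le> m'\<close> by (simp_all flip: power_add)
  then show ?thesis
    using grid_lindley_refine[OF \<open>0 \<le> q\<close>, of "2 ^ (m' - m)" f s "H / 2 ^ m" "j * 2 ^ m"]
    by (simp add: ac_simps)
qed

lemma dyadic_between: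
  fixes s u :: real
  assumes "0 \<le> s" "s < u" "0 < H"
  shows "\<forall>\<^sub>F m in sequentially. \<exists>i::nat. s < real i * (H / 2 ^ m) \<and> real i * (H / 2 ^ m) < u"
proof -
  have "(\<lambda>m. H * (1 / 2) ^ m) \<longlonglongrightarrow> H * 0" by (intro tendsto_intros LIMSEQ_power_zero) auto
  then have "\<forall>\<^sub>F m in sequentially. H * (1 / 2) ^ m < u - s"
    by (rule order_tendstoD(2)) (use assms in auto)
  then show ?thesis
  proof eventually_elim
    case (elim m)
    define h where "h = H / 2 ^ m"
    have h: "0 < h" "h < u - s" using elim \<open>0 < H\<close> by (auto simp: h_def power_divide)
    define i where "i = nat \<lfloor>s / h\<rfloor> + 1"
    have "0 \<le> s / h" using h assms by simp
    then have "real i = of_int \<lfloor>s / h\<rfloor> + 1" by (simp add: i_def)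
    then have "s / h < real i" "real i \<le> s / h + 1" by linarith+
    then have "s < real i * h" "real i * h \<le> s + h" using h by (simp_all add: field_simps)
    then show ?case using h unfolding h_def by (intro exI[of _ i]) auto
  qed
qed

text \<open>A point nearly attaining the supremum is approached from the right by grid points, where
  right-continuity keeps the value. Writing the time as \<open>j * H\<close> makes it a point of
  every grid.\<close>

lemma grid_lindley_tendsto:
  assumes f: "cadlag f" and "0 \<le> q" "0 < H"
  shows "(\<lambda>m. grid_lindley q f 0 (H / 2 ^ m) (j * 2 ^ m)) \<longlonglongrightarrow>
    max (q + f (real j * H) - f 0) (SUP s\<in>{0..real j * H}. f (real j * H) - f s)"
proof -
  define t where "t = real j * H"
  have t0: "0 \<le> t" using \<open>0 < H\<close> by (simp add: t_def)
  have t: "real (j * 2 ^ m) * (H / 2 ^ m) = t" for m by (simp add: t_def)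
  have bdd: "bdd_above ((\<lambda>s. f t - f s) ` {0..t})" by (rule cadlag_bdd_above[OF f t0])
  define S where "S = (SUP s\<in>{0..t}. f t - f s)"
  let ?G = "\<lambda>m. grid_lindley q f 0 (H / 2 ^ m) (j * 2 ^ m)"
  have S_ge: "f t - f s \<le> S" if "0 \<le> s" "s \<le> t" for s
    unfolding S_def using that by (intro cSUP_upper bdd) auto
  have S0: "0 \<le> S" using S_ge[of t] t0 by simp
  have upper: "?G m \<le> max (q + f t - f 0) S" for m
    using grid_lindley_cases[of q f 0 "H / 2 ^ m" "j * 2 ^ m"]
  proof (elim disjE exE conjE)
    fix i assume i: "i \<le> j * 2 ^ m"
      and eq: "?G m = f (0 + real (j * 2 ^ m) * (H / 2 ^ m)) - f (0 + real i * (H / 2 ^ m))"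
    have "real i * (H / 2 ^ m) \<le> real (j * 2 ^ m) * (H / 2 ^ m)"
      using i \<open>0 < H\<close> by (intro mult_right_mono) (auto simp del: of_nat_mult of_nat_power)
    then show ?thesis
      unfolding eq t using S_ge[of "real i * (H / 2 ^ m)"] \<open>0 < H\<close> t by simp
  next
    assume eq: "?G m = q + (f (0 + real (j * 2 ^ m) * (H / 2 ^ m)) - f 0)"
    show ?thesis unfolding eq t by simp
  qed
  show ?thesis
    unfolding t_def[symmetric] S_def[symmetric]
  proof (rule order_tendstoI)
    fix a assume "max (q + f t - f 0) S < a"
    then show "\<forall>\<^sub>F m in sequentially. ?G m < a" using upper by (meson always_eventually le_less_trans)
  next
    fix a assume a: "a < max (q + f t - f 0) S"
    show "\<forall>\<^sub>F m in sequentially. a < ?G m"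
    proof (cases "a < q + f t - f 0")
      case True
      have "q + f t - f 0 \<le> ?G m" for m
        using grid_lindley_ge_start[of q f 0 "j * 2 ^ m" "H / 2 ^ m"] unfolding t by simp
      then show ?thesis using True by (meson always_eventually less_le_trans)
    next
      case False
      then have "a < S" using a by simp
      then obtain s where s: "0 \<le> s" "s \<le> t" "a < f t - f s"
        unfolding S_def using less_cSUP_iff[OF _ bdd] t0 by auto
      show ?thesis
      proof (cases "s = t")
        \<comment> \<open>No grid point lies strictly between \<open>s\<close> and \<open>t\<close>
          here, but the choice of \<open>s\<close> now says \<open>a < 0\<close>, and grid values
          are nonnegative.\<close>
        case True
        then show ?thesis using s grid_lindley_nonneg[OF \<open>0 \<le> q\<close>]
          by (intro always_eventually allI) (auto intro: less_le_trans)
      next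
        case False
        then have "s < t" using s by simp
        obtain r l where r: "0 < r" "\<And>u. s \<le> u \<Longrightarrow> u < s + r \<Longrightarrow> \<bar>f u - f s\<bar> < f t - f s - a"
          using cadlag_near[OF f s(1), of "f t - f s - a"] s by (metis diff_gt_0_iff_gt)
        have "\<forall>\<^sub>F m in sequentially. \<exists>i::nat. s < real i * (H / 2 ^ m) \<and> real i * (H / 2 ^ m) < min t (s + r)"
          using s \<open>s < t\<close> r \<open>0 < H\<close> by (intro dyadic_between) auto
        then show ?thesis
        proof eventually_elim
          case (elim m)
          then obtain i :: nat where i: "s < real i * (H / 2 ^ m)" "real i * (H / 2 ^ m) < t"
            "real i * (H / 2 ^ m) < s + r" by auto
          have "real i * (H / 2 ^ m) < real (j * 2 ^ m) * (H / 2 ^ m)" using i t by simp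
          then have "real i < real (j * 2 ^ m)"
            by (rule mult_right_less_imp_less) (use \<open>0 < H\<close> in auto)
          then have "i \<le> j * 2 ^ m" by (simp only: of_nat_less_iff less_imp_le)
          then have "f t - f (real i * (H / 2 ^ m)) \<le> ?G m"
            using grid_lindley_ge[OF \<open>0 \<le> q\<close>, of i "j * 2 ^ m" f 0 "H / 2 ^ m"] unfolding t by simp
          then show ?case using r(2)[of "real i * (H / 2 ^ m)"] i by auto
        qed
      qed
    qed
  qed
qed

section \<open>Lindley chains\<close>

lemma (in prob_space) integrable_power_le:
  fixes X :: "'a \<Rightarrow> real"
  assumes [measurable]: "X \<in> borel_measurable M" and int: "integrable M (\<lambda>\<omega>. \<bar>X \<omega>\<bar> ^ n)" and "k \<le> n"
  shows "integrable M (\<lambda>\<omega>. X \<omega> ^ k)" "integrable M (\<lambda>\<omega>. \<bar>X \<omega>\<bar> ^ k)"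
proof -
  have *: "\<bar>x\<bar> ^ k \<le> 1 + \<bar>x\<bar> ^ n" for x :: real
  proof (cases "\<bar>x\<bar> \<le> 1")
    case True
    then have "\<bar>x\<bar> ^ k \<le> 1" by (simp add: power_le_one)
    then show ?thesis by (simp add: add_increasing2)
  next
    case False
    then have "\<bar>x\<bar> ^ k \<le> \<bar>x\<bar> ^ n" using \<open>k \<le> n\<close> by (intro power_increasing) auto
    then show ?thesis by simp
  qed
  have "integrable M (\<lambda>\<omega>. 1 + \<bar>X \<omega>\<bar> ^ n)" using int by simp
  then show "integrable M (\<lambda>\<omega>. X \<omega> ^ k)" "integrable M (\<lambda>\<omega>. \<bar>X \<omega>\<bar> ^ k)"
    by (rule Bochner_Integration.integrable_bound; use * in \<open>auto simp: power_abs intro: order_trans[OF _ abs_ge_self]\<close>)+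
qed

lemma (in prob_space) indep_var_integral_mult:
  fixes X Y :: "'a \<Rightarrow> real"
  assumes ind: "indep_var borel X borel Y"
    and [measurable]: "f \<in> borel_measurable borel" "g \<in> borel_measurable borel"
    and int: "integrable M (\<lambda>\<omega>. f (X \<omega>) :: real)" "integrable M (\<lambda>\<omega>. g (Y \<omega>) :: real)"
  shows "integrable M (\<lambda>\<omega>. f (X \<omega>) * g (Y \<omega>))"
    "(\<integral>\<omega>. f (X \<omega>) * g (Y \<omega>) \<partial>M) = (\<integral>\<omega>. f (X \<omega>) \<partial>M) * (\<integral>\<omega>. g (Y \<omega>) \<partial>M)"
proof -
  have "indep_var borel (f \<circ> X) borel (g \<circ> Y)"
    by (rule indep_var_compose[OF ind]) auto
  then have *: "indep_var borel (\<lambda>\<omega>. f (X \<omega>)) borel (\<lambda>\<omega>. g (Y \<omega>))" by (simp add: comp_def)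
  show "integrable M (\<lambda>\<omega>. f (X \<omega>) * g (Y \<omega>))"
    "(\<integral>\<omega>. f (X \<omega>) * g (Y \<omega>) \<partial>M) = (\<integral>\<omega>. f (X \<omega>) \<partial>M) * (\<integral>\<omega>. g (Y \<omega>) \<partial>M)"
    using indep_var_integrable[OF * int] indep_var_lebesgue_integral[OF * int] by auto
qed

text \<open>The constant is \<open>2 ^ (3 - 1)\<close>, from convexity of the cube; the defect
  factors as \<open>3 * (a + b) * (a - b)^2\<close>.\<close>

lemma pos_part_cube_le:
  fixes x y :: real
  shows "(max 0 (x + y)) ^ 3 \<le> 4 * (max 0 x) ^ 3 + 4 * (max 0 y) ^ 3"
proof -
  have *: "(a + b) ^ 3 \<le> 4 * a ^ 3 + 4 * b ^ 3" if "0 \<le> a" "0 \<le> b" for a b :: real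
  proof -
    have "4 * a ^ 3 + 4 * b ^ 3 - (a + b) ^ 3 = 3 * ((a + b) * (a - b)\<^sup>2)"
      by (simp add: power2_eq_square power3_eq_cube algebra_simps)
    also have "\<dots> \<ge> 0" using that by simp
    finally show ?thesis by simp
  qed
  have "(max 0 (x + y)) ^ 3 \<le> (max 0 x + max 0 y) ^ 3" by (intro power_mono) auto
  also have "\<dots> \<le> 4 * (max 0 x) ^ 3 + 4 * (max 0 y) ^ 3" by (intro *) auto
  finally show ?thesis .
qed

lemma abs_add_cube_le: "\<bar>x + y\<bar> ^ 3 \<le> 4 * \<bar>x\<bar> ^ 3 + 4 * \<bar>y :: real\<bar> ^ 3"
proof -
  have "\<bar>x + y\<bar> ^ 3 \<le> (max 0 (\<bar>x\<bar> + \<bar>y\<bar>)) ^ 3" by (intro power_mono) auto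
  also have "\<dots> \<le> 4 * \<bar>x\<bar> ^ 3 + 4 * \<bar>y\<bar> ^ 3" using pos_part_cube_le[of "\<bar>x\<bar>" "\<bar>y\<bar>"] by simp
  finally show ?thesis .
qed

text \<open>Independence is demanded between the current state and the next step: this factors the
  mixed moments and gives the one-step transition formula, and it survives a shift of time.\<close>

locale lindley_chain = prob_space M for M :: "'a measure" +
  fixes Q \<xi> :: "nat \<Rightarrow> 'a \<Rightarrow> real"
  assumes Q_0_nonneg: "AE \<omega> in M. 0 \<le> Q 0 \<omega>"
    and Q_Suc: "\<And>n \<omega>. Q (Suc n) \<omega> = max 0 (Q n \<omega> + \<xi> n \<omega>)"
    and indep: "\<And>n. indep_var borel (Q n) borel (\<xi> n)"
    and step_law: "\<And>n. distr M borel (\<xi> n) = distr M borel (\<xi> 0)"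
begin

lemma Q_measurable [measurable]: "Q n \<in> borel_measurable M"
  using indep_var_rv1[OF indep] .

lemma step_measurable [measurable]: "\<xi> n \<in> borel_measurable M"
  using indep_var_rv2[OF indep] .

lemma Q_nonneg: "AE \<omega> in M. 0 \<le> Q n \<omega>"
  using Q_0_nonneg by (cases n) (auto simp: Q_Suc)

lemma step_integral:
  assumes [measurable]: "(f :: real \<Rightarrow> real) \<in> borel_measurable borel"
  shows "integrable M (\<lambda>\<omega>. f (\<xi> n \<omega>)) \<longleftrightarrow> integrable M (\<lambda>\<omega>. f (\<xi> 0 \<omega>))"
    and "(\<integral>\<omega>. f (\<xi> n \<omega>) \<partial>M) = (\<integral>\<omega>. f (\<xi> 0 \<omega>) \<partial>M)"
proof -
  have "integrable M (\<lambda>\<omega>. f (\<xi> n \<omega>)) \<longleftrightarrow> integrable (distr M borel (\<xi> n)) f" for n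
    by (subst integrable_distr_eq) auto
  then show "integrable M (\<lambda>\<omega>. f (\<xi> n \<omega>)) \<longleftrightarrow> integrable M (\<lambda>\<omega>. f (\<xi> 0 \<omega>))"
    by (simp add: step_law[of n])
  have "(\<integral>\<omega>. f (\<xi> n \<omega>) \<partial>M) = (\<integral>x. f x \<partial>distr M borel (\<xi> n))" for n
    by (subst integral_distr) auto
  then show "(\<integral>\<omega>. f (\<xi> n \<omega>) \<partial>M) = (\<integral>\<omega>. f (\<xi> 0 \<omega>) \<partial>M)"
    by (simp add: step_law[of n])
qed

lemma Q_power_integrable:
  assumes "integrable M (\<lambda>\<omega>. \<bar>Q 0 \<omega>\<bar> ^ k)" "integrable M (\<lambda>\<omega>. \<bar>\<xi> 0 \<omega>\<bar> ^ k)"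
  shows "integrable M (\<lambda>\<omega>. \<bar>Q n \<omega>\<bar> ^ k)"
proof (induction n)
  case (Suc n)
  have *: "\<bar>max 0 (x + y)\<bar> ^ k \<le> 2 ^ k * \<bar>x\<bar> ^ k + 2 ^ k * \<bar>y\<bar> ^ k" for x y :: real
  proof -
    have "\<bar>max 0 (x + y)\<bar> ^ k \<le> (2 * max \<bar>x\<bar> \<bar>y\<bar>) ^ k" by (intro power_mono) auto
    also have "\<dots> = 2 ^ k * max \<bar>x\<bar> \<bar>y\<bar> ^ k" by (simp add: power_mult_distrib)
    also have "\<dots> \<le> 2 ^ k * (\<bar>x\<bar> ^ k + \<bar>y\<bar> ^ k)" by (intro mult_left_mono) (auto simp: max_def)
    finally show ?thesis by (simp add: algebra_simps)
  qed
  have "integrable M (\<lambda>\<omega>. 2 ^ k * \<bar>Q n \<omega>\<bar> ^ k + 2 ^ k * \<bar>\<xi> n \<omega>\<bar> ^ k)"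
    using Suc assms step_integral(1)[of "\<lambda>x. \<bar>x\<bar> ^ k" n] by auto
  then show ?case
    by (rule Bochner_Integration.integrable_bound)
       (use * in \<open>auto simp: Q_Suc intro: order_trans[OF _ abs_ge_self]\<close>)
qed (use assms in simp)

text \<open>The increment of the regulator at 0: the next state is the current state plus step plus
  loss, and loss and next state are never both positive.\<close>

definition loss :: "nat \<Rightarrow> 'a \<Rightarrow> real" where
  "loss n \<omega> = max 0 (- (Q n \<omega> + \<xi> n \<omega>))"

lemma loss_measurable [measurable]: "loss n \<in> borel_measurable M"
  unfolding loss_def by measurable

lemma loss_nonneg: "0 \<le> loss n \<omega>"
  by (simp add: loss_def)

lemma loss_le: "AE \<omega> in M. loss n \<omega> \<le> max 0 (- \<xi> n \<omega>)"
  using Q_nonneg[of n] by eventually_elim (auto simp: loss_def)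

text \<open>This quantity controls the boundary terms. For grid steps of mesh \<open>h\<close> it
  will be of smaller order than \<open>h\<close>.\<close>

abbreviation "undershoot3 \<equiv> (\<integral>\<omega>. (max 0 (- \<xi> 0 \<omega>)) ^ 3 \<partial>M)"

context
  assumes Q0_sq: "integrable M (\<lambda>\<omega>. \<bar>Q 0 \<omega>\<bar> ^ 2)" and step_cube: "integrable M (\<lambda>\<omega>. \<bar>\<xi> 0 \<omega>\<bar> ^ 3)"
begin

lemma step_power_integrable:
  assumes "k \<le> 3"
  shows "integrable M (\<lambda>\<omega>. \<xi> n \<omega> ^ k)" "integrable M (\<lambda>\<omega>. \<bar>\<xi> n \<omega>\<bar> ^ k)"
    "(\<integral>\<omega>. \<xi> n \<omega> ^ k \<partial>M) = (\<integral>\<omega>. \<xi> 0 \<omega> ^ k \<partial>M)"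
proof -
  have "integrable M (\<lambda>\<omega>. \<bar>\<xi> n \<omega>\<bar> ^ 3)" using step_integral(1)[of "\<lambda>x. \<bar>x\<bar> ^ 3" n] step_cube by simp
  then show "integrable M (\<lambda>\<omega>. \<xi> n \<omega> ^ k)" "integrable M (\<lambda>\<omega>. \<bar>\<xi> n \<omega>\<bar> ^ k)"
    using integrable_power_le[of "\<xi> n" 3 k] assms by auto
qed (use step_integral(2)[of "\<lambda>x. x ^ k" n] in simp)

lemma step_integrable: "integrable M (\<xi> n)" "(\<integral>\<omega>. \<xi> n \<omega> \<partial>M) = (\<integral>\<omega>. \<xi> 0 \<omega> \<partial>M)"
  using step_power_integrable[of 1 n] by auto

lemma Q_sq_integrable: "integrable M (\<lambda>\<omega>. \<bar>Q n \<omega>\<bar> ^ 2)" "integrable M (\<lambda>\<omega>. Q n \<omega> ^ 2)"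
  using Q_power_integrable[OF Q0_sq, of n] step_power_integrable(2)[of 2 0] by auto

lemma Q_integrable: "integrable M (Q n)"
  using integrable_power_le(1)[of "Q n" 2 1] Q_sq_integrable(1)[of n] by simp

lemma loss_power_integrable: "k \<le> 3 \<Longrightarrow> integrable M (\<lambda>\<omega>. loss n \<omega> ^ k)"
proof (rule Bochner_Integration.integrable_bound[OF step_power_integrable(2)[of k n]])
  show "AE \<omega> in M. norm (loss n \<omega> ^ k) \<le> norm (\<bar>\<xi> n \<omega>\<bar> ^ k)"
    using loss_le[of n]
  proof eventually_elim
    case (elim \<omega>)
    then have "loss n \<omega> ^ k \<le> \<bar>\<xi> n \<omega>\<bar> ^ k" using loss_nonneg[of n \<omega>] by (intro power_mono) auto
    then show ?case using loss_nonneg[of n \<omega>] by simp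
  qed
qed auto

lemma loss_cube_le: "(\<integral>\<omega>. loss n \<omega> ^ 3 \<partial>M) \<le> undershoot3"
proof -
  have int: "integrable M (\<lambda>\<omega>. (max 0 (- \<xi> n \<omega>)) ^ 3)"
  proof (rule Bochner_Integration.integrable_bound[OF step_power_integrable(2)[of 3 n]])
    have "(max 0 (- x)) ^ 3 \<le> \<bar>x\<bar> ^ 3" for x :: real by (intro power_mono) auto
    then show "AE \<omega> in M. norm ((max 0 (- \<xi> n \<omega>)) ^ 3) \<le> norm (\<bar>\<xi> n \<omega>\<bar> ^ 3)" by simp
  qed auto
  have "(\<integral>\<omega>. loss n \<omega> ^ 3 \<partial>M) \<le> (\<integral>\<omega>. (max 0 (- \<xi> n \<omega>)) ^ 3 \<partial>M)"
    using loss_le[of n] loss_power_integrable[of 3 n] int loss_nonneg[of n]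
    by (intro integral_mono_AE) (auto elim!: eventually_mono intro!: power_mono)
  also have "\<dots> = undershoot3" using step_integral(2)[of "\<lambda>x. (max 0 (- x)) ^ 3" n] by simp
  finally show ?thesis .
qed

lemma loss_mean:
  "(\<integral>\<omega>. loss n \<omega> \<partial>M) = (\<integral>\<omega>. Q (Suc n) \<omega> \<partial>M) - (\<integral>\<omega>. Q n \<omega> \<partial>M) - (\<integral>\<omega>. \<xi> 0 \<omega> \<partial>M)"
proof -
  have "loss n \<omega> = Q (Suc n) \<omega> - Q n \<omega> - \<xi> n \<omega>" for \<omega> by (auto simp: loss_def Q_Suc)
  then show ?thesis using Q_integrable step_integrable(1)[of n] step_integrable(2)[of n] by simp
qed

text \<open>Splitting at \<open>\<epsilon>\<close> gives
  \<open>x^2 \<le> \<epsilon> * x + x^3 / \<epsilon>\<close>. First moments of the loss telescope to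
  something bounded, and third moments are negligible on fine grids, so squares become negligible as
  well.\<close>

lemma loss_sq_le:
  assumes "0 < \<epsilon>"
  shows "(\<integral>\<omega>. loss n \<omega> ^ 2 \<partial>M) \<le> \<epsilon> * (\<integral>\<omega>. loss n \<omega> \<partial>M) + undershoot3 / \<epsilon>"
proof -
  have le: "x ^ 2 \<le> \<epsilon> * x + x ^ 3 / \<epsilon>" if "0 \<le> x" for x :: real
  proof (cases "x \<le> \<epsilon>")
    case True
    then have "x * x \<le> \<epsilon> * x" "0 \<le> x ^ 3 / \<epsilon>" using that assms by (auto intro: mult_right_mono)
    then show ?thesis by (simp add: power2_eq_square)
  next
    case False
    then have "x ^ 2 * \<epsilon> \<le> x ^ 2 * x" by (intro mult_left_mono) auto
    then have "x ^ 2 \<le> x ^ 3 / \<epsilon>" using assms by (simp add: field_simps power3_eq_cube power2_eq_square)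
    then show ?thesis using that assms by (simp add: add_increasing)
  qed
  have "(\<integral>\<omega>. loss n \<omega> ^ 2 \<partial>M) \<le> (\<integral>\<omega>. \<epsilon> * loss n \<omega> + loss n \<omega> ^ 3 / \<epsilon> \<partial>M)"
    using loss_power_integrable[of 1 n] loss_power_integrable[of 2 n] loss_power_integrable[of 3 n]
    by (intro integral_mono) (auto intro: le loss_nonneg)
  also have "\<dots> = \<epsilon> * (\<integral>\<omega>. loss n \<omega> \<partial>M) + (\<integral>\<omega>. loss n \<omega> ^ 3 \<partial>M) / \<epsilon>"
    using loss_power_integrable[of 1 n] loss_power_integrable[of 3 n] by simp
  also have "\<dots> \<le> \<epsilon> * (\<integral>\<omega>. loss n \<omega> \<partial>M) + undershoot3 / \<epsilon>"
    using loss_cube_le assms by (intro add_left_mono divide_right_mono) auto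
  finally show ?thesis .
qed

text \<open>Positive and negative parts are never both nonzero, so the square of the positive part
  is the full square minus that of the negative part, without a cross term.\<close>

lemma Q_sq_Suc:
  "(\<integral>\<omega>. Q (Suc n) \<omega> ^ 2 \<partial>M) = (\<integral>\<omega>. Q n \<omega> ^ 2 \<partial>M)
     + 2 * (\<integral>\<omega>. \<xi> 0 \<omega> \<partial>M) * (\<integral>\<omega>. Q n \<omega> \<partial>M) + (\<integral>\<omega>. \<xi> 0 \<omega> ^ 2 \<partial>M) - (\<integral>\<omega>. loss n \<omega> ^ 2 \<partial>M)"
proof -
  have eq: "Q (Suc n) \<omega> ^ 2 = Q n \<omega> ^ 2 + 2 * (Q n \<omega> * \<xi> n \<omega>) + \<xi> n \<omega> ^ 2 - loss n \<omega> ^ 2" for \<omega>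
    by (auto simp: Q_Suc loss_def max_def power2_eq_square algebra_simps)
  note m = indep_var_integral_mult[OF indep[of n], of "\<lambda>x. x" "\<lambda>x. x"]
  show ?thesis
    unfolding eq
    using m Q_integrable[of n] step_integrable[of n] Q_sq_integrable(2)[of n]
      step_power_integrable(1,3)[of 2 n] loss_power_integrable[of 2 n]
    by simp
qed

lemma Q_sq_sum:
  "(\<integral>\<omega>. Q N \<omega> ^ 2 \<partial>M) = (\<integral>\<omega>. Q 0 \<omega> ^ 2 \<partial>M)
     + 2 * (\<integral>\<omega>. \<xi> 0 \<omega> \<partial>M) * (\<Sum>n<N. \<integral>\<omega>. Q n \<omega> \<partial>M) + real N * (\<integral>\<omega>. \<xi> 0 \<omega> ^ 2 \<partial>M)
     - (\<Sum>n<N. \<integral>\<omega>. loss n \<omega> ^ 2 \<partial>M)"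
  by (induction N) (simp_all add: Q_sq_Suc algebra_simps)

text \<open>The means in \<open>loss_mean\<close> telescope, so the factor of
  \<open>\<epsilon>\<close> depends on the endpoints and the total drift only.\<close>

lemma loss_sq_sum_le:
  assumes "0 < \<epsilon>"
  shows "(\<Sum>n<N. \<integral>\<omega>. loss n \<omega> ^ 2 \<partial>M) \<le>
    \<epsilon> * ((\<integral>\<omega>. Q N \<omega> \<partial>M) - (\<integral>\<omega>. Q 0 \<omega> \<partial>M) - real N * (\<integral>\<omega>. \<xi> 0 \<omega> \<partial>M)) + real N * undershoot3 / \<epsilon>"
proof (induction N)
  case (Suc N)
  then show ?case using loss_sq_le[OF assms, of N]
    unfolding loss_mean by (simp add: algebra_simps add_divide_distrib)
qed simp

lemma loss_sq_sum_nonneg: "0 \<le> (\<Sum>n<N. \<integral>\<omega>. loss n \<omega> ^ 2 \<partial>M)"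
  by (intro sum_nonneg Bochner_Integration.integral_nonneg) auto

end

end

section \<open>Stochastic order between Lindley chains\<close>

context lindley_chain
begin

lemma nn_integral_Suc:
  assumes [measurable]: "(g :: real \<Rightarrow> ennreal) \<in> borel_measurable borel"
  shows "(\<integral>\<^sup>+\<omega>. g (Q (Suc n) \<omega>) \<partial>M) =
    (\<integral>\<^sup>+\<omega>. (\<integral>\<^sup>+y. g (max 0 (Q n \<omega> + y)) \<partial>distr M borel (\<xi> 0)) \<partial>M)"
proof -
  interpret A: prob_space "distr M borel (Q n)" by (rule prob_space_distr) simp
  interpret B: prob_space "distr M borel (\<xi> n)" by (rule prob_space_distr) simp
  have pair: "distr M borel (Q n) \<Otimes>\<^sub>M distr M borel (\<xi> n) = distr M (borel \<Otimes>\<^sub>M borel) (\<lambda>\<omega>. (Q n \<omega>, \<xi> n \<omega>))"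
    using indep[of n] by (simp add: indep_var_distribution_eq)
  have "(\<integral>\<^sup>+\<omega>. g (Q (Suc n) \<omega>) \<partial>M) = (\<integral>\<^sup>+p. g (max 0 (fst p + snd p))
      \<partial>distr M (borel \<Otimes>\<^sub>M borel) (\<lambda>\<omega>. (Q n \<omega>, \<xi> n \<omega>)))"
    by (subst nn_integral_distr) (auto simp: Q_Suc)
  also have "\<dots> = (\<integral>\<^sup>+x. (\<integral>\<^sup>+y. g (max 0 (x + y)) \<partial>distr M borel (\<xi> n)) \<partial>distr M borel (Q n))"
    unfolding pair[symmetric] by (subst B.nn_integral_fst[symmetric]) auto
  also have "\<dots> = (\<integral>\<^sup>+\<omega>. (\<integral>\<^sup>+y. g (max 0 (Q n \<omega> + y)) \<partial>distr M borel (\<xi> n)) \<partial>M)"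
    by (subst nn_integral_distr) auto
  finally show ?thesis by (simp add: step_law[of n])
qed

text \<open>Comparing a chain with its own shift is how moments are shown to increase in
  time.\<close>

lemma shift: "lindley_chain M (\<lambda>n. Q (Suc n)) (\<lambda>n. \<xi> (Suc n))"
proof unfold_locales
  show "AE \<omega> in M. 0 \<le> Q (Suc 0) \<omega>" by (rule Q_nonneg)
  show "distr M borel (\<xi> (Suc n)) = distr M borel (\<xi> (Suc 0))" for n
    using step_law[of "Suc n"] step_law[of "Suc 0"] by (rule trans[OF _ sym])
qed (use Q_Suc indep in blast)+

end

text \<open>The one-step transition operator maps monotone functions to monotone functions, so
  stochastic order of the initial laws propagates. Only laws are compared, since the two chains are
  driven by different steps; nonnegative integrals spare integrability conditions in the induction
  over all \<open>g\<close>.\<close>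

lemma lindley_chain_nn_integral_mono:
  fixes g :: "real \<Rightarrow> ennreal"
  assumes A: "lindley_chain M A \<xi>" and B: "lindley_chain M B \<eta>"
    and law: "distr M borel (\<xi> 0) = distr M borel (\<eta> 0)"
    and init: "\<And>g :: real \<Rightarrow> ennreal. g \<in> borel_measurable borel \<Longrightarrow> mono g \<Longrightarrow>
      (\<integral>\<^sup>+\<omega>. g (A 0 \<omega>) \<partial>M) \<le> (\<integral>\<^sup>+\<omega>. g (B 0 \<omega>) \<partial>M)"
    and "g \<in> borel_measurable borel" "mono g"
  shows "(\<integral>\<^sup>+\<omega>. g (A n \<omega>) \<partial>M) \<le> (\<integral>\<^sup>+\<omega>. g (B n \<omega>) \<partial>M)"
  using assms(5,6)
proof (induction n arbitrary: g)
  case 0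
  then show ?case by (rule init)
next
  case (Suc n)
  interpret A: lindley_chain M A \<xi> by (rule A)
  interpret B: lindley_chain M B \<eta> by (rule B)
  note [measurable] = Suc.prems(1)
  interpret D: prob_space "distr M borel (\<eta> 0)" by (rule A.prob_space_distr) simp
  define G where "G x = (\<integral>\<^sup>+y. g (max 0 (x + y)) \<partial>distr M borel (\<eta> 0))" for x
  have [measurable]: "G \<in> borel_measurable borel" unfolding G_def by measurable
  have "mono G"
    unfolding G_def by (intro monoI nn_integral_mono monoD[OF Suc.prems(2)]) auto
  have "(\<integral>\<^sup>+\<omega>. G (A n \<omega>) \<partial>M) \<le> (\<integral>\<^sup>+\<omega>. G (B n \<omega>) \<partial>M)"
    by (rule Suc.IH) (use \<open>mono G\<close> in auto)
  then show ?case
    unfolding A.nn_integral_Suc[OF Suc.prems(1)] B.nn_integral_Suc[OF Suc.prems(1)] law G_def .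
qed

text \<open>A start at 0 is the smallest possible one. The extra variable \<open>B'\<close> allows
  the larger chain to be replaced by a pathwise bound, later the continuous-time workload.\<close>

lemma lindley_chain_moment_mono:
  assumes A: "lindley_chain M A \<xi>" and B: "lindley_chain M B \<eta>"
    and law: "distr M borel (\<xi> 0) = distr M borel (\<eta> 0)"
    and init: "\<And>\<omega>. \<omega> \<in> space M \<Longrightarrow> A 0 \<omega> = 0"
    and int: "integrable M (\<lambda>\<omega>. A n \<omega> ^ k)" "integrable M (\<lambda>\<omega>. B' \<omega> ^ k)"
    and le: "AE \<omega> in M. B n \<omega> \<le> B' \<omega>"
  shows "(\<integral>\<omega>. A n \<omega> ^ k \<partial>M) \<le> (\<integral>\<omega>. B' \<omega> ^ k \<partial>M)"
proof -
  interpret A: lindley_chain M A \<xi> by (rule A)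
  interpret B: lindley_chain M B \<eta> by (rule B)
  have B'_nonneg: "AE \<omega> in M. 0 \<le> B' \<omega> ^ k"
    using B.Q_nonneg[of n] le by eventually_elim simp
  \<comment> \<open>Cutting at 0 makes even powers monotone on the whole line.\<close>
  define g :: "real \<Rightarrow> ennreal" where "g x = ennreal ((max 0 x) ^ k)" for x
  have [measurable]: "g \<in> borel_measurable borel" unfolding g_def by measurable
  have "mono g" unfolding g_def by (intro monoI ennreal_leI power_mono) auto
  have "(\<integral>\<^sup>+\<omega>. g (A n \<omega>) \<partial>M) \<le> (\<integral>\<^sup>+\<omega>. g (B n \<omega>) \<partial>M)"
  proof (rule lindley_chain_nn_integral_mono[OF A B law])
    fix g :: "real \<Rightarrow> ennreal" assume g: "g \<in> borel_measurable borel" "mono g"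
    show "(\<integral>\<^sup>+\<omega>. g (A 0 \<omega>) \<partial>M) \<le> (\<integral>\<^sup>+\<omega>. g (B 0 \<omega>) \<partial>M)"
    proof (rule nn_integral_mono_AE)
      show "AE \<omega> in M. g (A 0 \<omega>) \<le> g (B 0 \<omega>)"
        using B.Q_nonneg[of 0] AE_space by eventually_elim (auto intro!: monoD[OF g(2)] simp: init)
    qed
  qed (use \<open>mono g\<close> in auto)
  also have "(\<integral>\<^sup>+\<omega>. g (A n \<omega>) \<partial>M) = (\<integral>\<^sup>+\<omega>. ennreal (A n \<omega> ^ k) \<partial>M)"
    using A.Q_nonneg[of n] by (intro nn_integral_cong_AE) (auto elim!: eventually_mono simp: g_def)
  also have "\<dots> = ennreal (\<integral>\<omega>. A n \<omega> ^ k \<partial>M)"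
    using A.Q_nonneg[of n] by (intro nn_integral_eq_integral int) (auto elim!: eventually_mono)
  also have "(\<integral>\<^sup>+\<omega>. g (B n \<omega>) \<partial>M) \<le> (\<integral>\<^sup>+\<omega>. ennreal (B' \<omega> ^ k) \<partial>M)"
  proof (rule nn_integral_mono_AE)
    show "AE \<omega> in M. g (B n \<omega>) \<le> ennreal (B' \<omega> ^ k)"
      using B.Q_nonneg[of n] le
      by eventually_elim (auto simp: g_def intro!: ennreal_leI power_mono)
  qed
  also have "\<dots> = ennreal (\<integral>\<omega>. B' \<omega> ^ k \<partial>M)"
    using B'_nonneg by (intro nn_integral_eq_integral int)
  finally have "ennreal (\<integral>\<omega>. A n \<omega> ^ k \<partial>M) \<le> ennreal (\<integral>\<omega>. B' \<omega> ^ k \<partial>M)" .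
  moreover have "0 \<le> (\<integral>\<omega>. B' \<omega> ^ k \<partial>M)"
    using B'_nonneg by (intro integral_nonneg_AE)
  ultimately show ?thesis by simp
qed

text \<open>Designed for chains whose second moment alone is bounded: beyond the tangent term, every
  error is a power of \<open>1 / K\<close> times \<open>q^2\<close> times a function of the step, or
  a tail of the step. Below level \<open>K / 2\<close> only a step exceeding \<open>K / 2\<close>
  can cross the level; above it, \<open>1 \<le> 4 * q^2 / K^2\<close>.\<close>

lemma truncated_cube_step:
  fixes q x K :: real
  assumes "0 \<le> q" "0 < K"
  shows "(max 0 (max 0 (q + x) - K)) ^ 3 \<le> (max 0 (q - K)) ^ 3 + 3 * ((max 0 (q - K)) ^ 2 * x)
    + 3 / K * (q ^ 2 * x ^ 2) + 4 / K ^ 2 * (q ^ 2 * \<bar>x\<bar> ^ 3) + (max 0 (x - K / 2)) ^ 3"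
proof -
  define z where "z = q - K"
  define p where "p = max 0 z"
  have p: "0 \<le> p" "p \<le> q ^ 2 / K"
  proof -
    show "0 \<le> p" by (simp add: p_def)
    show "p \<le> q ^ 2 / K"
    proof (cases "q \<le> K")
      case True
      then show ?thesis using assms by (simp add: p_def z_def)
    next
      case False
      then have "q * K \<le> q * q" using assms by (intro mult_left_mono) auto
      then have "q \<le> q ^ 2 / K" using assms by (simp add: field_simps power2_eq_square)
      then show ?thesis using False assms by (simp add: p_def z_def)
    qed
  qed
  have eq: "max 0 (max 0 (q + x) - K) = max 0 (z + x)" using assms by (auto simp: z_def max_def)
  have base: "(max 0 (z + x)) ^ 3 \<le> p ^ 3 + 3 * (p ^ 2 * x) + 3 * p * x ^ 2 + \<bar>x\<bar> ^ 3"
  proof -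
    consider "z < 0" | "0 \<le> z" "0 \<le> z + x" | "0 \<le> z" "z + x < 0" by linarith
    then show ?thesis
    proof cases
      case 1
      then have "(max 0 (z + x)) ^ 3 \<le> \<bar>x\<bar> ^ 3" by (intro power_mono) auto
      then show ?thesis using 1 by (simp add: p_def)
    next
      case 2
      have "(z + x) ^ 3 = z ^ 3 + 3 * (z ^ 2 * x) + 3 * z * x ^ 2 + x ^ 3"
        by (simp add: power2_eq_square power3_eq_cube algebra_simps)
      also have "x ^ 3 \<le> \<bar>x\<bar> ^ 3" by (metis abs_ge_self power_abs)
      finally show ?thesis using 2 by (simp add: p_def)
    next
      case 3
      define y where "y = - x"
      have y: "0 \<le> z" "z < y" using 3 by (auto simp: y_def)
      have "(y - z) ^ 3 \<le> y ^ 3" using y by (intro power_mono) auto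
      moreover have "0 \<le> y ^ 3" using y by simp
      moreover have "z ^ 3 - 3 * (z ^ 2 * y) + 3 * z * y ^ 2 + y ^ 3 = 2 * y ^ 3 - (y - z) ^ 3"
        by (simp add: power2_eq_square power3_eq_cube algebra_simps)
      ultimately have "0 \<le> z ^ 3 - 3 * (z ^ 2 * y) + 3 * z * y ^ 2 + y ^ 3" by linarith
      then show ?thesis using 3 y by (simp add: p_def y_def abs_if)
    qed
  qed
  have x2: "3 * p * x ^ 2 \<le> 3 / K * (q ^ 2 * x ^ 2)"
    using mult_right_mono[OF p(2), of "3 * x ^ 2"] by (simp add: algebra_simps)
  have "(max 0 (z + x)) ^ 3 \<le> p ^ 3 + 3 * (p ^ 2 * x) + 3 / K * (q ^ 2 * x ^ 2)
      + 4 / K ^ 2 * (q ^ 2 * \<bar>x\<bar> ^ 3) + (max 0 (x - K / 2)) ^ 3"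
  proof (cases "q < K / 2")
    case True
    then have "p = 0" using assms by (simp add: p_def z_def)
    moreover have "(max 0 (z + x)) ^ 3 \<le> (max 0 (x - K / 2)) ^ 3"
      using True by (intro power_mono) (auto simp: z_def)
    moreover have "0 \<le> 3 / K * (q ^ 2 * x ^ 2)" "0 \<le> 4 / K ^ 2 * (q ^ 2 * \<bar>x\<bar> ^ 3)"
      using assms by auto
    ultimately show ?thesis by (simp only: power2_eq_square power3_eq_cube mult_zero_left mult_zero_right)
  next
    case False
    then have "(K / 2) ^ 2 \<le> q ^ 2" using assms by (intro power_mono) auto
    then have "1 \<le> 4 / K ^ 2 * q ^ 2" using assms by (simp add: field_simps power2_eq_square)
    then have "1 * \<bar>x\<bar> ^ 3 \<le> 4 / K ^ 2 * q ^ 2 * \<bar>x\<bar> ^ 3" by (intro mult_right_mono) auto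
    moreover have "0 \<le> (max 0 (x - K / 2)) ^ 3" by simp
    ultimately show ?thesis using base x2 unfolding mult.assoc mult_1 by linarith
  qed
  then show ?thesis unfolding eq p_def z_def .
qed

text \<open>With bounded second moments, truncation changes the third moment by a bounded amount,
  however large that moment has become.\<close>

lemma cube_minus_truncated_le:
  fixes x K :: real
  assumes "0 \<le> x" "0 < K"
  shows "x ^ 3 - (max 0 (x - K)) ^ 3 \<le> 3 * K * x ^ 2"
proof (cases "x \<le> K")
  case True
  then have "x * x ^ 2 \<le> K * x ^ 2" by (intro mult_right_mono) auto
  moreover have "0 \<le> K * x ^ 2" using assms by simp
  moreover have "max 0 (x - K) = 0" using True by simp
  ultimately show ?thesis by (simp add: power3_eq_cube power2_eq_square)
next
  case False
  then have "K * K ^ 2 \<le> x * K ^ 2" by (intro mult_right_mono) auto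
  moreover have "0 \<le> x * K ^ 2" using assms by simp
  moreover have "x ^ 3 - (x - K) ^ 3 = 3 * K * x ^ 2 - 3 * (x * K ^ 2) + K * K ^ 2"
    by (simp add: power2_eq_square power3_eq_cube algebra_simps)
  moreover have "max 0 (x - K) = x - K" using False by simp
  ultimately show ?thesis by simp
qed

text \<open>The chain starts empty rather than in equilibrium. With negative drift its first two
  moments increase to finite limits, so equilibrium values are obtained without constructing an
  invariant law.\<close>

locale stationary_lindley = lindley_chain +
  assumes start_0: "\<And>\<omega>. Q 0 \<omega> = 0"
    and cube: "integrable M (\<lambda>\<omega>. \<bar>\<xi> 0 \<omega>\<bar> ^ 3)"
    and drift: "(\<integral>\<omega>. \<xi> 0 \<omega> \<partial>M) < 0"
begin

definition "d = - (\<integral>\<omega>. \<xi> 0 \<omega> \<partial>M)"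
abbreviation "e2 \<equiv> (\<integral>\<omega>. \<xi> 0 \<omega> ^ 2 \<partial>M)"
abbreviation "e3 \<equiv> (\<integral>\<omega>. \<xi> 0 \<omega> ^ 3 \<partial>M)"

lemma d_pos: "0 < d"
  using drift by (simp add: d_def)

lemma start_sq: "integrable M (\<lambda>\<omega>. \<bar>Q 0 \<omega>\<bar> ^ 2)"
  by (simp add: start_0)

lemma Q_power_integrable_le: "k \<le> 3 \<Longrightarrow> integrable M (\<lambda>\<omega>. Q n \<omega> ^ k)"
proof -
  assume "k \<le> 3"
  have "integrable M (\<lambda>\<omega>. \<bar>Q n \<omega>\<bar> ^ 3)"
    by (rule Q_power_integrable) (use cube in \<open>auto simp: start_0\<close>)
  then show ?thesis by (intro integrable_power_le(1)[of "Q n" 3] \<open>k \<le> 3\<close>) auto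
qed

text \<open>The chain shifted by one step starts from a nonnegative state instead of 0, with the
  same step law.\<close>

lemma moment_mono:
  assumes "k \<le> 3"
  shows "(\<integral>\<omega>. Q n \<omega> ^ k \<partial>M) \<le> (\<integral>\<omega>. Q (Suc n) \<omega> ^ k \<partial>M)"
proof (rule lindley_chain_moment_mono[OF lindley_chain_axioms shift, where n = n and k = k and B' = "Q (Suc n)"])
  show "distr M borel (\<xi> 0) = distr M borel (\<xi> (Suc 0))" by (rule step_law[symmetric])
  show "Q 0 \<omega> = 0" for \<omega> by (rule start_0)
  show "integrable M (\<lambda>\<omega>. Q n \<omega> ^ k)" "integrable M (\<lambda>\<omega>. Q (Suc n) \<omega> ^ k)"
    by (rule Q_power_integrable_le[OF assms])+
  show "AE \<omega> in M. Q (Suc n) \<omega> \<le> Q (Suc n) \<omega>" by (rule AE_I2) (rule order_refl)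
qed

lemma Q_cube_Suc:
  "(\<integral>\<omega>. Q (Suc n) \<omega> ^ 3 \<partial>M) = (\<integral>\<omega>. Q n \<omega> ^ 3 \<partial>M) - 3 * d * (\<integral>\<omega>. Q n \<omega> ^ 2 \<partial>M)
    + 3 * e2 * (\<integral>\<omega>. Q n \<omega> \<partial>M) + e3 + (\<integral>\<omega>. loss n \<omega> ^ 3 \<partial>M)"
proof -
  have eq: "Q (Suc n) \<omega> ^ 3 = Q n \<omega> ^ 3 + 3 * (Q n \<omega> ^ 2 * \<xi> n \<omega>) + 3 * (Q n \<omega> * \<xi> n \<omega> ^ 2)
      + \<xi> n \<omega> ^ 3 + loss n \<omega> ^ 3" for \<omega>
    by (auto simp: Q_Suc loss_def max_def power2_eq_square power3_eq_cube algebra_simps)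
  have Q: "integrable M (\<lambda>\<omega>. Q n \<omega>)" using Q_power_integrable_le[of 1 n] by simp
  have Q2: "integrable M (\<lambda>\<omega>. Q n \<omega> ^ 2)" and Q3: "integrable M (\<lambda>\<omega>. Q n \<omega> ^ 3)"
    by (rule Q_power_integrable_le; simp)+
  note X = step_integrable[OF start_sq cube, of n]
  have X2: "integrable M (\<lambda>\<omega>. \<xi> n \<omega> ^ 2)" "(\<integral>\<omega>. \<xi> n \<omega> ^ 2 \<partial>M) = e2"
    and X3: "integrable M (\<lambda>\<omega>. \<xi> n \<omega> ^ 3)" "(\<integral>\<omega>. \<xi> n \<omega> ^ 3 \<partial>M) = e3"
    by (rule step_power_integrable[OF start_sq cube]; simp)+
  have L3: "integrable M (\<lambda>\<omega>. loss n \<omega> ^ 3)"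
    by (rule loss_power_integrable[OF start_sq cube]) simp
  have m1: "integrable M (\<lambda>\<omega>. Q n \<omega> ^ 2 * \<xi> n \<omega>)"
    "(\<integral>\<omega>. Q n \<omega> ^ 2 * \<xi> n \<omega> \<partial>M) = (\<integral>\<omega>. Q n \<omega> ^ 2 \<partial>M) * (\<integral>\<omega>. \<xi> n \<omega> \<partial>M)"
    by (rule indep_var_integral_mult[OF indep[of n]]; use Q2 X in simp)+
  have m2: "integrable M (\<lambda>\<omega>. Q n \<omega> * \<xi> n \<omega> ^ 2)"
    "(\<integral>\<omega>. Q n \<omega> * \<xi> n \<omega> ^ 2 \<partial>M) = (\<integral>\<omega>. Q n \<omega> \<partial>M) * (\<integral>\<omega>. \<xi> n \<omega> ^ 2 \<partial>M)"
    by (rule indep_var_integral_mult[OF indep[of n]]; use Q X2 in simp)+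
  show ?thesis
    unfolding eq by (simp add: Q Q2 Q3 X X2 X3 L3 m1 m2 d_def)
qed

lemma Q_sq_Suc_drift:
  "(\<integral>\<omega>. Q (Suc n) \<omega> ^ 2 \<partial>M) = (\<integral>\<omega>. Q n \<omega> ^ 2 \<partial>M) - 2 * d * (\<integral>\<omega>. Q n \<omega> \<partial>M) + e2
    - (\<integral>\<omega>. loss n \<omega> ^ 2 \<partial>M)"
  using Q_sq_Suc[OF start_sq cube, of n] by (simp add: d_def)

text \<open>Since the second moment does not decrease, its one-step change forces
  \<open>2 * d\<close> times the mean below \<open>e2\<close>.\<close>

lemma mean_le: "(\<integral>\<omega>. Q n \<omega> \<partial>M) \<le> e2 / (2 * d)"
proof -
  have "0 \<le> (\<integral>\<omega>. loss n \<omega> ^ 2 \<partial>M)" by (intro Bochner_Integration.integral_nonneg) auto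
  then have "2 * d * (\<integral>\<omega>. Q n \<omega> \<partial>M) \<le> e2"
    using moment_mono[of 2 n] Q_sq_Suc_drift[of n] by linarith
  then show ?thesis using d_pos by (simp add: field_simps)
qed

lemma e2_nonneg: "0 \<le> e2"
  by (intro Bochner_Integration.integral_nonneg) auto

text \<open>The argument of \<open>mean_le\<close> one power higher: the third moment does not
  decrease, and the cubed loss is at most \<open>undershoot3\<close>.\<close>

lemma second_moment_le:
  "(\<integral>\<omega>. Q n \<omega> ^ 2 \<partial>M) \<le> (3 * e2 * (e2 / (2 * d)) + e3 + undershoot3) / (3 * d)"
proof -
  have "3 * d * (\<integral>\<omega>. Q n \<omega> ^ 2 \<partial>M) \<le> 3 * e2 * (\<integral>\<omega>. Q n \<omega> \<partial>M) + e3 + undershoot3"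
    using moment_mono[of 3 n] Q_cube_Suc[of n] loss_cube_le[OF start_sq cube, of n] by linarith
  also have "\<dots> \<le> 3 * e2 * (e2 / (2 * d)) + e3 + undershoot3"
    using mean_le[of n] e2_nonneg by (intro add_right_mono mult_left_mono) auto
  finally show ?thesis using d_pos by (subst pos_le_divide_eq) (simp_all add: mult.commute)
qed

text \<open>The first-order term has nonpositive mean by the negative drift and is dropped. What
  remains tends to 0 as \<open>K\<close> grows, uniformly in \<open>n\<close>.\<close>

lemma truncated_third_moment_step:
  assumes "0 < K" and m: "\<And>n. (\<integral>\<omega>. Q n \<omega> ^ 2 \<partial>M) \<le> m"
  shows "(\<integral>\<omega>. (max 0 (Q (Suc n) \<omega> - K)) ^ 3 \<partial>M) - (\<integral>\<omega>. (max 0 (Q n \<omega> - K)) ^ 3 \<partial>M)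
    \<le> 3 / K * (m * e2) + 4 / K ^ 2 * (m * (\<integral>\<omega>. \<bar>\<xi> 0 \<omega>\<bar> ^ 3 \<partial>M))
      + (\<integral>\<omega>. (max 0 (\<xi> 0 \<omega> - K / 2)) ^ 3 \<partial>M)"
proof -
  have trunc: "integrable M (\<lambda>\<omega>. (max 0 (Q n \<omega> - K)) ^ k)" if "k \<le> 3" for n k
  proof (rule Bochner_Integration.integrable_bound[OF Q_power_integrable_le[OF that, of n]])
    show "AE \<omega> in M. norm ((max 0 (Q n \<omega> - K)) ^ k) \<le> norm (Q n \<omega> ^ k)"
      using Q_nonneg[of n] by eventually_elim (use \<open>0 < K\<close> in \<open>auto intro!: power_mono\<close>)
  qed auto
  have tail: "integrable M (\<lambda>\<omega>. (max 0 (\<xi> n \<omega> - K / 2)) ^ 3)" for n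
  proof (rule Bochner_Integration.integrable_bound[OF step_power_integrable(2)[OF start_sq cube, of 3 n]])
    have "(max 0 (x - K / 2)) ^ 3 \<le> \<bar>x\<bar> ^ 3" for x :: real using \<open>0 < K\<close> by (intro power_mono) auto
    then show "AE \<omega> in M. norm ((max 0 (\<xi> n \<omega> - K / 2)) ^ 3) \<le> norm (\<bar>\<xi> n \<omega>\<bar> ^ 3)" by simp
  qed auto
  have Q2: "integrable M (\<lambda>\<omega>. Q n \<omega> ^ 2)"
    by (rule Q_power_integrable_le) simp
  have P2: "integrable M (\<lambda>\<omega>. (max 0 (Q n \<omega> - K)) ^ 2)"
    and P3: "integrable M (\<lambda>\<omega>. (max 0 (Q n \<omega> - K)) ^ 3)"
      "integrable M (\<lambda>\<omega>. (max 0 (Q (Suc n) \<omega> - K)) ^ 3)"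
    by (rule trunc; simp)+
  note X = step_integrable[OF start_sq cube, of n]
  have X2: "integrable M (\<lambda>\<omega>. \<xi> n \<omega> ^ 2)" "(\<integral>\<omega>. \<xi> n \<omega> ^ 2 \<partial>M) = e2"
    by (rule step_power_integrable[OF start_sq cube]; simp)+
  have X3: "integrable M (\<lambda>\<omega>. \<bar>\<xi> n \<omega>\<bar> ^ 3)"
    "(\<integral>\<omega>. \<bar>\<xi> n \<omega>\<bar> ^ 3 \<partial>M) = (\<integral>\<omega>. \<bar>\<xi> 0 \<omega>\<bar> ^ 3 \<partial>M)"
    using step_power_integrable(2)[OF start_sq cube, of 3 n] step_integral(2)[of "\<lambda>x. \<bar>x\<bar> ^ 3" n] by auto
  have T: "(\<integral>\<omega>. (max 0 (\<xi> n \<omega> - K / 2)) ^ 3 \<partial>M) = (\<integral>\<omega>. (max 0 (\<xi> 0 \<omega> - K / 2)) ^ 3 \<partial>M)"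
    using step_integral(2)[of "\<lambda>x. (max 0 (x - K / 2)) ^ 3" n] by simp
  have m1: "integrable M (\<lambda>\<omega>. (max 0 (Q n \<omega> - K)) ^ 2 * \<xi> n \<omega>)"
    "(\<integral>\<omega>. (max 0 (Q n \<omega> - K)) ^ 2 * \<xi> n \<omega> \<partial>M) =
      (\<integral>\<omega>. (max 0 (Q n \<omega> - K)) ^ 2 \<partial>M) * (\<integral>\<omega>. \<xi> n \<omega> \<partial>M)"
    by (rule indep_var_integral_mult[OF indep[of n], of "\<lambda>x. (max 0 (x - K)) ^ 2" "\<lambda>x. x"]; use P2 X in simp)+
  have m2: "integrable M (\<lambda>\<omega>. Q n \<omega> ^ 2 * \<xi> n \<omega> ^ 2)"
    "(\<integral>\<omega>. Q n \<omega> ^ 2 * \<xi> n \<omega> ^ 2 \<partial>M) = (\<integral>\<omega>. Q n \<omega> ^ 2 \<partial>M) * (\<integral>\<omega>. \<xi> n \<omega> ^ 2 \<partial>M)"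
    by (rule indep_var_integral_mult[OF indep[of n]]; use Q2 X2 in simp)+
  have m3: "integrable M (\<lambda>\<omega>. Q n \<omega> ^ 2 * \<bar>\<xi> n \<omega>\<bar> ^ 3)"
    "(\<integral>\<omega>. Q n \<omega> ^ 2 * \<bar>\<xi> n \<omega>\<bar> ^ 3 \<partial>M) = (\<integral>\<omega>. Q n \<omega> ^ 2 \<partial>M) * (\<integral>\<omega>. \<bar>\<xi> n \<omega>\<bar> ^ 3 \<partial>M)"
    by (rule indep_var_integral_mult[OF indep[of n], of "\<lambda>x. x ^ 2" "\<lambda>x. \<bar>x\<bar> ^ 3"]; use Q2 X3 in simp)+
  note ints = Q2 P2 P3 X(1) X2(1) X3(1) tail[of n] m1(1) m2(1) m3(1)
  have "(\<integral>\<omega>. (max 0 (Q (Suc n) \<omega> - K)) ^ 3 \<partial>M) \<le>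
    (\<integral>\<omega>. (max 0 (Q n \<omega> - K)) ^ 3 + 3 * ((max 0 (Q n \<omega> - K)) ^ 2 * \<xi> n \<omega>)
    + 3 / K * (Q n \<omega> ^ 2 * \<xi> n \<omega> ^ 2) + 4 / K ^ 2 * (Q n \<omega> ^ 2 * \<bar>\<xi> n \<omega>\<bar> ^ 3)
    + (max 0 (\<xi> n \<omega> - K / 2)) ^ 3 \<partial>M)"
  proof (rule integral_mono_AE)
    show "AE \<omega> in M. (max 0 (Q (Suc n) \<omega> - K)) ^ 3 \<le>
      (max 0 (Q n \<omega> - K)) ^ 3 + 3 * ((max 0 (Q n \<omega> - K)) ^ 2 * \<xi> n \<omega>)
      + 3 / K * (Q n \<omega> ^ 2 * \<xi> n \<omega> ^ 2) + 4 / K ^ 2 * (Q n \<omega> ^ 2 * \<bar>\<xi> n \<omega>\<bar> ^ 3)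
      + (max 0 (\<xi> n \<omega> - K / 2)) ^ 3"
      using Q_nonneg[of n]
    proof eventually_elim
      case (elim \<omega>)
      show ?case unfolding Q_Suc by (rule truncated_cube_step[OF elim \<open>0 < K\<close>])
    qed
  qed (simp_all add: ints)
  also have "\<dots> = (\<integral>\<omega>. (max 0 (Q n \<omega> - K)) ^ 3 \<partial>M)
    + 3 * ((\<integral>\<omega>. (max 0 (Q n \<omega> - K)) ^ 2 \<partial>M) * (\<integral>\<omega>. \<xi> 0 \<omega> \<partial>M))
    + 3 / K * ((\<integral>\<omega>. Q n \<omega> ^ 2 \<partial>M) * e2)
    + 4 / K ^ 2 * ((\<integral>\<omega>. Q n \<omega> ^ 2 \<partial>M) * (\<integral>\<omega>. \<bar>\<xi> 0 \<omega>\<bar> ^ 3 \<partial>M))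
    + (\<integral>\<omega>. (max 0 (\<xi> 0 \<omega> - K / 2)) ^ 3 \<partial>M)"
    by (simp add: ints m1(2) m2(2) m3(2) X(2) X2(2) X3(2) T)
  also have "\<dots> \<le> (\<integral>\<omega>. (max 0 (Q n \<omega> - K)) ^ 3 \<partial>M) + 0 + 3 / K * (m * e2)
    + 4 / K ^ 2 * (m * (\<integral>\<omega>. \<bar>\<xi> 0 \<omega>\<bar> ^ 3 \<partial>M)) + (\<integral>\<omega>. (max 0 (\<xi> 0 \<omega> - K / 2)) ^ 3 \<partial>M)"
  proof (intro add_mono mult_left_mono mult_right_mono m order_refl e2_nonneg)
    have "(\<integral>\<omega>. (max 0 (Q n \<omega> - K)) ^ 2 \<partial>M) * (\<integral>\<omega>. \<xi> 0 \<omega> \<partial>M) \<le> 0"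
      using drift by (intro mult_nonneg_nonpos Bochner_Integration.integral_nonneg) auto
    then show "3 * ((\<integral>\<omega>. (max 0 (Q n \<omega> - K)) ^ 2 \<partial>M) * (\<integral>\<omega>. \<xi> 0 \<omega> \<partial>M)) \<le> 0" by linarith
  qed (use \<open>0 < K\<close> in \<open>auto intro!: Bochner_Integration.integral_nonneg\<close>)
  finally show ?thesis by simp
qed

text \<open>The converse of \<open>second_moment_le\<close>, where monotonicity points the wrong
  way. It suffices to exhibit one \<open>n\<close>, because the second moments increase.\<close>

lemma second_moment_limit_ge:
  assumes "0 < \<epsilon>" "0 < \<eta>"
  shows "\<exists>n. (3 * e2 * ((e2 - \<epsilon> * d - undershoot3 / \<epsilon>) / (2 * d)) + e3) / (3 * d) - \<eta>
    \<le> (\<integral>\<omega>. Q n \<omega> ^ 2 \<partial>M)"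
proof -
  define a where "a n = (\<integral>\<omega>. Q n \<omega> \<partial>M)" for n
  define b where "b n = (\<integral>\<omega>. Q n \<omega> ^ 2 \<partial>M)" for n
  define c where "c n = (\<integral>\<omega>. Q n \<omega> ^ 3 \<partial>M)" for n
  note d = d_pos
  have "incseq a" using moment_mono[of 1] by (intro incseq_SucI) (simp add: a_def)
  moreover have "a n \<le> e2 / (2 * d)" for n using mean_le by (simp add: a_def)
  ultimately obtain a' where a': "a \<longlonglongrightarrow> a'" by (metis incseq_convergent)
  have "incseq b" using moment_mono[of 2] by (intro incseq_SucI) (simp add: b_def)
  moreover have "b n \<le> (3 * e2 * (e2 / (2 * d)) + e3 + undershoot3) / (3 * d)" for n
    using second_moment_le unfolding b_def .
  ultimately obtain m where m: "b \<longlonglongrightarrow> m" by (metis incseq_convergent)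
  have bm: "b n \<le> m" for n using incseq_le[OF \<open>incseq b\<close> m] .
  have bm': "(\<integral>\<omega>. Q n \<omega> ^ 2 \<partial>M) \<le> m" for n using bm[of n] by (simp add: b_def)
  \<comment> \<open>In the limit the increments of the first two moments vanish, and the bound on
    the squared loss turns into a lower bound for the limiting mean.\<close>
  have a'_ge: "(e2 - \<epsilon> * d - undershoot3 / \<epsilon>) / (2 * d) \<le> a'"
  proof -
    have "e2 - 2 * d * a n - (b (Suc n) - b n) \<le> \<epsilon> * (a (Suc n) - a n + d) + undershoot3 / \<epsilon>" for n
      using loss_sq_le[OF start_sq cube \<open>0 < \<epsilon>\<close>, of n] Q_sq_Suc_drift[of n]
      unfolding loss_mean[OF start_sq cube] a_def b_def by (simp add: d_def)
    moreover have "(\<lambda>n. e2 - 2 * d * a n - (b (Suc n) - b n)) \<longlonglongrightarrow> e2 - 2 * d * a' - (m - m)"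
      by (intro tendsto_intros a' m LIMSEQ_Suc)
    moreover have "(\<lambda>n. \<epsilon> * (a (Suc n) - a n + d) + undershoot3 / \<epsilon>) \<longlonglongrightarrow> \<epsilon> * (a' - a' + d) + undershoot3 / \<epsilon>"
      by (intro tendsto_intros a' LIMSEQ_Suc)
    ultimately have "e2 - 2 * d * a' - (m - m) \<le> \<epsilon> * (a' - a' + d) + undershoot3 / \<epsilon>"
      by (intro LIMSEQ_le) auto
    then have "e2 - \<epsilon> * d - undershoot3 / \<epsilon> \<le> a' * (2 * d)" by (simp add: algebra_simps)
    then show ?thesis using d by (subst pos_divide_le_eq) auto
  qed
  \<comment> \<open>The limiting growth per step of the third moment, without the nonnegative loss.
    Showing \<open>\<kappa> \<le> 0\<close> bounds \<open>m\<close> from below.\<close>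
  define \<kappa> where "\<kappa> = - 3 * d * m + 3 * e2 * a' + e3"
  have c_step: "- 3 * d * b n + 3 * e2 * a n + e3 \<le> c (Suc n) - c n" for n
  proof -
    have "0 \<le> (\<integral>\<omega>. loss n \<omega> ^ 3 \<partial>M)" using loss_nonneg by (intro Bochner_Integration.integral_nonneg) auto
    then show ?thesis using Q_cube_Suc[of n] unfolding a_def b_def c_def by linarith
  qed
  have \<kappa>_lim: "(\<lambda>n. - 3 * d * b n + 3 * e2 * a n + e3) \<longlonglongrightarrow> \<kappa>"
    unfolding \<kappa>_def by (intro tendsto_intros a' m)
  have "\<kappa> \<le> 0"
  proof (rule ccontr)
    assume "\<not> \<kappa> \<le> 0"
    then have "0 < \<kappa>" by simp
    define r where "r k = 3 / real k * (m * e2) + 4 / real k ^ 2 * (m * (\<integral>\<omega>. \<bar>\<xi> 0 \<omega>\<bar> ^ 3 \<partial>M))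
      + (\<integral>\<omega>. (max 0 (\<xi> 0 \<omega> - real k / 2)) ^ 3 \<partial>M)" for k :: nat
    have "(\<lambda>k. \<integral>\<omega>. (max 0 (\<xi> 0 \<omega> - real k / 2)) ^ 3 \<partial>M) \<longlonglongrightarrow> (\<integral>\<omega>. 0 \<partial>M)"
    proof (rule integral_dominated_convergence[where w = "\<lambda>\<omega>. \<bar>\<xi> 0 \<omega>\<bar> ^ 3"])
      show "AE \<omega> in M. (\<lambda>k. (max 0 (\<xi> 0 \<omega> - real k / 2)) ^ 3) \<longlonglongrightarrow> 0"
      proof (rule AE_I2)
        fix \<omega>
        obtain k0 :: nat where k0: "2 * \<xi> 0 \<omega> \<le> real k0" using real_arch_simple by blast
        have "\<forall>\<^sub>F k in sequentially. (max 0 (\<xi> 0 \<omega> - real k / 2)) ^ 3 = 0"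
          using eventually_ge_at_top[of k0] by eventually_elim (use k0 in auto)
        then show "(\<lambda>k. (max 0 (\<xi> 0 \<omega> - real k / 2)) ^ 3) \<longlonglongrightarrow> 0" by (rule tendsto_eventually)
      qed
      have "(max 0 (x - real k / 2)) ^ 3 \<le> \<bar>x\<bar> ^ 3" for x :: real and k :: nat
        by (intro power_mono) auto
      then show "AE \<omega> in M. norm ((max 0 (\<xi> 0 \<omega> - real k / 2)) ^ 3) \<le> \<bar>\<xi> 0 \<omega>\<bar> ^ 3" for k :: nat
        by simp
    qed (use cube in auto)
    moreover have "(\<lambda>k. 3 / real k * (m * e2)) \<longlonglongrightarrow> 0 * (m * e2)"
      by (intro tendsto_intros lim_const_over_n)
    moreover have "(\<lambda>k. 4 / real k ^ 2 * (m * (\<integral>\<omega>. \<bar>\<xi> 0 \<omega>\<bar> ^ 3 \<partial>M))) \<longlonglongrightarrow> 0 * (m * (\<integral>\<omega>. \<bar>\<xi> 0 \<omega>\<bar> ^ 3 \<partial>M))"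
    proof (intro tendsto_intros)
      have "(\<lambda>k. 4 * (1 / real k) ^ 2) \<longlonglongrightarrow> 4 * 0 ^ 2"
        by (intro tendsto_intros lim_1_over_n)
      then show "(\<lambda>k. 4 / real k ^ 2) \<longlonglongrightarrow> 0" by (simp add: power_divide)
    qed
    ultimately have "r \<longlonglongrightarrow> 0 * (m * e2) + 0 * (m * (\<integral>\<omega>. \<bar>\<xi> 0 \<omega>\<bar> ^ 3 \<partial>M)) + (\<integral>\<omega>. 0 \<partial>M)"
      unfolding r_def by (intro tendsto_add)
    then have "\<forall>\<^sub>F k in sequentially. r k < \<kappa> / 4"
      by (rule order_tendstoD(2)) (use \<open>0 < \<kappa>\<close> in simp)
    then have "\<forall>\<^sub>F k in sequentially. r k < \<kappa> / 4 \<and> 0 < k"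
      using eventually_gt_at_top[of 0] by (rule eventually_conj)
    then obtain k where k: "r k < \<kappa> / 4" "0 < k"
      using eventually_happens'[OF sequentially_bot] by blast
    define R where "R n = (\<integral>\<omega>. (max 0 (Q n \<omega> - real k)) ^ 3 \<partial>M)" for n
    have R_step: "R (Suc n) - R n \<le> \<kappa> / 4" for n
      using truncated_third_moment_step[OF _ bm', of "real k" n] k unfolding R_def r_def by simp
    have "\<forall>\<^sub>F n in sequentially. \<kappa> / 2 < - 3 * d * b n + 3 * e2 * a n + e3"
      using \<kappa>_lim by (rule order_tendstoD(1)) (use \<open>0 < \<kappa>\<close> in simp)
    then obtain n0 where n0: "\<And>n. n0 \<le> n \<Longrightarrow> \<kappa> / 2 < - 3 * d * b n + 3 * e2 * a n + e3"
      unfolding eventually_sequentially by blast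
    \<comment> \<open>Eventually the full third moment gains at least \<open>\<kappa> / 2\<close>
      per step and the truncated one at most \<open>\<kappa> / 4\<close>, so their difference grows
      linearly.\<close>
    have grow: "c n0 - R n0 + real j * (\<kappa> / 4) \<le> c (n0 + j) - R (n0 + j)" for j
    proof (induction j)
      case (Suc j)
      have "real (Suc j) * (\<kappa> / 4) = real j * (\<kappa> / 4) + \<kappa> / 4" by (simp add: algebra_simps add_divide_distrib)
      then show ?case using Suc n0[of "n0 + j"] c_step[of "n0 + j"] R_step[of "n0 + j"]
        unfolding add_Suc_right by linarith
    qed simp
    \<comment> \<open>The same difference is bounded uniformly in \<open>n\<close> because the
      second moments are; this is the contradiction.\<close>
    have bound: "c n - R n \<le> 3 * real k * m" for n
    proof -
      have trunc: "integrable M (\<lambda>\<omega>. (max 0 (Q n \<omega> - real k)) ^ 3)"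
      proof (rule Bochner_Integration.integrable_bound[OF Q_power_integrable_le[of 3 n]])
        show "AE \<omega> in M. norm ((max 0 (Q n \<omega> - real k)) ^ 3) \<le> norm (Q n \<omega> ^ 3)"
          using Q_nonneg[of n] by eventually_elim (use k in \<open>auto intro!: power_mono\<close>)
      qed auto
      have "c n - R n = (\<integral>\<omega>. Q n \<omega> ^ 3 - (max 0 (Q n \<omega> - real k)) ^ 3 \<partial>M)"
        using trunc Q_power_integrable_le[of 3 n] by (simp add: c_def R_def)
      also have "\<dots> \<le> (\<integral>\<omega>. 3 * real k * Q n \<omega> ^ 2 \<partial>M)"
      proof (rule integral_mono_AE)
        show "AE \<omega> in M. Q n \<omega> ^ 3 - (max 0 (Q n \<omega> - real k)) ^ 3 \<le> 3 * real k * Q n \<omega> ^ 2"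
          using Q_nonneg[of n] by eventually_elim (use k in \<open>auto intro!: cube_minus_truncated_le\<close>)
      qed (use trunc Q_power_integrable_le[of 3 n] Q_power_integrable_le[of 2 n] in auto)
      also have "\<dots> = 3 * real k * b n" by (simp add: b_def)
      also have "\<dots> \<le> 3 * real k * m" using bm by (intro mult_left_mono) auto
      finally show ?thesis .
    qed
    obtain j :: nat where "(3 * real k * m - (c n0 - R n0)) / (\<kappa> / 4) < real j"
      using reals_Archimedean2 by blast
    then have "3 * real k * m - (c n0 - R n0) < real j * (\<kappa> / 4)" using \<open>0 < \<kappa>\<close> by (simp add: field_simps)
    then show False using grow[of j] bound[of "n0 + j"] by simp
  qed
  define L where "L = (3 * e2 * ((e2 - \<epsilon> * d - undershoot3 / \<epsilon>) / (2 * d)) + e3) / (3 * d)"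
  have "3 * e2 * ((e2 - \<epsilon> * d - undershoot3 / \<epsilon>) / (2 * d)) + e3 \<le> 3 * e2 * a' + e3"
    using a'_ge e2_nonneg by (intro add_right_mono mult_left_mono) auto
  also have "\<dots> \<le> m * (3 * d)" using \<open>\<kappa> \<le> 0\<close> by (simp add: \<kappa>_def algebra_simps)
  finally have "L \<le> m" unfolding L_def using d by (subst pos_divide_le_eq) auto
  then have "L - \<eta> < m" using \<open>0 < \<eta>\<close> by simp
  then have "\<forall>\<^sub>F n in sequentially. L - \<eta> < b n" using m by (intro order_tendstoD(1))
  then obtain n where "L - \<eta> < b n" using eventually_happens'[OF sequentially_bot] by blast
  then show ?thesis unfolding L_def b_def by (intro exI[of _ n]) simp
qed

end

section \<open>Moments of a Levy process\<close>

lemma (in prob_space) indep_vars_imp_indep_var: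
  assumes "indep_vars (\<lambda>_. borel) X I" "i \<in> I" "j \<in> I" "i \<noteq> j"
  shows "indep_var borel (X i) borel (X j)"
proof -
  have "indep_var (PiM {i} (\<lambda>_. borel)) (\<lambda>\<omega>. \<lambda>k\<in>{i}. X k \<omega>) (PiM {j} (\<lambda>_. borel)) (\<lambda>\<omega>. \<lambda>k\<in>{j}. X k \<omega>)"
    using assms by (intro indep_var_restrict) auto
  then have "indep_var borel ((\<lambda>f. f i) \<circ> (\<lambda>\<omega>. \<lambda>k\<in>{i}. X k \<omega>)) borel ((\<lambda>f. f j) \<circ> (\<lambda>\<omega>. \<lambda>k\<in>{j}. X k \<omega>))"
    by (rule indep_var_compose) auto
  then show ?thesis by (simp add: comp_def)
qed

text \<open>By Fubini, \<open>A + b\<close> has a third absolute moment for almost every value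
  \<open>b\<close> of \<open>B\<close>; one such \<open>b\<close> exists, and shifting by a constant
  preserves integrability.\<close>

lemma (in prob_space) indep_var_sum_cube_integrable:
  fixes A B :: "'a \<Rightarrow> real"
  assumes ind: "indep_var borel A borel B" and int: "integrable M (\<lambda>\<omega>. \<bar>A \<omega> + B \<omega>\<bar> ^ 3)"
  shows "integrable M (\<lambda>\<omega>. \<bar>A \<omega>\<bar> ^ 3)"
proof -
  have [measurable]: "A \<in> borel_measurable M" "B \<in> borel_measurable M"
    using indep_var_rv1[OF ind] indep_var_rv2[OF ind] by auto
  interpret A: prob_space "distr M borel A" by (rule prob_space_distr) simp
  interpret B: prob_space "distr M borel B" by (rule prob_space_distr) simp
  interpret AB: pair_sigma_finite "distr M borel A" "distr M borel B" ..
  have "integrable (distr M borel A \<Otimes>\<^sub>M distr M borel B) (\<lambda>(a, b). \<bar>a + b\<bar> ^ 3)"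
  proof -
    have pair: "distr M borel A \<Otimes>\<^sub>M distr M borel B = distr M (borel \<Otimes>\<^sub>M borel) (\<lambda>\<omega>. (A \<omega>, B \<omega>))"
      using ind by (simp add: indep_var_distribution_eq)
    show ?thesis unfolding pair using int by (subst integrable_distr_eq) auto
  qed
  then have "AE b in distr M borel B. integrable (distr M borel A) (\<lambda>a. \<bar>a + b\<bar> ^ 3)"
    by (rule AB.AE_integrable_snd)
  moreover have "ae_filter (distr M borel B) \<noteq> bot"
    using B.emeasure_space_1 by (simp add: ae_filter_eq_bot_iff del: emeasure_distr space_distr)
  ultimately obtain b where "integrable (distr M borel A) (\<lambda>a. \<bar>a + b\<bar> ^ 3)"
    using eventually_happens' by blast
  then have i: "integrable M (\<lambda>\<omega>. \<bar>A \<omega> + b\<bar> ^ 3)" by (subst (asm) integrable_distr_eq) auto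
  have "integrable M (\<lambda>\<omega>. 4 * \<bar>A \<omega> + b\<bar> ^ 3 + 4 * \<bar>- b\<bar> ^ 3)"
    using i by auto
  then show ?thesis
  proof (rule Bochner_Integration.integrable_bound)
    show "AE \<omega> in M. norm (\<bar>A \<omega>\<bar> ^ 3) \<le> norm (4 * \<bar>A \<omega> + b\<bar> ^ 3 + 4 * \<bar>- b\<bar> ^ 3)"
    proof (rule AE_I2)
      fix \<omega>
      show "norm (\<bar>A \<omega>\<bar> ^ 3) \<le> norm (4 * \<bar>A \<omega> + b\<bar> ^ 3 + 4 * \<bar>- b\<bar> ^ 3)"
        using abs_add_cube_le[of "A \<omega> + b" "- b"] by simp
    qed
  qed auto
qed

text \<open>The convex function cubing the positive part lies above its tangent at
  \<open>a\<close>.\<close>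

lemma pos_part_cube_tangent:
  fixes a b :: real
  shows "(max 0 a) ^ 3 + 3 * ((max 0 a) ^ 2 * b) \<le> (max 0 (a + b)) ^ 3"
proof (cases "a \<le> 0")
  case False
  show ?thesis
  proof (cases "0 \<le> a + b")
    case True
    have "0 \<le> b ^ 2 * (3 * a + b)" using True False by (intro mult_nonneg_nonneg) auto
    also have "b ^ 2 * (3 * a + b) = (a + b) ^ 3 - (a ^ 3 + 3 * (a ^ 2 * b))"
      by (simp add: power2_eq_square power3_eq_cube algebra_simps)
    finally show ?thesis using True False by simp
  next
    case neg: False
    have "a ^ 2 * (a + 3 * b) \<le> 0" using neg False by (intro mult_nonneg_nonpos) auto
    then have "a ^ 3 + 3 * (a ^ 2 * b) \<le> 0" by (simp add: power2_eq_square power3_eq_cube algebra_simps)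
    then show ?thesis using neg False by simp
  qed
qed simp

lemma (in prob_space) pos_part_cube_integrable:
  fixes X :: "'a \<Rightarrow> real"
  assumes [measurable]: "X \<in> borel_measurable M" and int: "integrable M (\<lambda>\<omega>. \<bar>X \<omega>\<bar> ^ 3)"
    and le: "\<And>x. f x \<le> \<bar>x\<bar>" and [measurable]: "f \<in> borel_measurable borel" and "k \<le> 3"
  shows "integrable M (\<lambda>\<omega>. (max 0 (f (X \<omega>))) ^ k)"
proof (rule Bochner_Integration.integrable_bound[OF integrable_power_le(2)[OF assms(1) int \<open>k \<le> 3\<close>]])
  have "(max 0 (f x)) ^ k \<le> \<bar>x\<bar> ^ k" for x using le[of x] by (intro power_mono) auto
  then show "AE \<omega> in M. norm ((max 0 (f (X \<omega>))) ^ k) \<le> norm (\<bar>X \<omega>\<bar> ^ k)" by simp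
qed measurable

text \<open>Conditional Jensen in elementary form: integrate the tangent inequality, whose linear
  term vanishes by independence and centring.\<close>

lemma (in prob_space) centred_summand_pos_cube_le:
  fixes A B :: "'a \<Rightarrow> real"
  assumes ind: "indep_var borel A borel B"
    and int: "integrable M (\<lambda>\<omega>. \<bar>A \<omega>\<bar> ^ 3)" "integrable M (\<lambda>\<omega>. \<bar>B \<omega>\<bar> ^ 3)"
    and mean: "(\<integral>\<omega>. B \<omega> \<partial>M) = 0"
  shows "(\<integral>\<omega>. (max 0 (A \<omega>)) ^ 3 \<partial>M) \<le> (\<integral>\<omega>. (max 0 (A \<omega> + B \<omega>)) ^ 3 \<partial>M)"
proof -
  have [measurable]: "A \<in> borel_measurable M" "B \<in> borel_measurable M"
    using indep_var_rv1[OF ind] indep_var_rv2[OF ind] by auto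
  have A3: "integrable M (\<lambda>\<omega>. (max 0 (A \<omega>)) ^ 3)" and A2: "integrable M (\<lambda>\<omega>. (max 0 (A \<omega>)) ^ 2)"
    by (rule pos_part_cube_integrable[of A "\<lambda>x. x"]; use int in simp)+
  have B: "integrable M B" using integrable_power_le(1)[of B 3 1] int by simp
  have AB3: "integrable M (\<lambda>\<omega>. (max 0 (A \<omega> + B \<omega>)) ^ 3)"
  proof (rule Bochner_Integration.integrable_bound)
    show "integrable M (\<lambda>\<omega>. 4 * \<bar>A \<omega>\<bar> ^ 3 + 4 * \<bar>B \<omega>\<bar> ^ 3)" using int by auto
    have "(max 0 (x + y)) ^ 3 \<le> 4 * \<bar>x\<bar> ^ 3 + 4 * \<bar>y\<bar> ^ 3" for x y :: real
    proof -
      have "(max 0 (x + y)) ^ 3 \<le> \<bar>x + y\<bar> ^ 3" by (intro power_mono) auto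
      then show ?thesis using abs_add_cube_le[of x y] by linarith
    qed
    then show "AE \<omega> in M. norm ((max 0 (A \<omega> + B \<omega>)) ^ 3) \<le> norm (4 * \<bar>A \<omega>\<bar> ^ 3 + 4 * \<bar>B \<omega>\<bar> ^ 3)"
      by simp
  qed measurable
  have m: "integrable M (\<lambda>\<omega>. (max 0 (A \<omega>)) ^ 2 * B \<omega>)"
    "(\<integral>\<omega>. (max 0 (A \<omega>)) ^ 2 * B \<omega> \<partial>M) = (\<integral>\<omega>. (max 0 (A \<omega>)) ^ 2 \<partial>M) * (\<integral>\<omega>. B \<omega> \<partial>M)"
    by (rule indep_var_integral_mult[OF ind, of "\<lambda>x. (max 0 x) ^ 2" "\<lambda>x. x"]; use A2 B in simp)+
  have "(\<integral>\<omega>. (max 0 (A \<omega>)) ^ 3 \<partial>M) = (\<integral>\<omega>. (max 0 (A \<omega>)) ^ 3 + 3 * ((max 0 (A \<omega>)) ^ 2 * B \<omega>) \<partial>M)"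
    using m A3 mean by simp
  also have "\<dots> \<le> (\<integral>\<omega>. (max 0 (A \<omega> + B \<omega>)) ^ 3 \<partial>M)"
    using m A3 AB3 by (intro integral_mono pos_part_cube_tangent) auto
  finally show ?thesis .
qed

section \<open>Moments of increments as functions of time\<close>

context levy_process
begin

lemma increment_measurable [measurable (raw)]:
  "0 \<le> s \<Longrightarrow> 0 \<le> t \<Longrightarrow> (\<lambda>\<omega>. U t \<omega> - U s \<omega>) \<in> borel_measurable M"
  using random_variable by (intro borel_measurable_diff) auto

lemma increment_integral:
  assumes "0 \<le> s" "0 \<le> h" and [measurable]: "(f :: real \<Rightarrow> real) \<in> borel_measurable borel"
  shows "integrable M (\<lambda>\<omega>. f (U (s + h) \<omega> - U s \<omega>)) \<longleftrightarrow> integrable M (\<lambda>\<omega>. f (U h \<omega>))"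
    and "(\<integral>\<omega>. f (U (s + h) \<omega> - U s \<omega>) \<partial>M) = (\<integral>\<omega>. f (U h \<omega>) \<partial>M)"
proof -
  have [measurable]: "U h \<in> borel_measurable M" "(\<lambda>\<omega>. U (s + h) \<omega> - U s \<omega>) \<in> borel_measurable M"
    using assms random_variable increment_measurable by auto
  have "integrable M (\<lambda>\<omega>. f (U (s + h) \<omega> - U s \<omega>)) \<longleftrightarrow>
      integrable (distr M borel (\<lambda>\<omega>. U (s + h) \<omega> - U s \<omega>)) f"
    by (subst integrable_distr_eq) auto
  also have "\<dots> \<longleftrightarrow> integrable M (\<lambda>\<omega>. f (U h \<omega>))"
    unfolding stationary_increments[OF assms(1,2)] by (subst integrable_distr_eq) auto
  finally show "integrable M (\<lambda>\<omega>. f (U (s + h) \<omega> - U s \<omega>)) \<longleftrightarrow> integrable M (\<lambda>\<omega>. f (U h \<omega>))" .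
  have "(\<integral>\<omega>. f (U (s + h) \<omega> - U s \<omega>) \<partial>M) = (\<integral>x. f x \<partial>distr M borel (\<lambda>\<omega>. U (s + h) \<omega> - U s \<omega>))"
    by (subst integral_distr) auto
  also have "\<dots> = (\<integral>\<omega>. f (U h \<omega>) \<partial>M)"
    unfolding stationary_increments[OF assms(1,2)] by (subst integral_distr) auto
  finally show "(\<integral>\<omega>. f (U (s + h) \<omega> - U s \<omega>) \<partial>M) = (\<integral>\<omega>. f (U h \<omega>) \<partial>M)" .
qed

lemma consecutive_increments_indep:
  assumes "0 \<le> s" "0 \<le> h"
  shows "indep_var borel (\<lambda>\<omega>. U s \<omega> - U 0 \<omega>) borel (\<lambda>\<omega>. U (s + h) \<omega> - U s \<omega>)"
proof -
  \<comment> \<open>The times 0, \<open>s\<close>, \<open>s + h\<close>, continued as a constant to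
    give the monotone sequence that \<open>indep_increments\<close> expects.\<close>
  define t where "t i = (if i = 0 then 0 else if i = 1 then s else s + h)" for i :: nat
  have "mono t" using assms by (intro monoI) (auto simp: t_def)
  then have "indep_vars (\<lambda>_. borel) (\<lambda>i \<omega>. U (t (Suc i)) \<omega> - U (t i) \<omega>) {..<2}"
    by (intro indep_increments) (simp add: t_def)
  from indep_vars_imp_indep_var[OF this, of 0 1] show ?thesis by (simp add: t_def)
qed

lemma cube_integrable_add:
  assumes "0 \<le> s" "0 \<le> h" "integrable M (\<lambda>\<omega>. \<bar>U s \<omega>\<bar> ^ 3)" "integrable M (\<lambda>\<omega>. \<bar>U h \<omega>\<bar> ^ 3)"
  shows "integrable M (\<lambda>\<omega>. \<bar>U (s + h) \<omega>\<bar> ^ 3)"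
proof -
  have "integrable M (\<lambda>\<omega>. 4 * \<bar>U s \<omega>\<bar> ^ 3 + 4 * \<bar>U (s + h) \<omega> - U s \<omega>\<bar> ^ 3)"
    using assms increment_integral(1)[of s h "\<lambda>x. \<bar>x\<bar> ^ 3"] by auto
  then show ?thesis
  proof (rule Bochner_Integration.integrable_bound)
    show "AE \<omega> in M. norm (\<bar>U (s + h) \<omega>\<bar> ^ 3) \<le> norm (4 * \<bar>U s \<omega>\<bar> ^ 3 + 4 * \<bar>U (s + h) \<omega> - U s \<omega>\<bar> ^ 3)"
    proof (rule AE_I2)
      fix \<omega>
      show "norm (\<bar>U (s + h) \<omega>\<bar> ^ 3) \<le> norm (4 * \<bar>U s \<omega>\<bar> ^ 3 + 4 * \<bar>U (s + h) \<omega> - U s \<omega>\<bar> ^ 3)"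
        using abs_add_cube_le[of "U s \<omega>" "U (s + h) \<omega> - U s \<omega>"] by simp
    qed
  qed (use assms random_variable[of "s + h"] in simp)
qed

lemma cube_integrable_summand:
  assumes "0 \<le> s" "0 \<le> h" "integrable M (\<lambda>\<omega>. \<bar>U (s + h) \<omega>\<bar> ^ 3)"
  shows "integrable M (\<lambda>\<omega>. \<bar>U s \<omega>\<bar> ^ 3)"
proof -
  have "integrable M (\<lambda>\<omega>. \<bar>U (0 + (s + h)) \<omega> - U 0 \<omega>\<bar> ^ 3)"
    using increment_integral(1)[of 0 "s + h" "\<lambda>x. \<bar>x\<bar> ^ 3"] assms by simp
  then have "integrable M (\<lambda>\<omega>. \<bar>(U s \<omega> - U 0 \<omega>) + (U (s + h) \<omega> - U s \<omega>)\<bar> ^ 3)" by simp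
  then have "integrable M (\<lambda>\<omega>. \<bar>U s \<omega> - U 0 \<omega>\<bar> ^ 3)"
    by (rule indep_var_sum_cube_integrable[OF consecutive_increments_indep[OF assms(1,2)]])
  then show ?thesis using increment_integral(1)[of 0 s "\<lambda>x. \<bar>x\<bar> ^ 3"] assms by simp
qed

end

locale cubic_levy_process = levy_process +
  assumes cube_1: "integrable M (\<lambda>\<omega>. \<bar>U 1 \<omega>\<bar> ^ 3)" and mean_1: "(\<integral>\<omega>. U 1 \<omega> \<partial>M) = 1"
begin

text \<open>Integrability climbs along the integers by adding increments and descends to
  \<open>s\<close> because \<open>U s\<close> is, up to the start, an independent summand of a later
  value.\<close>

lemma cube_integrable:
  assumes "0 \<le> s"
  shows "integrable M (\<lambda>\<omega>. \<bar>U s \<omega>\<bar> ^ 3)"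
proof -
  have nat: "integrable M (\<lambda>\<omega>. \<bar>U (real (Suc n)) \<omega>\<bar> ^ 3)" for n
  proof (induction n)
    case (Suc n)
    then show ?case using cube_integrable_add[of "real (Suc n)" 1] cube_1 by (simp add: add.commute)
  qed (use cube_1 in simp)
  obtain n :: nat where n: "s \<le> real n" using real_arch_simple by blast
  show ?thesis
    using cube_integrable_summand[of s "real (Suc n) - s"] nat[of n] n assms by simp
qed

lemma power_integrable: "0 \<le> s \<Longrightarrow> k \<le> 3 \<Longrightarrow> integrable M (\<lambda>\<omega>. U s \<omega> ^ k)"
  using integrable_power_le(1)[OF random_variable cube_integrable] by blast

lemma U_integrable: "0 \<le> s \<Longrightarrow> integrable M (U s)"
  using power_integrable[of s 1] by simp

lemma shifted_cube_integrable:
  assumes "0 \<le> s"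
  shows "integrable M (\<lambda>\<omega>. \<bar>U s \<omega> - c\<bar> ^ 3)"
proof (rule Bochner_Integration.integrable_bound)
  show "integrable M (\<lambda>\<omega>. 4 * \<bar>U s \<omega>\<bar> ^ 3 + 4 * \<bar>- c\<bar> ^ 3)"
    using cube_integrable[OF assms] by auto
  show "AE \<omega> in M. norm (\<bar>U s \<omega> - c\<bar> ^ 3) \<le> norm (4 * \<bar>U s \<omega>\<bar> ^ 3 + 4 * \<bar>- c\<bar> ^ 3)"
  proof (rule AE_I2)
    fix \<omega>
    show "norm (\<bar>U s \<omega> - c\<bar> ^ 3) \<le> norm (4 * \<bar>U s \<omega>\<bar> ^ 3 + 4 * \<bar>- c\<bar> ^ 3)"
      using abs_add_cube_le[of "U s \<omega>" "- c"] by simp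
  qed
qed (use random_variable[OF assms] in simp)

lemma shifted_power_integrable:
  assumes "0 \<le> s" "k \<le> 3"
  shows "integrable M (\<lambda>\<omega>. (U s \<omega> - c) ^ k)"
  by (rule integrable_power_le(1)[OF _ shifted_cube_integrable]) (use assms random_variable in auto)

lemma shifted_power_integrable_increment:
  assumes "0 \<le> s" "0 \<le> h" "k \<le> 3"
  shows "integrable M (\<lambda>\<omega>. (U (s + h) \<omega> - U s \<omega> - c) ^ k)"
  using increment_integral(1)[of s h "\<lambda>x. (x - c) ^ k"] shifted_power_integrable[of h k c] assms by simp

definition "mean s = (\<integral>\<omega>. U s \<omega> \<partial>M)"
definition "cent k s = (\<integral>\<omega>. (U s \<omega> - mean s) ^ k \<partial>M)"

lemma mean_increment: "0 \<le> s \<Longrightarrow> 0 \<le> h \<Longrightarrow> (\<integral>\<omega>. U (s + h) \<omega> - U s \<omega> \<partial>M) = mean h"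
  using increment_integral(2)[of s h "\<lambda>x. x"] by (simp add: mean_def)

lemma mean_add: "0 \<le> s \<Longrightarrow> 0 \<le> h \<Longrightarrow> mean (s + h) = mean s + mean h"
  using mean_increment[of s h] U_integrable by (simp add: mean_def)

lemma cent_increment:
  "0 \<le> s \<Longrightarrow> 0 \<le> h \<Longrightarrow> (\<integral>\<omega>. (U (s + h) \<omega> - U s \<omega> - mean h) ^ k \<partial>M) = cent k h"
  using increment_integral(2)[of s h "\<lambda>x. (x - mean h) ^ k"] by (simp add: cent_def)

text \<open>The path may start away from 0 on a null set, so \<open>U s\<close> is replaced by \<open>U s - U 0\<close>, which has the
  same law.\<close>

lemma centred_increments:
  assumes "0 \<le> s" "0 \<le> h"
  defines "A \<equiv> \<lambda>\<omega>. U s \<omega> - U 0 \<omega> - mean s" and "B \<equiv> \<lambda>\<omega>. U (s + h) \<omega> - U s \<omega> - mean h"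
  shows "indep_var borel A borel B"
    and "\<And>k. k \<le> 3 \<Longrightarrow> integrable M (\<lambda>\<omega>. A \<omega> ^ k)" "\<And>k. k \<le> 3 \<Longrightarrow> integrable M (\<lambda>\<omega>. B \<omega> ^ k)"
    and "\<And>k. (\<integral>\<omega>. A \<omega> ^ k \<partial>M) = cent k s" "\<And>k. (\<integral>\<omega>. B \<omega> ^ k \<partial>M) = cent k h"
    and "\<And>k. (\<integral>\<omega>. (A \<omega> + B \<omega>) ^ k \<partial>M) = cent k (s + h)"
    and "(\<integral>\<omega>. A \<omega> \<partial>M) = 0" "(\<integral>\<omega>. B \<omega> \<partial>M) = 0"
proof -
  have "indep_var borel ((\<lambda>x. x - mean s) \<circ> (\<lambda>\<omega>. U s \<omega> - U 0 \<omega>)) borel ((\<lambda>x. x - mean h) \<circ> (\<lambda>\<omega>. U (s + h) \<omega> - U s \<omega>))"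
    by (rule indep_var_compose[OF consecutive_increments_indep[OF assms(1,2)]]) auto
  then show "indep_var borel A borel B" by (simp add: A_def B_def comp_def)
  show "integrable M (\<lambda>\<omega>. A \<omega> ^ k)" if "k \<le> 3" for k
    using shifted_power_integrable_increment[of 0 s k "mean s"] that assms by (simp add: A_def)
  show "integrable M (\<lambda>\<omega>. B \<omega> ^ k)" if "k \<le> 3" for k
    using shifted_power_integrable_increment[of s h k "mean h"] that assms by (simp add: B_def)
  show "(\<integral>\<omega>. A \<omega> ^ k \<partial>M) = cent k s" for k
    using cent_increment[of 0 s k] assms by (simp add: A_def)
  show "(\<integral>\<omega>. B \<omega> ^ k \<partial>M) = cent k h" for k
    using cent_increment[of s h k] assms by (simp add: B_def)
  have AB: "A \<omega> + B \<omega> = U (0 + (s + h)) \<omega> - U 0 \<omega> - mean (s + h)" for \<omega>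
    using assms by (simp add: A_def B_def mean_add)
  show "(\<integral>\<omega>. (A \<omega> + B \<omega>) ^ k \<partial>M) = cent k (s + h)" for k
    unfolding AB by (rule cent_increment) (use assms in auto)
  show "(\<integral>\<omega>. A \<omega> \<partial>M) = 0"
    using mean_increment[of 0 s] assms U_integrable[of s] U_integrable[of 0] by (simp add: A_def prob_space)
  show "(\<integral>\<omega>. B \<omega> \<partial>M) = 0"
    using mean_increment[of s h] assms U_integrable[of s] U_integrable[of "s + h"] by (simp add: B_def prob_space)
qed

text \<open>The second and third central moments are cumulants: after expanding the power, each
  mixed term contains a centred factor to the first power.\<close>

lemma cent_add:
  assumes "0 \<le> s" "0 \<le> h"
  shows "cent 2 (s + h) = cent 2 s + cent 2 h" "cent 3 (s + h) = cent 3 s + cent 3 h"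
proof -
  define A where "A \<omega> = U s \<omega> - U 0 \<omega> - mean s" for \<omega>
  define B where "B \<omega> = U (s + h) \<omega> - U s \<omega> - mean h" for \<omega>
  note AB = centred_increments[OF assms, folded A_def B_def]
  have A1: "integrable M A" and B1: "integrable M B" using AB(2)[of 1] AB(3)[of 1] by simp_all
  have A2: "integrable M (\<lambda>\<omega>. A \<omega> ^ 2)" and A3: "integrable M (\<lambda>\<omega>. A \<omega> ^ 3)" by (rule AB(2); simp)+
  have B2: "integrable M (\<lambda>\<omega>. B \<omega> ^ 2)" and B3: "integrable M (\<lambda>\<omega>. B \<omega> ^ 3)" by (rule AB(3); simp)+
  have m11: "integrable M (\<lambda>\<omega>. A \<omega> * B \<omega>)" "(\<integral>\<omega>. A \<omega> * B \<omega> \<partial>M) = 0"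
    by (rule indep_var_integral_mult[OF AB(1), of "\<lambda>x. x" "\<lambda>x. x"]
             trans[OF indep_var_integral_mult(2)[OF AB(1), of "\<lambda>x. x" "\<lambda>x. x"]];
        use A1 B1 AB(7,8) in simp)+
  have m21: "integrable M (\<lambda>\<omega>. A \<omega> ^ 2 * B \<omega>)" "(\<integral>\<omega>. A \<omega> ^ 2 * B \<omega> \<partial>M) = 0"
    by (rule indep_var_integral_mult[OF AB(1), of "\<lambda>x. x ^ 2" "\<lambda>x. x"]
             trans[OF indep_var_integral_mult(2)[OF AB(1), of "\<lambda>x. x ^ 2" "\<lambda>x. x"]];
        use A2 B1 AB(7,8) in simp)+
  have m12: "integrable M (\<lambda>\<omega>. A \<omega> * B \<omega> ^ 2)" "(\<integral>\<omega>. A \<omega> * B \<omega> ^ 2 \<partial>M) = 0"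
    by (rule indep_var_integral_mult[OF AB(1), of "\<lambda>x. x" "\<lambda>x. x ^ 2"]
             trans[OF indep_var_integral_mult(2)[OF AB(1), of "\<lambda>x. x" "\<lambda>x. x ^ 2"]];
        use A1 B2 AB(7,8) in simp)+
  have e2: "(A \<omega> + B \<omega>) ^ 2 = A \<omega> ^ 2 + 2 * (A \<omega> * B \<omega>) + B \<omega> ^ 2" for \<omega>
    by (simp add: power2_eq_square algebra_simps)
  have e3: "(A \<omega> + B \<omega>) ^ 3 = A \<omega> ^ 3 + 3 * (A \<omega> ^ 2 * B \<omega>) + 3 * (A \<omega> * B \<omega> ^ 2) + B \<omega> ^ 3" for \<omega>
    by (simp add: power2_eq_square power3_eq_cube algebra_simps)
  show "cent 2 (s + h) = cent 2 s + cent 2 h"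
    unfolding AB(6)[of 2, symmetric] e2 by (simp add: A2 B2 m11 AB(4,5))
  show "cent 3 (s + h) = cent 3 s + cent 3 h"
    unfolding AB(6)[of 3, symmetric] e3 by (simp add: A3 B3 m21 m12 AB(4,5))
qed

lemma cent_2_nonneg: "0 \<le> cent 2 s"
  unfolding cent_def by simp

lemma cent_2_mono: "0 \<le> s \<Longrightarrow> s \<le> t \<Longrightarrow> cent 2 s \<le> cent 2 t"
  using cent_add(1)[of s "t - s"] cent_2_nonneg[of "t - s"] by simp

text \<open>Additivity and nonnegativity make the variance monotone, hence bounded on
  \<open>[0, 1]\<close>.\<close>

lemma cent_2: "0 \<le> s \<Longrightarrow> cent 2 s = s * cent 2 1"
  by (rule additive_bounded_imp_linear[of _ 1 "cent 2 1"])
     (use cent_add(1) cent_2_nonneg cent_2_mono in auto)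

text \<open>The mean has no sign, so boundedness must come from the paths. If means exceeded 1 at
  times tending to 0, each increment would be far from 0 or far from its mean; right-continuity
  excludes the first and the vanishing variance the second.\<close>

lemma mean_bounded_near_0: "\<exists>e>0. \<forall>s. 0 < s \<longrightarrow> s \<le> e \<longrightarrow> \<bar>mean s\<bar> \<le> 1"
proof (rule ccontr)
  assume "\<not> ?thesis"
  then have "\<exists>s. 0 < s \<and> s \<le> 1 / real (Suc n) \<and> 1 < \<bar>mean s\<bar>" for n
    by (metis linorder_not_le of_nat_0_less_iff zero_less_Suc zero_less_divide_1_iff)
  then obtain s where s: "\<And>n. 0 < s n" "\<And>n. s n \<le> 1 / real (Suc n)" "\<And>n. 1 < \<bar>mean (s n)\<bar>" by metis
  have s0: "s \<longlonglongrightarrow> 0"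
  proof (rule tendsto_sandwich[of "\<lambda>_. 0" _ _ "\<lambda>n. 1 / real (Suc n)"])
    show "\<forall>\<^sub>F n in sequentially. 0 \<le> s n" by (intro always_eventually allI less_imp_le s(1))
    show "\<forall>\<^sub>F n in sequentially. s n \<le> 1 / real (Suc n)" by (intro always_eventually allI s(2))
  qed (use LIMSEQ_inverse_real_of_nat in \<open>auto simp: inverse_eq_divide\<close>)
  define Z where "Z n \<omega> = U (s n) \<omega> - U 0 \<omega>" for n \<omega>
  have [measurable]: "Z n \<in> borel_measurable M" for n
    unfolding Z_def using s(1)[of n] by (intro increment_measurable) auto
  have "(\<lambda>n. \<integral>\<omega>. min 1 \<bar>Z n \<omega>\<bar> \<partial>M) \<longlonglongrightarrow> (\<integral>\<omega>. 0 \<partial>M)"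
  proof (rule integral_dominated_convergence[where w = "\<lambda>_. 1"])
    show "AE \<omega> in M. (\<lambda>n. min 1 \<bar>Z n \<omega>\<bar>) \<longlonglongrightarrow> 0"
    proof (rule AE_I2)
      fix \<omega> assume "\<omega> \<in> space M"
      then have "((\<lambda>t. U t \<omega>) \<longlongrightarrow> U 0 \<omega>) (at_right 0)"
        using cadlag_paths by (simp add: cadlag_def)
      moreover have "filterlim s (at_right 0) sequentially"
        unfolding filterlim_at
        using s0 by (auto intro!: always_eventually simp: s(1) s(1)[THEN less_imp_neq, THEN not_sym])
      ultimately have "(\<lambda>n. U (s n) \<omega>) \<longlonglongrightarrow> U 0 \<omega>" by (rule filterlim_compose)
      then have "(\<lambda>n. min 1 \<bar>Z n \<omega>\<bar>) \<longlonglongrightarrow> min 1 \<bar>U 0 \<omega> - U 0 \<omega>\<bar>"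
        unfolding Z_def by (intro tendsto_intros)
      then show "(\<lambda>n. min 1 \<bar>Z n \<omega>\<bar>) \<longlonglongrightarrow> 0" by simp
    qed
  qed auto
  then have lim1: "(\<lambda>n. \<integral>\<omega>. min 1 \<bar>Z n \<omega>\<bar> \<partial>M) \<longlonglongrightarrow> 0" by simp
  have lim2: "(\<lambda>n. s n * cent 2 1) \<longlonglongrightarrow> 0" using tendsto_mult_left_zero[OF s0] .
  have ge: "1 \<le> (\<integral>\<omega>. min 1 \<bar>Z n \<omega>\<bar> \<partial>M) + (1 / 4 + s n * cent 2 1)" for n
  proof -
    have sn: "0 \<le> s n" using s(1)[of n] by simp
    have i2: "integrable M (\<lambda>\<omega>. (Z n \<omega> - mean (s n)) ^ 2)"
      using shifted_power_integrable_increment[of 0 "s n" 2 "mean (s n)"] sn by (simp add: Z_def)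
    have v: "(\<integral>\<omega>. (Z n \<omega> - mean (s n)) ^ 2 \<partial>M) = s n * cent 2 1"
      using cent_increment[of 0 "s n" 2] cent_2[OF sn] sn by (simp add: Z_def)
    have i1: "integrable M (\<lambda>\<omega>. min 1 \<bar>Z n \<omega>\<bar>)"
      by (rule integrable_const_bound[where B = 1]) auto
    have "1 = (\<integral>\<omega>. (1::real) \<partial>M)" by (simp add: prob_space)
    also have "\<dots> \<le> (\<integral>\<omega>. min 1 \<bar>Z n \<omega>\<bar> + (1 / 4 + (Z n \<omega> - mean (s n)) ^ 2) \<partial>M)"
    proof (rule integral_mono)
      fix \<omega>
      \<comment> \<open>The deviation \<open>y\<close> enters through
        \<open>y \<le> 1 / 4 + y^2\<close>, leaving \<open>1 \<le> 1 / 4\<close> in the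
        limit.\<close>
      define y where "y = \<bar>Z n \<omega> - mean (s n)\<bar>"
      have "0 \<le> (y - 1 / 2) ^ 2" by simp
      then have "y \<le> 1 / 4 + (Z n \<omega> - mean (s n)) ^ 2"
        by (simp add: y_def power2_eq_square algebra_simps)
      moreover have "1 \<le> \<bar>Z n \<omega>\<bar> + y" using s(3)[of n] unfolding y_def by linarith
      moreover have "0 \<le> (Z n \<omega> - mean (s n)) ^ 2" by simp
      moreover have "min 1 \<bar>Z n \<omega>\<bar> = (if 1 \<le> \<bar>Z n \<omega>\<bar> then 1 else \<bar>Z n \<omega>\<bar>)" by (simp add: min_def)
      ultimately show "1 \<le> min 1 \<bar>Z n \<omega>\<bar> + (1 / 4 + (Z n \<omega> - mean (s n)) ^ 2)"
        by (cases "1 \<le> \<bar>Z n \<omega>\<bar>"; simp only: if_True if_False; linarith)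
    qed (use i1 i2 in auto)
    also have "\<dots> = (\<integral>\<omega>. min 1 \<bar>Z n \<omega>\<bar> \<partial>M) + (1 / 4 + s n * cent 2 1)"
      using i1 i2 v by (simp add: prob_space)
    finally show ?thesis .
  qed
  have "(\<lambda>n. (\<integral>\<omega>. min 1 \<bar>Z n \<omega>\<bar> \<partial>M) + (1 / 4 + s n * cent 2 1)) \<longlonglongrightarrow> 0 + (1 / 4 + 0)"
    by (intro tendsto_intros lim1 lim2)
  then have "1 \<le> (0 :: real) + (1 / 4 + 0)" using ge by (intro LIMSEQ_le_const) auto
  then show False by simp
qed

lemma mean_eq: "0 \<le> s \<Longrightarrow> mean s = s"
proof -
  assume "0 \<le> s"
  obtain e where e: "0 < e" "\<And>s. 0 < s \<Longrightarrow> s \<le> e \<Longrightarrow> \<bar>mean s\<bar> \<le> 1" using mean_bounded_near_0 by blast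
  have "mean 0 = 0" using mean_add[of 0 0] by simp
  then have "\<bar>mean s\<bar> \<le> 1" if "0 \<le> s" "s \<le> e" for s using e(2)[of s] that by (cases "s = 0") auto
  then have "mean s = s * mean 1"
    by (intro additive_bounded_imp_linear[OF mean_add \<open>0 < e\<close> _ \<open>0 \<le> s\<close>])
  then show "mean s = s" using mean_1 by (simp add: mean_def)
qed

text \<open>Centred at \<open>s\<close>, which is the mean of \<open>U s\<close> by
  \<open>mean_eq\<close>.\<close>

definition "under3 s = (\<integral>\<omega>. (max 0 (- (U s \<omega> - s))) ^ 3 \<partial>M)"
definition "over3 s = (\<integral>\<omega>. (max 0 (U s \<omega> - s)) ^ 3 \<partial>M)"

text \<open>Up to time \<open>t\<close> an independent centred increment is added, which cannot
  decrease the mean of a convex function; negating both increments treats the lower part.\<close>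

lemma part3_mono:
  assumes "0 \<le> s" "s \<le> t"
  shows "under3 s \<le> under3 t" "over3 s \<le> over3 t"
proof -
  define h where "h = t - s"
  have h: "0 \<le> h" "t = s + h" using assms by (auto simp: h_def)
  define A where "A \<omega> = U s \<omega> - U 0 \<omega> - s" for \<omega>
  define B where "B \<omega> = U (s + h) \<omega> - U s \<omega> - h" for \<omega>
  note AB = centred_increments[OF assms(1) h(1), unfolded mean_eq[OF assms(1)] mean_eq[OF h(1)], folded A_def B_def]
  have A3: "integrable M (\<lambda>\<omega>. \<bar>A \<omega>\<bar> ^ 3)" and B3: "integrable M (\<lambda>\<omega>. \<bar>B \<omega>\<bar> ^ 3)"
    using integrable_abs[OF AB(2)[of 3]] integrable_abs[OF AB(3)[of 3]] by (simp_all add: power_abs)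
  have "(\<integral>\<omega>. (max 0 (A \<omega>)) ^ 3 \<partial>M) \<le> (\<integral>\<omega>. (max 0 (A \<omega> + B \<omega>)) ^ 3 \<partial>M)"
    by (rule centred_summand_pos_cube_le[OF AB(1) A3 B3 AB(8)])
  moreover have "(\<integral>\<omega>. (max 0 (A \<omega>)) ^ 3 \<partial>M) = over3 s"
    using increment_integral(2)[of 0 s "\<lambda>x. (max 0 (x - s)) ^ 3"] assms by (simp add: A_def over3_def)
  moreover have "(\<integral>\<omega>. (max 0 (A \<omega> + B \<omega>)) ^ 3 \<partial>M) = over3 t"
    using increment_integral(2)[of 0 t "\<lambda>x. (max 0 (x - t)) ^ 3"] assms h
    by (simp add: A_def B_def over3_def algebra_simps)
  ultimately show "over3 s \<le> over3 t" by simp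
  have "indep_var borel (uminus \<circ> A) borel (uminus \<circ> B)"
    by (rule indep_var_compose[OF AB(1)]) auto
  then have ind: "indep_var borel (\<lambda>\<omega>. - A \<omega>) borel (\<lambda>\<omega>. - B \<omega>)" by (simp add: comp_def)
  have "(\<integral>\<omega>. (max 0 (- A \<omega>)) ^ 3 \<partial>M) \<le> (\<integral>\<omega>. (max 0 (- A \<omega> + - B \<omega>)) ^ 3 \<partial>M)"
    by (rule centred_summand_pos_cube_le[OF ind]) (use A3 B3 AB(8) in simp_all)
  moreover have "(\<integral>\<omega>. (max 0 (- A \<omega>)) ^ 3 \<partial>M) = under3 s"
    using increment_integral(2)[of 0 s "\<lambda>x. (max 0 (- (x - s))) ^ 3"] assms by (simp add: A_def under3_def)
  moreover have "(\<integral>\<omega>. (max 0 (- A \<omega> + - B \<omega>)) ^ 3 \<partial>M) = under3 t"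
    using increment_integral(2)[of 0 t "\<lambda>x. (max 0 (- (x - t))) ^ 3"] assms h
    by (simp add: A_def B_def under3_def algebra_simps)
  ultimately show "under3 s \<le> under3 t" by simp
qed

text \<open>The third central moment is neither signed nor monotone, but it is the difference of two
  nonnegative monotone functions and so is bounded on \<open>[0, 1]\<close>.\<close>

lemma cent_3:
  assumes "0 \<le> s"
  shows "cent 3 s = s * cent 3 1"
proof (rule additive_bounded_imp_linear[of _ 1 "over3 1 + under3 1"])
  fix s :: real assume s: "0 \<le> s" "s \<le> 1"
  have ints: "integrable M (\<lambda>\<omega>. (max 0 (U s \<omega> - s)) ^ 3)" "integrable M (\<lambda>\<omega>. (max 0 (- (U s \<omega> - s))) ^ 3)"
    by (rule pos_part_cube_integrable[of "\<lambda>\<omega>. U s \<omega> - s" "\<lambda>x. x"]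
             pos_part_cube_integrable[of "\<lambda>\<omega>. U s \<omega> - s" "\<lambda>x. - x"];
        use s random_variable[of s] shifted_cube_integrable[of s s] in simp)+
  have "x ^ 3 = (max 0 x) ^ 3 - (max 0 (- x)) ^ 3" for x :: real by (simp add: max_def)
  then have "cent 3 s = (\<integral>\<omega>. (max 0 (U s \<omega> - s)) ^ 3 - (max 0 (- (U s \<omega> - s))) ^ 3 \<partial>M)"
    unfolding cent_def mean_eq[OF s(1)] by (intro Bochner_Integration.integral_cong) blast+
  also have "\<dots> = over3 s - under3 s"
    unfolding over3_def under3_def by (rule Bochner_Integration.integral_diff[OF ints])
  finally have "cent 3 s = over3 s - under3 s" .
  moreover have "0 \<le> over3 s" "0 \<le> under3 s" unfolding over3_def under3_def by simp_all
  ultimately show "\<bar>cent 3 s\<bar> \<le> over3 1 + under3 1"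
    using part3_mono[OF s] by linarith
qed (use cent_add(2) assms in auto)

end

section \<open>Spectral positivity and small undershoots\<close>

text \<open>For \<open>s\<close> outside \<open>[-R, R]\<close> this is the tangent inequality.
  Inside, the tangent terms vanish, and a downward step exceeding \<open>2 * R\<close> still ends
  below \<open>- R\<close> by the excess.\<close>

lemma shifted_pos_cube_step:
  fixes s x R :: real
  assumes "0 < R"
  shows "(max 0 (- s - R)) ^ 3 + 3 * ((max 0 (- s - R)) ^ 2 * (- x))
    + indicator {- R..R} s * (max 0 (- x - 2 * R)) ^ 3 \<le> (max 0 (- (s + x) - R)) ^ 3"
proof (cases "s \<in> {- R..R}")
  case True
  then have "(max 0 (- x - 2 * R)) ^ 3 \<le> (max 0 (- (s + x) - R)) ^ 3"
    by (intro power_mono) (auto simp: max_def)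
  then show ?thesis using True by simp
next
  case False
  then show ?thesis using pos_part_cube_tangent[of "- s - R" "- x"] by (simp add: algebra_simps)
qed

context cubic_levy_process
begin

text \<open>A single-big-step estimate, uniform in \<open>N\<close>: the far tails of all
  \<open>N\<close> steps together are controlled by the tail at time 1. Before each step the centred
  path lies in \<open>[-R, R]\<close> with probability at least one half, whence the factor 2, and a
  huge downward step then shows in the final value.\<close>

lemma grid_tail_le:
  assumes "0 < R" "2 * cent 2 1 \<le> R ^ 2" "0 < N"
  shows "real N * (\<integral>\<omega>. (max 0 (- (U (1 / real N) \<omega> - 1 / real N) - 2 * R)) ^ 3 \<partial>M)
    \<le> 2 * (\<integral>\<omega>. (max 0 (- (U 1 \<omega> - 1) - R)) ^ 3 \<partial>M)"
proof -
  define h where "h = 1 / real N"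
  have h: "0 \<le> h" by (simp add: h_def)
  define S where "S n \<omega> = U (real n * h) \<omega> - U 0 \<omega> - real n * h" for n \<omega>
  define X where "X n \<omega> = U (real n * h + h) \<omega> - U (real n * h) \<omega> - h" for n \<omega>
  define g where "g y = (max 0 (- y - R)) ^ 3" for y :: real
  define T where "T = (\<integral>\<omega>. (max 0 (- (U h \<omega> - h) - 2 * R)) ^ 3 \<partial>M)"
  have nh: "0 \<le> real n * h" for n using h by simp
  note SX = centred_increments[OF nh h, unfolded mean_eq[OF nh] mean_eq[OF h], folded S_def X_def]
  have [measurable]: "S n \<in> borel_measurable M" "X n \<in> borel_measurable M" for n
    using indep_var_rv1[OF SX(1)] indep_var_rv2[OF SX(1)] by auto
  have S3: "integrable M (\<lambda>\<omega>. \<bar>S n \<omega>\<bar> ^ 3)" and X3: "integrable M (\<lambda>\<omega>. \<bar>X n \<omega>\<bar> ^ 3)" for n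
    using integrable_abs[OF SX(2)[of 3]] integrable_abs[OF SX(3)[of 3]] by (simp_all add: power_abs)
  have S_Suc: "S (Suc n) \<omega> = S n \<omega> + X n \<omega>" for n \<omega>
    by (simp add: S_def X_def algebra_simps)
  have gS: "integrable M (\<lambda>\<omega>. g (S n \<omega>))" for n
    unfolding g_def by (rule pos_part_cube_integrable[OF _ S3, where f = "\<lambda>y. - y - R"]) (use \<open>0 < R\<close> in auto)
  have gS2: "integrable M (\<lambda>\<omega>. (max 0 (- S n \<omega> - R)) ^ 2)" for n
    by (rule pos_part_cube_integrable[OF _ S3, where f = "\<lambda>y. - y - R"]) (use \<open>0 < R\<close> in auto)
  have tX: "integrable M (\<lambda>\<omega>. (max 0 (- X n \<omega> - 2 * R)) ^ 3)" for n
    by (rule pos_part_cube_integrable[OF _ X3, where f = "\<lambda>y. - y - 2 * R"]) (use \<open>0 < R\<close> in auto)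
  have TX: "(\<integral>\<omega>. (max 0 (- X n \<omega> - 2 * R)) ^ 3 \<partial>M) = T" for n
    using increment_integral(2)[OF nh h, of "\<lambda>x. (max 0 (- (x - h) - 2 * R)) ^ 3" n]
    by (simp add: X_def T_def algebra_simps)
  have T0: "0 \<le> T" unfolding T_def by simp
  have X1: "integrable M (X n)" for n using SX(3)[of 1 n] by simp
  \<comment> \<open>Chebyshev, in the form that \<open>1 - x^2 / R^2\<close> lies below the
    indicator of \<open>[-R, R]\<close>.\<close>
  have half: "1 / 2 \<le> (\<integral>\<omega>. (indicator {- R..R} (S n \<omega>) :: real) \<partial>M)" if "n < N" for n
  proof -
    have "(\<integral>\<omega>. S n \<omega> ^ 2 \<partial>M) = real n * h * cent 2 1"
      using SX(4)[of n 2] cent_2[OF nh[of n]] by simp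
    also have "\<dots> \<le> 1 * cent 2 1"
      using that by (intro mult_right_mono cent_2_nonneg) (simp add: h_def)
    also have "\<dots> \<le> R ^ 2 / 2" using assms by simp
    finally have v: "(\<integral>\<omega>. S n \<omega> ^ 2 \<partial>M) \<le> R ^ 2 / 2" .
    have i: "integrable M (\<lambda>\<omega>. S n \<omega> ^ 2)" by (rule SX(2)) simp
    have "(\<integral>\<omega>. 1 - S n \<omega> ^ 2 / R ^ 2 \<partial>M) \<le> (\<integral>\<omega>. indicator {- R..R} (S n \<omega>) \<partial>M)"
    proof (rule integral_mono)
      fix \<omega>
      show "1 - S n \<omega> ^ 2 / R ^ 2 \<le> indicator {- R..R} (S n \<omega>)"
      proof (cases "S n \<omega> \<in> {- R..R}")
        case False
        then have "R \<le> \<bar>S n \<omega>\<bar>" by auto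
        then have "R ^ 2 \<le> S n \<omega> ^ 2" using \<open>0 < R\<close> by (simp add: abs_le_square_iff[symmetric])
        then show ?thesis using False \<open>0 < R\<close> by simp
      qed simp
    next
      show "integrable M (\<lambda>\<omega>. indicator {- R..R} (S n \<omega>) :: real)"
        by (rule integrable_const_bound[where B = 1]) (auto simp: indicator_def)
    qed (use i in simp)
    also have "(\<integral>\<omega>. 1 - S n \<omega> ^ 2 / R ^ 2 \<partial>M) = 1 - (\<integral>\<omega>. S n \<omega> ^ 2 \<partial>M) / R ^ 2"
      using i by (simp add: prob_space)
    finally have "1 - (\<integral>\<omega>. S n \<omega> ^ 2 \<partial>M) / R ^ 2 \<le> (\<integral>\<omega>. indicator {- R..R} (S n \<omega>) \<partial>M)" .
    moreover have "(\<integral>\<omega>. S n \<omega> ^ 2 \<partial>M) / R ^ 2 \<le> 1 / 2" using v \<open>0 < R\<close> by (simp add: field_simps)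
    ultimately show ?thesis by linarith
  qed
  have step: "(\<integral>\<omega>. g (S n \<omega>) \<partial>M) + T / 2 \<le> (\<integral>\<omega>. g (S (Suc n) \<omega>) \<partial>M)" if "n < N" for n
  proof -
    have m1: "integrable M (\<lambda>\<omega>. (max 0 (- S n \<omega> - R)) ^ 2 * (- X n \<omega>))"
      "(\<integral>\<omega>. (max 0 (- S n \<omega> - R)) ^ 2 * (- X n \<omega>) \<partial>M) = 0"
      by (rule indep_var_integral_mult[OF SX(1)[of n], of "\<lambda>x. (max 0 (- x - R)) ^ 2" uminus]
             trans[OF indep_var_integral_mult(2)[OF SX(1)[of n], of "\<lambda>x. (max 0 (- x - R)) ^ 2" uminus]];
          use gS2 X1 SX(8) in simp)+
    have iS: "integrable M (\<lambda>\<omega>. indicator {- R..R} (S n \<omega>) :: real)"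
      by (rule integrable_const_bound[where B = 1]) (auto simp: indicator_def)
    have m2: "integrable M (\<lambda>\<omega>. indicator {- R..R} (S n \<omega>) * (max 0 (- X n \<omega> - 2 * R)) ^ 3)"
      "(\<integral>\<omega>. indicator {- R..R} (S n \<omega>) * (max 0 (- X n \<omega> - 2 * R)) ^ 3 \<partial>M)
        = (\<integral>\<omega>. indicator {- R..R} (S n \<omega>) \<partial>M) * (\<integral>\<omega>. (max 0 (- X n \<omega> - 2 * R)) ^ 3 \<partial>M)"
      by (rule indep_var_integral_mult[OF SX(1)[of n], of "indicator {- R..R}" "\<lambda>x. (max 0 (- x - 2 * R)) ^ 3"];
          use tX iS in simp)+
    have "(\<integral>\<omega>. g (S n \<omega>) \<partial>M) + T / 2 \<le> (\<integral>\<omega>. g (S n \<omega>) \<partial>M) + 3 * 0 + (\<integral>\<omega>. indicator {- R..R} (S n \<omega>) \<partial>M) * T"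
      using mult_right_mono[OF half[OF that] T0] by simp
    also have "\<dots> = (\<integral>\<omega>. g (S n \<omega>) + 3 * ((max 0 (- S n \<omega> - R)) ^ 2 * (- X n \<omega>))
        + indicator {- R..R} (S n \<omega>) * (max 0 (- X n \<omega> - 2 * R)) ^ 3 \<partial>M)"
    proof -
      have i1: "integrable M (\<lambda>\<omega>. 3 * ((max 0 (- S n \<omega> - R)) ^ 2 * (- X n \<omega>)))"
        by (rule integrable_mult_right[OF m1(1)])
      have e1: "(\<integral>\<omega>. 3 * ((max 0 (- S n \<omega> - R)) ^ 2 * (- X n \<omega>)) \<partial>M) = 3 * 0"
        by (simp only: integral_mult_right_zero m1(2))
      show ?thesis
        unfolding Bochner_Integration.integral_add[OF Bochner_Integration.integrable_add[OF gS i1] m2(1)]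
          Bochner_Integration.integral_add[OF gS i1] m2(2) TX e1 ..
    qed
    also have "\<dots> \<le> (\<integral>\<omega>. g (S (Suc n) \<omega>) \<partial>M)"
    proof (rule integral_mono)
      show "integrable M (\<lambda>\<omega>. g (S n \<omega>) + 3 * ((max 0 (- S n \<omega> - R)) ^ 2 * (- X n \<omega>))
        + indicator {- R..R} (S n \<omega>) * (max 0 (- X n \<omega> - 2 * R)) ^ 3)"
        by (intro Bochner_Integration.integrable_add integrable_mult_right m1(1) m2(1) gS)
    qed (use gS[of "Suc n"] shifted_pos_cube_step[OF \<open>0 < R\<close>] in \<open>auto simp: g_def S_Suc\<close>)
    finally show ?thesis .
  qed
  have "real n * (T / 2) \<le> (\<integral>\<omega>. g (S n \<omega>) \<partial>M)" if "n \<le> N" for n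
    using that
  proof (induction n)
    case (Suc n)
    then show ?case using step[of n] by (simp add: algebra_simps add_divide_distrib)
  qed (simp add: g_def S_def)
  from this[of N] have "real N * T \<le> 2 * (\<integral>\<omega>. g (S N \<omega>) \<partial>M)" by simp
  also have "real N * h = 1" using \<open>0 < N\<close> by (simp add: h_def)
  then have "(\<integral>\<omega>. g (S N \<omega>) \<partial>M) = (\<integral>\<omega>. (max 0 (- (U 1 \<omega> - 1) - R)) ^ 3 \<partial>M)"
    using increment_integral(2)[of 0 1 "\<lambda>x. (max 0 (- (x - 1) - R)) ^ 3"] by (simp add: g_def S_def)
  finally show ?thesis by (simp add: T_def h_def)
qed

lemma tail_tendsto_0: "(\<lambda>k. \<integral>\<omega>. (max 0 (- (U 1 \<omega> - 1) - real k)) ^ 3 \<partial>M) \<longlonglongrightarrow> 0"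
proof -
  have [measurable]: "U 1 \<in> borel_measurable M" by (rule random_variable) simp
  have "(\<lambda>k. \<integral>\<omega>. (max 0 (- (U 1 \<omega> - 1) - real k)) ^ 3 \<partial>M) \<longlonglongrightarrow> (\<integral>\<omega>. 0 \<partial>M)"
  proof (rule integral_dominated_convergence[where w = "\<lambda>\<omega>. \<bar>U 1 \<omega> - 1\<bar> ^ 3"])
    show "AE \<omega> in M. (\<lambda>k. (max 0 (- (U 1 \<omega> - 1) - real k)) ^ 3) \<longlonglongrightarrow> 0"
    proof (rule AE_I2)
      fix \<omega>
      obtain k0 :: nat where k0: "- (U 1 \<omega> - 1) \<le> real k0" using real_arch_simple by blast
      have "\<forall>\<^sub>F k in sequentially. (max 0 (- (U 1 \<omega> - 1) - real k)) ^ 3 = 0"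
        using eventually_ge_at_top[of k0] by eventually_elim (use k0 in auto)
      then show "(\<lambda>k. (max 0 (- (U 1 \<omega> - 1) - real k)) ^ 3) \<longlonglongrightarrow> 0" by (rule tendsto_eventually)
    qed
    show "AE \<omega> in M. norm ((max 0 (- (U 1 \<omega> - 1) - real k)) ^ 3) \<le> \<bar>U 1 \<omega> - 1\<bar> ^ 3" for k
    proof (rule AE_I2)
      fix \<omega>
      have "(max 0 (- (U 1 \<omega> - 1) - real k)) ^ 3 \<le> \<bar>U 1 \<omega> - 1\<bar> ^ 3" by (intro power_mono) auto
      then show "norm ((max 0 (- (U 1 \<omega> - 1) - real k)) ^ 3) \<le> \<bar>U 1 \<omega> - 1\<bar> ^ 3" by simp
    qed
  qed (use shifted_cube_integrable[of 1 1] in auto)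
  then show ?thesis by simp
qed

end

section \<open>Large downward grid steps of a path without negative jumps\<close>

context levy_process
begin

definition negative_step :: "real \<Rightarrow> nat \<Rightarrow> 'a set" where
  "negative_step e k = {\<omega> \<in> space M. \<exists>j<2 ^ k. U (real (Suc j) * (1 / 2 ^ k)) \<omega> - U (real j * (1 / 2 ^ k)) \<omega> < - e}"

lemma negative_step_measurable [measurable]: "negative_step e k \<in> events"
proof -
  have [measurable]: "U (real j * (1 / 2 ^ k)) \<in> borel_measurable M" for j
    by (rule random_variable) simp
  show ?thesis unfolding negative_step_def by measurable
qed

text \<open>A path with such steps on infinitely many dyadic grids violates the one-sided uniform
  continuity of paths without negative jumps. So the limit superior of these events forces a
  negative jump in \<open>{0<..1}\<close> and is null.\<close>

lemma prob_negative_step_tendsto_0: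
  assumes sp: "spectrally_positive M U" and "0 < e"
  shows "(\<lambda>k. prob (negative_step e k)) \<longlonglongrightarrow> 0"
proof -
  define W where "W n = (\<Union>k\<in>{n..}. negative_step e k)" for n
  have W: "W n \<in> events" for n unfolding W_def by measurable
  define L where "L = (\<Inter>n. W n)"
  have L: "L \<in> events" unfolding L_def using W by measurable
  have jump: "\<exists>t\<in>{0<..1}. jump (\<lambda>s. U s \<omega>) t < 0" if "\<omega> \<in> L" for \<omega>
  proof (rule ccontr)
    have \<omega>: "\<omega> \<in> space M" using that sets.sets_into_space[OF L] by blast
    assume "\<not> ?thesis"
    then have "\<And>s. 0 < s \<Longrightarrow> s \<le> 1 \<Longrightarrow> 0 \<le> jump (\<lambda>s. U s \<omega>) s"
      by (metis greaterThanAtMost_iff not_less)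
    then obtain d where d: "0 < d"
      "\<And>u v. 0 \<le> u \<Longrightarrow> u < v \<Longrightarrow> v \<le> 1 \<Longrightarrow> v - u < d \<Longrightarrow> - e \<le> U v \<omega> - U u \<omega>"
      using cadlag_no_negative_jumps_increment[OF cadlag_paths[OF \<omega>] \<open>0 < e\<close>, of 1] by metis
    obtain n :: nat where n: "(1 / 2) ^ n < d"
      using real_arch_pow_inv[OF \<open>0 < d\<close>, of "1 / 2"] by auto
    have "\<omega> \<in> W n" using that by (simp add: L_def)
    then obtain k j where k: "n \<le> k" "j < 2 ^ k"
      and less: "U (real (Suc j) * (1 / 2 ^ k)) \<omega> - U (real j * (1 / 2 ^ k)) \<omega> < - e"
      unfolding W_def negative_step_def by auto
    have "(1 / 2 :: real) ^ k \<le> (1 / 2) ^ n" using k by (intro power_decreasing) auto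
    then have "1 / 2 ^ k < d" using n by (simp add: power_divide)
    moreover have "real (Suc j) \<le> 2 ^ k" using k(2) by (metis Suc_leI of_nat_le_iff of_nat_numeral of_nat_power)
    then have "real (Suc j) * (1 / 2 ^ k) \<le> 1" by (simp add: field_simps)
    ultimately have "- e \<le> U (real (Suc j) * (1 / 2 ^ k)) \<omega> - U (real j * (1 / 2 ^ k)) \<omega>"
      by (intro d(2)) (auto simp: field_simps)
    then show False using less by simp
  qed
  \<comment> \<open>\<open>L\<close> is measurable, so only monotonicity of the integral has to be
    applied to the number of jumps.\<close>
  have "(\<integral>\<^sup>+\<omega>. indicator L \<omega> \<partial>M) \<le> levy_measure M U {..<0}"
    unfolding levy_measure_def
  proof (rule nn_integral_mono)
    fix \<omega>
    show "indicator L \<omega> \<le> emeasure (count_space UNIV) {t \<in> {0<..1}. jump (\<lambda>s. U s \<omega>) t \<in> {..<0} - {0}}"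
    proof (cases "\<omega> \<in> L")
      case True
      then obtain t where "t \<in> {0<..1}" "jump (\<lambda>s. U s \<omega>) t < 0" using jump by blast
      then have "emeasure (count_space UNIV) {t} \<le> emeasure (count_space UNIV) {t \<in> {0<..1}. jump (\<lambda>s. U s \<omega>) t \<in> {..<0} - {0}}"
        by (intro emeasure_mono) auto
      then show ?thesis using True by simp
    qed simp
  qed
  then have "emeasure M L = 0" using sp L by (simp add: spectrally_positive_def)
  then have L0: "prob L = 0" by (simp add: measure_def)
  have "(\<lambda>n. prob (W n)) \<longlonglongrightarrow> prob L"
    unfolding L_def
  proof (rule finite_Lim_measure_decseq)
    show "range W \<subseteq> events" using W by auto
    show "decseq W" unfolding W_def by (intro decseq_SucI) force
  qed
  then have lim: "(\<lambda>n. prob (W n)) \<longlonglongrightarrow> 0" by (simp add: L0)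
  show ?thesis
  proof (rule tendsto_sandwich[OF _ _ tendsto_const lim])
    show "\<forall>\<^sub>F k in sequentially. prob (negative_step e k) \<le> prob (W k)"
      using W by (intro always_eventually allI finite_measure_mono) (auto simp: W_def)
  qed auto
qed

text \<open>The grid steps are independent with equal law, so the chance that none of them is large
  is \<open>(1 - p k) ^ (2 ^ k) \<le> exp (- (2 ^ k * p k))\<close>. This chance tends to 1, which
  sends the exponent to 0.\<close>

lemma prob_small_step:
  assumes sp: "spectrally_positive M U" and "0 < e"
  shows "(\<lambda>k. 2 ^ k * prob {\<omega> \<in> space M. U (1 / 2 ^ k) \<omega> < - e}) \<longlonglongrightarrow> 0"
proof -
  define p where "p k = prob {\<omega> \<in> space M. U (1 / 2 ^ k) \<omega> < - e}" for k :: nat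
  have le: "1 - prob (negative_step e k) \<le> exp (- (2 ^ k * p k))" for k
  proof -
    define h :: real where "h = 1 / 2 ^ k"
    define X where "X j \<omega> = U (real (Suc j) * h) \<omega> - U (real j * h) \<omega>" for j \<omega>
    have h: "0 \<le> h" by (simp add: h_def)
    have [measurable]: "U (real j * h) \<in> borel_measurable M" for j
      using h by (intro random_variable) simp
    have [measurable]: "U h \<in> borel_measurable M" using h by (rule random_variable)
    have [measurable]: "X j \<in> borel_measurable M" for j unfolding X_def by measurable
    have ind: "indep_vars (\<lambda>_. borel) X {..<2 ^ k}"
      unfolding X_def
    proof (rule indep_increments[of "\<lambda>j. real j * h"])
      show "mono (\<lambda>j. real j * h)" using h by (intro monoI mult_right_mono) auto
    qed simp
    have p1: "prob (X j -` {- e..} \<inter> space M) = 1 - p k" for j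
    proof -
      have Suc_j: "real (Suc j) * h = real j * h + h" by (simp add: algebra_simps)
      have "measure (distr M borel (X j)) {- e..} = measure (distr M borel (U h)) {- e..}"
        unfolding X_def Suc_j using stationary_increments[of "real j * h" h] h by simp
      then have "prob (X j -` {- e..} \<inter> space M) = prob (U h -` {- e..} \<inter> space M)"
        by (simp add: measure_distr)
      also have "U h -` {- e..} \<inter> space M = space M - {\<omega> \<in> space M. U h \<omega> < - e}" by auto
      also have "prob \<dots> = 1 - p k" by (subst prob_compl) (simp_all add: p_def flip: h_def)
      finally show ?thesis .
    qed
    have "space M - negative_step e k = (\<Inter>j\<in>{..<2 ^ k}. X j -` {- e..} \<inter> space M)"
      by (auto simp: negative_step_def X_def h_def lessThan_empty_iff)
    then have "1 - prob (negative_step e k) = prob (\<Inter>j\<in>{..<2 ^ k}. X j -` {- e..} \<inter> space M)"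
      using prob_compl[OF negative_step_measurable, of e k] by simp
    also have "\<dots> = (\<Prod>j\<in>{..<2 ^ k}. prob (X j -` {- e..} \<inter> space M))"
      by (rule indep_varsD[OF ind]) (auto simp: lessThan_empty_iff)
    also have "\<dots> = (1 - p k) ^ (2 ^ k)" by (simp add: p1)
    also have "\<dots> \<le> exp (- p k) ^ (2 ^ k)"
    proof (rule power_mono)
      show "1 - p k \<le> exp (- p k)" using exp_ge_add_one_self[of "- p k"] by simp
    qed (simp add: p_def)
    also have "\<dots> = exp (- (2 ^ k * p k))" by (simp flip: exp_of_nat_mult)
    finally show ?thesis .
  qed
  show ?thesis
    unfolding p_def[symmetric]
  proof (rule tendstoI)
    fix r :: real assume "0 < r"
    have "\<forall>\<^sub>F k in sequentially. prob (negative_step e k) < 1 - exp (- r)"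
      using prob_negative_step_tendsto_0[OF assms] by (rule order_tendstoD(2)) (use \<open>0 < r\<close> in simp)
    then show "\<forall>\<^sub>F k in sequentially. dist (2 ^ k * p k) 0 < r"
    proof eventually_elim
      case (elim k)
      then have "exp (- r) < exp (- (2 ^ k * p k))" using le[of k] by linarith
      then show ?case by (simp add: p_def)
    qed
  qed
qed

end

context cubic_levy_process
begin

text \<open>Small undershoots are controlled by the variance, those between \<open>\<epsilon>\<close> and \<open>2 R\<close> by the absence
  of negative jumps, and the large ones by the uniform integrability expressed in \<open>grid_tail_le\<close>.\<close>

lemma under3_dyadic:
  assumes sp: "spectrally_positive M U" and "0 < r"
  shows "\<forall>\<^sub>F k in sequentially. 2 ^ k * under3 (1 / 2 ^ k) < r"
proof -
  have v: "0 \<le> cent 2 1" by (rule cent_2_nonneg)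
  \<comment> \<open>The variance term, the probability term and the tail term will each take at most
    \<open>r / 4\<close>.\<close>
  define \<epsilon> where "\<epsilon> = r / (4 * (cent 2 1 + 1))"
  have \<epsilon>: "0 < \<epsilon>" "\<epsilon> * cent 2 1 \<le> r / 4"
    using \<open>0 < r\<close> v by (auto simp: \<epsilon>_def field_simps)
  have "\<forall>\<^sub>F K in sequentially. (\<integral>\<omega>. (max 0 (- (U 1 \<omega> - 1) - real K)) ^ 3 \<partial>M) < r / 32"
    using tail_tendsto_0 by (rule order_tendstoD(2)) (use \<open>0 < r\<close> in simp)
  \<comment> \<open>This makes \<open>R \<ge> 1\<close>, so that
    \<open>R ^ 2 \<ge> R \<ge> 2 * cent 2 1\<close>, the Chebyshev condition of
    \<open>grid_tail_le\<close>.\<close>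
  moreover have "\<forall>\<^sub>F K :: nat in sequentially. 2 * cent 2 1 + 1 \<le> real K"
    using eventually_ge_at_top[of "nat \<lceil>2 * cent 2 1 + 1\<rceil>"] by eventually_elim linarith
  ultimately have "\<forall>\<^sub>F K in sequentially. (\<integral>\<omega>. (max 0 (- (U 1 \<omega> - 1) - real K)) ^ 3 \<partial>M) < r / 32 \<and>
      2 * cent 2 1 + 1 \<le> real K" by (rule eventually_conj)
  then obtain K :: nat where K: "(\<integral>\<omega>. (max 0 (- (U 1 \<omega> - 1) - real K)) ^ 3 \<partial>M) < r / 32"
    "2 * cent 2 1 + 1 \<le> real K" using eventually_happens'[OF sequentially_bot] by blast
  define R where "R = real K"
  have R: "0 < R" "2 * cent 2 1 \<le> R ^ 2"
  proof -
    show "0 < R" using K(2) v by (simp add: R_def)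
    have "1 * R \<le> R * R" using K(2) v by (intro mult_right_mono) (auto simp: R_def)
    then show "2 * cent 2 1 \<le> R ^ 2" using K(2) by (simp add: R_def power2_eq_square)
  qed
  \<comment> \<open>The factor is \<open>4 * (2 * R) ^ 3\<close>, from splitting the undershoot at
    \<open>2 * R\<close> with \<open>pos_part_cube_le\<close>.\<close>
  have "(\<lambda>k. 32 * R ^ 3 * (2 ^ k * prob {\<omega> \<in> space M. U (1 / 2 ^ k) \<omega> < - (\<epsilon> / 2)})) \<longlonglongrightarrow> 32 * R ^ 3 * 0"
    by (intro tendsto_mult_left prob_small_step[OF sp]) (use \<epsilon> in simp)
  then have "\<forall>\<^sub>F k in sequentially. 32 * R ^ 3 * (2 ^ k * prob {\<omega> \<in> space M. U (1 / 2 ^ k) \<omega> < - (\<epsilon> / 2)}) < r / 4"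
    by (rule order_tendstoD(2)) (use \<open>0 < r\<close> in simp)
  moreover have "\<forall>\<^sub>F k in sequentially. (1 / 2 :: real) ^ k < \<epsilon> / 2"
    by (rule order_tendstoD(2)[OF LIMSEQ_power_zero]) (use \<epsilon> in auto)
  ultimately show ?thesis
  proof eventually_elim
    case (elim k)
    define h :: real where "h = 1 / 2 ^ k"
    have h: "0 \<le> h" "h < \<epsilon> / 2" "2 ^ k * h = 1" using elim(2) by (auto simp: h_def power_divide)
    have [measurable]: "U h \<in> borel_measurable M" using h(1) by (rule random_variable)
    define B where "B = {\<omega> \<in> space M. U h \<omega> < - (\<epsilon> / 2)}"
    have [measurable]: "B \<in> events" unfolding B_def by measurable
    define Y where "Y \<omega> = max 0 (- (U h \<omega> - h))" for \<omega>
    define Z where "Z \<omega> = max 0 (- (U h \<omega> - h) - 2 * R)" for \<omega>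
    have i2: "integrable M (\<lambda>\<omega>. (U h \<omega> - h) ^ 2)" by (rule shifted_power_integrable) (use h in auto)
    have Y3: "integrable M (\<lambda>\<omega>. Y \<omega> ^ 3)" unfolding Y_def
      by (rule pos_part_cube_integrable[of "\<lambda>\<omega>. U h \<omega> - h" "\<lambda>x. - x"])
         (use shifted_cube_integrable[OF h(1)] in auto)
    have Z3: "integrable M (\<lambda>\<omega>. Z \<omega> ^ 3)" unfolding Z_def
      by (rule pos_part_cube_integrable[of "\<lambda>\<omega>. U h \<omega> - h" "\<lambda>x. - x - 2 * R"])
         (use shifted_cube_integrable[OF h(1)] R in auto)
    have "under3 h = (\<integral>\<omega>. Y \<omega> ^ 3 \<partial>M)" by (simp add: under3_def Y_def)
    also have "\<dots> \<le> (\<integral>\<omega>. \<epsilon> * (U h \<omega> - h) ^ 2 + 32 * R ^ 3 * indicator B \<omega> + 4 * Z \<omega> ^ 3 \<partial>M)"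
    proof (rule integral_mono)
      fix \<omega> assume "\<omega> \<in> space M"
      have Z0: "0 \<le> Z \<omega> ^ 3" by (simp add: Z_def)
      show "Y \<omega> ^ 3 \<le> \<epsilon> * (U h \<omega> - h) ^ 2 + 32 * R ^ 3 * indicator B \<omega> + 4 * Z \<omega> ^ 3"
      proof (cases "Y \<omega> \<le> \<epsilon>")
        case True
        have "Y \<omega> * Y \<omega> ^ 2 \<le> \<epsilon> * (U h \<omega> - h) ^ 2"
        proof (rule mult_mono[OF True])
          show "Y \<omega> ^ 2 \<le> (U h \<omega> - h) ^ 2" by (simp add: Y_def max_def power2_commute)
        qed (use \<epsilon> in auto)
        moreover have "0 \<le> 32 * R ^ 3 * indicator B \<omega>" using R by simp
        ultimately show ?thesis using Z0 by (simp add: power3_eq_cube power2_eq_square)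
      next
        case False
        \<comment> \<open>Centring shifts by \<open>h < \<epsilon> / 2\<close>, so an undershoot
          above \<open>\<epsilon>\<close> of the centred variable is one above
          \<open>\<epsilon> / 2\<close> of \<open>U h\<close> itself.\<close>
        then have "U h \<omega> < - (\<epsilon> / 2)" using \<epsilon>(1) h(2) by (auto simp: Y_def max_def split: if_splits)
        then have B: "\<omega> \<in> B" using \<open>\<omega> \<in> space M\<close> by (simp add: B_def)
        have "Y \<omega> ^ 3 \<le> 4 * Z \<omega> ^ 3 + 4 * (2 * R) ^ 3"
          using pos_part_cube_le[of "- (U h \<omega> - h) - 2 * R" "2 * R"] R by (simp add: Y_def Z_def)
        moreover have "0 \<le> \<epsilon> * (U h \<omega> - h) ^ 2" using \<epsilon> by simp
        ultimately show ?thesis using B by (simp add: power_mult_distrib)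
      qed
    qed (use i2 Y3 Z3 in \<open>auto simp: less_top[symmetric]\<close>)
    also have "\<dots> = \<epsilon> * (\<integral>\<omega>. (U h \<omega> - h) ^ 2 \<partial>M) + 32 * R ^ 3 * prob B + 4 * (\<integral>\<omega>. Z \<omega> ^ 3 \<partial>M)"
      using i2 Z3 by (simp add: less_top[symmetric])
    also have "(\<integral>\<omega>. (U h \<omega> - h) ^ 2 \<partial>M) = h * cent 2 1"
      using cent_2[OF h(1)] mean_eq[OF h(1)] by (simp add: cent_def)
    finally have "2 ^ k * under3 h \<le> 2 ^ k * (\<epsilon> * (h * cent 2 1) + 32 * R ^ 3 * prob B + 4 * (\<integral>\<omega>. Z \<omega> ^ 3 \<partial>M))"
      by (intro mult_left_mono) auto
    also have "\<dots> = \<epsilon> * ((2 ^ k * h) * cent 2 1) + 32 * R ^ 3 * (2 ^ k * prob B) + 4 * (2 ^ k * (\<integral>\<omega>. Z \<omega> ^ 3 \<partial>M))"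
      by (simp add: algebra_simps)
    also have "\<dots> < r"
    proof -
      have "2 ^ k * (\<integral>\<omega>. Z \<omega> ^ 3 \<partial>M) \<le> 2 * (\<integral>\<omega>. (max 0 (- (U 1 \<omega> - 1) - R)) ^ 3 \<partial>M)"
        using grid_tail_le[OF R, of "2 ^ k"] by (simp add: Z_def h_def)
      then have "4 * (2 ^ k * (\<integral>\<omega>. Z \<omega> ^ 3 \<partial>M)) \<le> 8 * (r / 32)" using K(1) by (simp add: R_def)
      moreover have "32 * R ^ 3 * (2 ^ k * prob B) < r / 4" using elim(1) by (simp add: B_def h_def)
      ultimately show ?thesis using \<epsilon>(2) \<open>0 < r\<close> unfolding h(3) mult_1 by linarith
    qed
    finally show ?case by (simp add: h_def)
  qed
qed

text \<open>Monotonicity of \<open>under3\<close> carries the dyadic rate to all times: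
  \<open>s\<close> lies between consecutive dyadic meshes, and their ratio 2 is absorbed by starting
  from \<open>r / 2\<close>.\<close>

lemma under3_small_o:
  assumes sp: "spectrally_positive M U" and "0 < r"
  obtains s0 where "0 < s0" "\<And>s. 0 < s \<Longrightarrow> s < s0 \<Longrightarrow> under3 s \<le> r * s"
proof -
  have "\<forall>\<^sub>F k in sequentially. 2 ^ k * under3 (1 / 2 ^ k) < r / 2"
    using under3_dyadic[OF sp, of "r / 2"] \<open>0 < r\<close> by simp
  then obtain K where K: "\<And>k. K \<le> k \<Longrightarrow> 2 ^ k * under3 (1 / 2 ^ k) < r / 2"
    unfolding eventually_sequentially by blast
  show thesis
  proof (rule that[of "1 / 2 ^ K"])
    fix s :: real assume s: "0 < s" "s < 1 / 2 ^ K"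
    have "\<exists>n. 1 / 2 ^ n \<le> s"
    proof -
      obtain n where "(1 / 2) ^ n < s" using real_arch_pow_inv[OF s(1), of "1 / 2"] by auto
      then show ?thesis by (intro exI[of _ n]) (simp add: power_divide)
    qed
    define n where "n = (LEAST n. 1 / 2 ^ n \<le> s)"
    have n: "1 / 2 ^ n \<le> s" unfolding n_def by (rule LeastI_ex) fact
    have "K < n"
    proof (rule ccontr)
      assume "\<not> K < n"
      then have "(1 / 2 :: real) ^ K \<le> (1 / 2) ^ n" by (intro power_decreasing) auto
      then show False using n s(2) by (simp add: power_divide)
    qed
    then obtain k where k: "n = Suc k" "K \<le> k" by (cases n) auto
    have "\<not> 1 / 2 ^ k \<le> s" using not_less_Least[of k "\<lambda>n. 1 / 2 ^ n \<le> s"] k by (simp add: n_def)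
    then have "under3 s \<le> under3 (1 / 2 ^ k)" using s by (intro part3_mono) auto
    also have "\<dots> \<le> r / 2 * (1 / 2 ^ k)" using K[OF k(2)] by (simp add: field_simps)
    also have "\<dots> = r * (1 / 2 ^ n)" by (simp add: k)
    also have "\<dots> \<le> r * s" using n \<open>0 < r\<close> by (intro mult_left_mono) auto
    finally show "under3 s \<le> r * s" .
  qed simp
qed

end

section \<open>The workload and its grid approximation\<close>

lemma lindley_cong: "q = q' \<Longrightarrow> (\<And>i. i < n \<Longrightarrow> x i = y i) \<Longrightarrow> lindley q x n = lindley q' y n"
  by (induction n) auto

text \<open>Places the initial value at index 0 of one independent family, so that grouping of
  coordinates can be applied to it together with the steps.\<close>

lemma (in prob_space) indep_vars_case_nat:
  fixes q :: "'a \<Rightarrow> real" and x :: "nat \<Rightarrow> 'a \<Rightarrow> real"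
  assumes q: "q \<in> borel_measurable M" and ind: "indep_vars (\<lambda>_. borel) x {..<n}"
    and prod: "\<And>A B. A \<in> sets borel \<Longrightarrow> (\<And>i. i < n \<Longrightarrow> B i \<in> sets borel) \<Longrightarrow> 0 < n \<Longrightarrow>
      prob ((q -` A \<inter> space M) \<inter> (\<Inter>i\<in>{..<n}. x i -` B i \<inter> space M)) =
      prob (q -` A \<inter> space M) * prob (\<Inter>i\<in>{..<n}. x i -` B i \<inter> space M)"
  shows "indep_vars (\<lambda>_. borel) (case_nat q x) {..<Suc n}"
proof -
  have x: "x i \<in> borel_measurable M" if "i < n" for i
    using ind that by (auto simp: indep_vars_def)
  have "\<forall>A\<in>(\<Pi> i\<in>{..<Suc n}. sets borel). prob (\<Inter>j\<in>{..<Suc n}. case_nat q x j -` A j \<inter> space M)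
      = (\<Prod>j\<in>{..<Suc n}. prob (case_nat q x j -` A j \<inter> space M))"
  proof
    fix A :: "nat \<Rightarrow> real set" assume A: "A \<in> (\<Pi> i\<in>{..<Suc n}. sets borel)"
    have set: "(\<Inter>j\<in>{..<Suc n}. case_nat q x j -` A j \<inter> space M) =
      (q -` A 0 \<inter> space M) \<inter> (\<Inter>i\<in>{..<n}. x i -` A (Suc i) \<inter> space M)"
      unfolding lessThan_Suc_eq_insert_0 by simp
    have rhs: "(\<Prod>j\<in>{..<Suc n}. prob (case_nat q x j -` A j \<inter> space M)) =
      prob (q -` A 0 \<inter> space M) * (\<Prod>i\<in>{..<n}. prob (x i -` A (Suc i) \<inter> space M))"
      by (subst prod.lessThan_Suc_shift) simp
    show "prob (\<Inter>j\<in>{..<Suc n}. case_nat q x j -` A j \<inter> space M)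
      = (\<Prod>j\<in>{..<Suc n}. prob (case_nat q x j -` A j \<inter> space M))"
    \<comment> \<open>An intersection over no indices is \<open>UNIV\<close> rather than
      \<open>space M\<close>, so the product rule is requested for positive \<open>n\<close> only
      and this case is direct.\<close>
    proof (cases "n = 0")
      case True
      then show ?thesis unfolding set rhs by simp
    next
      case False
      then have ne: "{..<n} \<noteq> {}" by (auto simp: lessThan_empty_iff)
      have "prob (\<Inter>j\<in>{..<Suc n}. case_nat q x j -` A j \<inter> space M) =
          prob (q -` A 0 \<inter> space M) * prob (\<Inter>i\<in>{..<n}. x i -` A (Suc i) \<inter> space M)"
        unfolding set using A False by (intro prod) (auto simp: Pi_iff)
      also have "prob (\<Inter>i\<in>{..<n}. x i -` A (Suc i) \<inter> space M) = (\<Prod>i\<in>{..<n}. prob (x i -` A (Suc i) \<inter> space M))"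
        using A ne by (intro indep_varsD[OF ind]) (auto simp: Pi_iff)
      finally show ?thesis unfolding rhs .
    qed
  qed
  then show ?thesis
    by (subst indep_vars_finite[where E = "\<lambda>_. sets borel"])
       (use q x in \<open>auto simp: sets.sigma_sets_eq[of borel, simplified] sets.Int_stable lessThan_Suc_eq_insert_0\<close>)
qed

text \<open>The state after \<open>n\<close> steps is a measurable function of coordinates 0 to
  \<open>n\<close> of the family, and the next step is coordinate \<open>Suc n\<close>.\<close>

lemma (in prob_space) lindley_step_indep:
  fixes q :: "'a \<Rightarrow> real" and x :: "nat \<Rightarrow> 'a \<Rightarrow> real"
  assumes ind: "indep_vars (\<lambda>_. borel) (case_nat q x) {..<Suc (Suc n)}"
  shows "indep_var borel (\<lambda>\<omega>. lindley (q \<omega>) (\<lambda>i. x i \<omega>) n) borel (x n)"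
proof -
  define L where "L z = lindley (z 0) (\<lambda>i. z (Suc i)) n" for z :: "nat \<Rightarrow> real"
  have "(\<lambda>z. lindley (z 0) (\<lambda>i. z (Suc i)) m) \<in> borel_measurable (PiM {..n} (\<lambda>_. borel :: real measure))"
    if "m \<le> n" for m
    using that
  proof (induction m)
    case (Suc m)
    have c: "(\<lambda>z. z (Suc m)) \<in> borel_measurable (PiM {..n} (\<lambda>_. borel :: real measure))"
      using Suc.prems by (intro measurable_component_singleton) auto
    show ?case
      unfolding lindley.simps
      by (intro borel_measurable_max borel_measurable_const borel_measurable_add Suc.IH c)
         (use Suc.prems in simp)
  qed (simp add: measurable_component_singleton)
  then have L: "L \<in> borel_measurable (PiM {..n} (\<lambda>_. borel :: real measure))"
    unfolding L_def by simp
  have c: "(\<lambda>z. z (Suc n)) \<in> borel_measurable (PiM {Suc n} (\<lambda>_. borel :: real measure))"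
    by (intro measurable_component_singleton) auto
  have "indep_var (PiM {..n} (\<lambda>_. borel)) (\<lambda>\<omega>. restrict (\<lambda>i. case_nat q x i \<omega>) {..n})
      (PiM {Suc n} (\<lambda>_. borel)) (\<lambda>\<omega>. restrict (\<lambda>i. case_nat q x i \<omega>) {Suc n})"
    by (rule indep_var_restrict[OF ind]) auto
  from indep_var_compose[OF this L c]
  have "indep_var borel (L \<circ> (\<lambda>\<omega>. restrict (\<lambda>i. case_nat q x i \<omega>) {..n})) borel (x n)"
    by (simp add: comp_def)
  moreover have "(L \<circ> (\<lambda>\<omega>. restrict (\<lambda>i. case_nat q x i \<omega>) {..n})) = (\<lambda>\<omega>. lindley (q \<omega>) (\<lambda>i. x i \<omega>) n)"
    by (auto simp: fun_eq_iff L_def intro!: lindley_cong)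
  ultimately show ?thesis by simp
qed

text \<open>A constant generates the trivial sigma-algebra. This makes the initially empty queue an
  instance of the general one.\<close>

lemma (in prob_space) indep_of_process_const:
  assumes "\<And>t. 0 \<le> t \<Longrightarrow> U t \<in> borel_measurable M"
  shows "indep_of_process M (\<lambda>_. c) U"
  unfolding indep_of_process_def
proof (rule indep_setI)
  have F: "sets (vimage_algebra (space M) (\<lambda>_. c) borel) = {(\<lambda>_. c) -` A \<inter> space M | A. A \<in> sets borel}"
    by (rule sets_vimage_algebra2) simp
  have sub: "a = {} \<or> a = space M" if "a \<in> sets (vimage_algebra (space M) (\<lambda>_. c) borel)" for a
  proof -
    have "\<exists>A. a = (\<lambda>_. c) -` A \<inter> space M" using that unfolding F by (simp only: mem_Collect_eq) (elim exE conjE, rule exI)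
    then obtain A where a: "a = (\<lambda>_. c) -` A \<inter> space M" ..
    show ?thesis unfolding a by (cases "c \<in> A") auto
  qed
  show "sets (vimage_algebra (space M) (\<lambda>_. c) borel) \<subseteq> events"
  proof
    fix a assume "a \<in> sets (vimage_algebra (space M) (\<lambda>_. c) borel)"
    then show "a \<in> events" using sub[of a] by auto
  qed
  show G: "sets (vimage_algebra (space M) (\<lambda>\<omega>. \<lambda>t\<in>{0..}. U t \<omega>) (PiM {0..} (\<lambda>_. borel))) \<subseteq> events"
    by (rule sets_image_in_sets[OF refl]) (rule measurable_restrict, simp add: assms)
  fix a b assume "a \<in> sets (vimage_algebra (space M) (\<lambda>_. c) borel)"
    and b: "b \<in> sets (vimage_algebra (space M) (\<lambda>\<omega>. \<lambda>t\<in>{0..}. U t \<omega>) (PiM {0..} (\<lambda>_. borel)))"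
  then consider "a = {}" | "a = space M" using sub by blast
  then show "prob (a \<inter> b) = prob a * prob b"
  proof cases
    case 2
    then show ?thesis using b G sets.sets_into_space by (simp add: prob_space Int_absorb1 subset_iff)
  qed simp
qed

locale levy_queue = cubic_levy_process +
  fixes lam :: real and q :: "'a \<Rightarrow> real"
  assumes lam_pos: "0 < lam"
    and q_measurable [measurable]: "q \<in> borel_measurable M"
    and q_nonneg: "AE \<omega> in M. 0 \<le> q \<omega>"
    and q_sq: "integrable M (\<lambda>\<omega>. q \<omega> ^ 2)"
    and q_indep: "indep_of_process M q U"
begin

definition grid_queue :: "real \<Rightarrow> real \<Rightarrow> real \<Rightarrow> nat \<Rightarrow> 'a \<Rightarrow> real" where
  "grid_queue \<mu> s h n \<omega> = grid_lindley (q \<omega>) (\<lambda>t. net_input U lam \<mu> t \<omega>) s h n"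

definition grid_step :: "real \<Rightarrow> real \<Rightarrow> real \<Rightarrow> nat \<Rightarrow> 'a \<Rightarrow> real" where
  "grid_step \<mu> s h n \<omega> = grid_increment (\<lambda>t. net_input U lam \<mu> t \<omega>) s h n"

lemma grid_step_eq:
  "grid_step \<mu> s h n \<omega> = (U (lam * (s + real n * h) + lam * h) \<omega> - U (lam * (s + real n * h)) \<omega>) - \<mu> * h"
  by (simp add: grid_step_def grid_increment_def net_input_def algebra_simps)

lemma net_input_measurable [measurable (raw)]: "0 \<le> t \<Longrightarrow> net_input U lam \<mu> t \<in> borel_measurable M"
  unfolding net_input_def using lam_pos random_variable[of "lam * t"] by simp

lemma grid_step_law:
  assumes "0 \<le> s" "0 \<le> h"
  shows "distr M borel (grid_step \<mu> s h n) = distr M borel (\<lambda>\<omega>. U (lam * h) \<omega> - \<mu> * h)"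
proof -
  define t where "t = lam * (s + real n * h)"
  have t: "0 \<le> t" "0 \<le> lam * h" using assms lam_pos by (auto simp: t_def)
  have [measurable]: "(\<lambda>\<omega>. U (t + lam * h) \<omega> - U t \<omega>) \<in> borel_measurable M" "U (lam * h) \<in> borel_measurable M"
    using t random_variable by (auto intro!: borel_measurable_diff)
  have eq: "grid_step \<mu> s h n = (\<lambda>\<omega>. (U (t + lam * h) \<omega> - U t \<omega>) - \<mu> * h)"
    by (rule ext) (simp add: grid_step_eq t_def)
  have "distr M borel (grid_step \<mu> s h n) =
      distr (distr M borel (\<lambda>\<omega>. U (t + lam * h) \<omega> - U t \<omega>)) borel (\<lambda>x. x - \<mu> * h)"
    unfolding eq by (subst distr_distr) (auto simp: comp_def)
  also have "\<dots> = distr M borel (\<lambda>\<omega>. U (lam * h) \<omega> - \<mu> * h)"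
    unfolding stationary_increments[OF t] by (subst distr_distr) (auto simp: comp_def)
  finally show ?thesis .
qed

lemma grid_steps_indep:
  assumes "0 \<le> s" "0 \<le> h"
  shows "indep_vars (\<lambda>_. borel) (grid_step \<mu> s h) {..<n}"
proof -
  define t where "t i = lam * (s + real i * h)" for i
  have "mono t" unfolding t_def
    using lam_pos assms by (intro monoI mult_left_mono add_left_mono mult_right_mono) auto
  then have "indep_vars (\<lambda>_. borel) (\<lambda>i \<omega>. U (t (Suc i)) \<omega> - U (t i) \<omega>) {..<n}"
    by (rule indep_increments[rotated]) (use lam_pos assms in \<open>simp add: t_def\<close>)
  then have "indep_vars (\<lambda>_. borel) (\<lambda>i \<omega>. (U (t (Suc i)) \<omega> - U (t i) \<omega>) - \<mu> * h) {..<n}"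
    by (rule indep_vars_compose2[where Y = "\<lambda>_ x. x - \<mu> * h"]) simp
  moreover have "(\<lambda>i \<omega>. (U (t (Suc i)) \<omega> - U (t i) \<omega>) - \<mu> * h) = grid_step \<mu> s h"
    by (simp add: fun_eq_iff grid_step_eq t_def algebra_simps)
  ultimately show ?thesis by simp
qed

text \<open>Every grid step is measurable for the sigma-algebra of the path of \<open>U\<close>,
  from which the initial workload is independent.\<close>

lemma grid_chain:
  assumes "0 \<le> s" "0 \<le> h"
  shows "lindley_chain M (grid_queue \<mu> s h) (grid_step \<mu> s h)"
proof unfold_locales
  show "AE \<omega> in M. 0 \<le> grid_queue \<mu> s h 0 \<omega>" using q_nonneg by (simp add: grid_queue_def)
  show "grid_queue \<mu> s h (Suc n) \<omega> = max 0 (grid_queue \<mu> s h n \<omega> + grid_step \<mu> s h n \<omega>)" for n \<omega>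
    by (simp add: grid_queue_def grid_step_def)
  show "distr M borel (grid_step \<mu> s h n) = distr M borel (grid_step \<mu> s h 0)" for n
    by (simp only: grid_step_law[OF assms])
  fix n
  let ?G = "vimage_algebra (space M) (\<lambda>\<omega>. \<lambda>t\<in>{0..}. U t \<omega>) (PiM {0..} (\<lambda>_. borel))"
  have path: "(\<lambda>\<omega>. \<lambda>t\<in>{0..}. U t \<omega>) \<in> measurable ?G (PiM {0..} (\<lambda>_. borel))"
    by (rule measurable_vimage_algebra1) (auto simp: space_PiM)
  have U: "U t \<in> borel_measurable ?G" if "0 \<le> t" for t
  proof -
    have "(\<lambda>f. f t) \<in> borel_measurable (PiM {0..} (\<lambda>_. borel :: real measure))"
      using that by (intro measurable_component_singleton) auto
    from measurable_compose[OF path this] show ?thesis using that by simp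
  qed
  have step: "grid_step \<mu> s h i \<in> borel_measurable ?G" for i
    unfolding grid_step_eq[abs_def] using lam_pos assms by (intro borel_measurable_diff U borel_measurable_const) auto
  have "indep_vars (\<lambda>_. borel) (case_nat q (grid_step \<mu> s h)) {..<Suc (Suc n)}"
  proof (rule indep_vars_case_nat[OF q_measurable grid_steps_indep[OF assms]])
    fix A :: "real set" and B :: "nat \<Rightarrow> real set"
    assume A: "A \<in> sets borel" and B: "\<And>i. i < Suc n \<Longrightarrow> B i \<in> sets borel"
    have "q -` A \<inter> space M \<in> sets (vimage_algebra (space M) q borel)"
      using A by (rule in_vimage_algebra)
    moreover have "(\<Inter>i\<in>{..<Suc n}. grid_step \<mu> s h i -` B i \<inter> space M) \<in> sets ?G"
    proof (rule sets.finite_INT)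
      show "grid_step \<mu> s h i -` B i \<inter> space M \<in> sets ?G" if "i \<in> {..<Suc n}" for i
        using measurable_sets[OF step B, of i i] that by simp
    qed (auto simp: lessThan_empty_iff)
    ultimately show "prob ((q -` A \<inter> space M) \<inter> (\<Inter>i\<in>{..<Suc n}. grid_step \<mu> s h i -` B i \<inter> space M)) =
      prob (q -` A \<inter> space M) * prob (\<Inter>i\<in>{..<Suc n}. grid_step \<mu> s h i -` B i \<inter> space M)"
      using q_indep unfolding indep_of_process_def by (intro indep_setD)
  qed
  from lindley_step_indep[OF this]
  show "indep_var borel (grid_queue \<mu> s h n) borel (grid_step \<mu> s h n)"
    by (simp add: grid_queue_def[abs_def] grid_lindley_def grid_step_def[abs_def])
qed

lemma grid_step_integral:
  assumes "0 \<le> s" "0 \<le> h" and [measurable]: "(f :: real \<Rightarrow> real) \<in> borel_measurable borel"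
  shows "integrable M (\<lambda>\<omega>. f (grid_step \<mu> s h n \<omega>)) \<longleftrightarrow> integrable M (\<lambda>\<omega>. f (U (lam * h) \<omega> - \<mu> * h))"
    and "(\<integral>\<omega>. f (grid_step \<mu> s h n \<omega>) \<partial>M) = (\<integral>\<omega>. f (U (lam * h) \<omega> - \<mu> * h) \<partial>M)"
proof -
  interpret C: lindley_chain M "grid_queue \<mu> s h" "grid_step \<mu> s h" by (rule grid_chain[OF assms(1,2)])
  have [measurable]: "U (lam * h) \<in> borel_measurable M" using assms lam_pos by (intro random_variable) simp
  have "integrable M (\<lambda>\<omega>. f (grid_step \<mu> s h n \<omega>)) \<longleftrightarrow> integrable (distr M borel (grid_step \<mu> s h n)) f"
    by (subst integrable_distr_eq) auto
  also have "\<dots> \<longleftrightarrow> integrable M (\<lambda>\<omega>. f (U (lam * h) \<omega> - \<mu> * h))"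
    unfolding grid_step_law[OF assms(1,2)] by (subst integrable_distr_eq) auto
  finally show "integrable M (\<lambda>\<omega>. f (grid_step \<mu> s h n \<omega>)) \<longleftrightarrow> integrable M (\<lambda>\<omega>. f (U (lam * h) \<omega> - \<mu> * h))" .
  have "(\<integral>\<omega>. f (grid_step \<mu> s h n \<omega>) \<partial>M) = (\<integral>x. f x \<partial>distr M borel (grid_step \<mu> s h n))"
    by (subst integral_distr) auto
  also have "\<dots> = (\<integral>\<omega>. f (U (lam * h) \<omega> - \<mu> * h) \<partial>M)"
    unfolding grid_step_law[OF assms(1,2)] by (subst integral_distr) auto
  finally show "(\<integral>\<omega>. f (grid_step \<mu> s h n \<omega>) \<partial>M) = (\<integral>\<omega>. f (U (lam * h) \<omega> - \<mu> * h) \<partial>M)" .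
qed

text \<open>Variance and third central moment of the net input per unit of time.\<close>

definition "v = lam * cent 2 1"
definition "w = lam * cent 3 1"

lemma v_nonneg: "0 \<le> v"
  using lam_pos cent_2_nonneg by (simp add: v_def)

text \<open>A step is the centred increment \<open>Y\<close> minus the deterministic drift
  \<open>c = (\<mu> - lam) * h\<close>; expanding gives rates linear in \<open>h\<close> plus
  corrections of higher order. In the undershoot bound the drift contributes only a cube of
  \<open>h\<close>.\<close>

lemma grid_step_moments:
  assumes "0 \<le> s" "0 \<le> h"
  shows "integrable M (\<lambda>\<omega>. \<bar>grid_step \<mu> s h n \<omega>\<bar> ^ 3)"
    and "(\<integral>\<omega>. grid_step \<mu> s h n \<omega> \<partial>M) = - (\<mu> - lam) * h"
    and "(\<integral>\<omega>. grid_step \<mu> s h n \<omega> ^ 2 \<partial>M) = v * h + (\<mu> - lam) ^ 2 * h ^ 2"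
    and "(\<integral>\<omega>. grid_step \<mu> s h n \<omega> ^ 3 \<partial>M) = w * h - 3 * v * (\<mu> - lam) * h ^ 2 - (\<mu> - lam) ^ 3 * h ^ 3"
    and "(\<integral>\<omega>. (max 0 (- grid_step \<mu> s h n \<omega>)) ^ 3 \<partial>M) \<le> 4 * under3 (lam * h) + 4 * \<bar>\<mu> - lam\<bar> ^ 3 * h ^ 3"
proof -
  have t: "0 \<le> lam * h" using assms lam_pos by simp
  define Y where "Y \<omega> = U (lam * h) \<omega> - lam * h" for \<omega>
  define c where "c = (\<mu> - lam) * h"
  have eq: "U (lam * h) \<omega> - \<mu> * h = Y \<omega> - c" for \<omega> by (simp add: Y_def c_def algebra_simps)
  have [measurable]: "U (lam * h) \<in> borel_measurable M" using t by (rule random_variable)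
  show "integrable M (\<lambda>\<omega>. \<bar>grid_step \<mu> s h n \<omega>\<bar> ^ 3)"
    using grid_step_integral(1)[OF assms, of "\<lambda>x. \<bar>x\<bar> ^ 3"] shifted_cube_integrable[OF t] by simp
  have Y1: "integrable M Y" using shifted_power_integrable[OF t, of 1 "lam * h"] by (simp add: Y_def[abs_def])
  have Y2: "integrable M (\<lambda>\<omega>. Y \<omega> ^ 2)" and Y3: "integrable M (\<lambda>\<omega>. Y \<omega> ^ 3)"
    unfolding Y_def by (rule shifted_power_integrable[OF t]; simp)+
  have EY: "(\<integral>\<omega>. Y \<omega> \<partial>M) = 0"
    using U_integrable[OF t] mean_eq[OF t] by (simp add: Y_def mean_def prob_space)
  have EY2: "(\<integral>\<omega>. Y \<omega> ^ 2 \<partial>M) = v * h"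
    using cent_2[OF t] mean_eq[OF t] by (simp add: Y_def cent_def v_def)
  have EY3: "(\<integral>\<omega>. Y \<omega> ^ 3 \<partial>M) = w * h"
    using cent_3[OF t] mean_eq[OF t] by (simp add: Y_def cent_def w_def)
  show "(\<integral>\<omega>. grid_step \<mu> s h n \<omega> \<partial>M) = - (\<mu> - lam) * h"
    using grid_step_integral(2)[OF assms, of "\<lambda>x. x" \<mu> n] unfolding eq
    using Y1 EY by (simp add: prob_space c_def algebra_simps)
  have e2: "(Y \<omega> - c) ^ 2 = Y \<omega> ^ 2 - 2 * c * Y \<omega> + c ^ 2" for \<omega>
    by (simp add: power2_eq_square algebra_simps)
  show "(\<integral>\<omega>. grid_step \<mu> s h n \<omega> ^ 2 \<partial>M) = v * h + (\<mu> - lam) ^ 2 * h ^ 2"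
    unfolding grid_step_integral(2)[OF assms, of "\<lambda>x. x ^ 2", simplified] eq e2
    using Y1 Y2 EY EY2 by (simp add: prob_space c_def power_mult_distrib)
  have e3: "(Y \<omega> - c) ^ 3 = Y \<omega> ^ 3 - 3 * c * Y \<omega> ^ 2 + 3 * c ^ 2 * Y \<omega> - c ^ 3" for \<omega>
    by (simp add: power2_eq_square power3_eq_cube algebra_simps)
  show "(\<integral>\<omega>. grid_step \<mu> s h n \<omega> ^ 3 \<partial>M) = w * h - 3 * v * (\<mu> - lam) * h ^ 2 - (\<mu> - lam) ^ 3 * h ^ 3"
    unfolding grid_step_integral(2)[OF assms, of "\<lambda>x. x ^ 3", simplified] eq e3
    using Y1 Y2 Y3 EY EY2 EY3 by (simp add: prob_space c_def power_mult_distrib power2_eq_square)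
  have "(\<integral>\<omega>. (max 0 (- grid_step \<mu> s h n \<omega>)) ^ 3 \<partial>M) = (\<integral>\<omega>. (max 0 (- (U (lam * h) \<omega> - \<mu> * h))) ^ 3 \<partial>M)"
    by (rule grid_step_integral(2)[OF assms]) measurable
  also have "\<dots> = (\<integral>\<omega>. (max 0 (- Y \<omega> + c)) ^ 3 \<partial>M)" unfolding eq by simp
  also have "\<dots> \<le> (\<integral>\<omega>. 4 * (max 0 (- Y \<omega>)) ^ 3 + 4 * \<bar>c\<bar> ^ 3 \<partial>M)"
  proof (rule integral_mono)
    have Y3': "integrable M (\<lambda>\<omega>. \<bar>Y \<omega>\<bar> ^ 3)" unfolding Y_def by (rule shifted_cube_integrable[OF t])
    have i: "integrable M (\<lambda>\<omega>. (max 0 (- Y \<omega>)) ^ 3)"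
      by (rule pos_part_cube_integrable[of Y "\<lambda>x. - x"]) (use Y1 Y3' in auto)
    then show i': "integrable M (\<lambda>\<omega>. 4 * (max 0 (- Y \<omega>)) ^ 3 + 4 * \<bar>c\<bar> ^ 3)" by simp
    have le: "(max 0 (- y + c)) ^ 3 \<le> 4 * (max 0 (- y)) ^ 3 + 4 * \<bar>c\<bar> ^ 3" for y :: real
    proof -
      have "(max 0 c) ^ 3 \<le> \<bar>c\<bar> ^ 3" by (intro power_mono) auto
      then show ?thesis using pos_part_cube_le[of "- y" c] by linarith
    qed
    show "(max 0 (- Y \<omega> + c)) ^ 3 \<le> 4 * (max 0 (- Y \<omega>)) ^ 3 + 4 * \<bar>c\<bar> ^ 3" for \<omega> by (rule le)
    show "integrable M (\<lambda>\<omega>. (max 0 (- Y \<omega> + c)) ^ 3)"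
    proof (rule Bochner_Integration.integrable_bound[OF i'])
      show "AE \<omega> in M. norm ((max 0 (- Y \<omega> + c)) ^ 3) \<le> norm (4 * (max 0 (- Y \<omega>)) ^ 3 + 4 * \<bar>c\<bar> ^ 3)"
      proof (rule AE_I2)
        fix \<omega>
        have "0 \<le> (max 0 (- Y \<omega> + c)) ^ 3" by simp
        then show "norm ((max 0 (- Y \<omega> + c)) ^ 3) \<le> norm (4 * (max 0 (- Y \<omega>)) ^ 3 + 4 * \<bar>c\<bar> ^ 3)"
          using le[of "Y \<omega>"] by (simp only: real_norm_def) linarith
      qed
    qed (use Y1 in measurable)
  qed
  also have "\<dots> = 4 * (\<integral>\<omega>. (max 0 (- Y \<omega>)) ^ 3 \<partial>M) + 4 * \<bar>c\<bar> ^ 3"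
  proof -
    have "integrable M (\<lambda>\<omega>. (max 0 (- Y \<omega>)) ^ 3)"
      by (rule pos_part_cube_integrable[of Y "\<lambda>x. - x"]) (use Y1 in \<open>auto simp: Y_def intro: shifted_cube_integrable[OF t]\<close>)
    then show ?thesis by (simp add: prob_space)
  qed
  also have "(\<integral>\<omega>. (max 0 (- Y \<omega>)) ^ 3 \<partial>M) = under3 (lam * h)" by (simp add: under3_def Y_def)
  also have "4 * \<bar>c\<bar> ^ 3 = 4 * \<bar>\<mu> - lam\<bar> ^ 3 * h ^ 3"
    using assms by (simp add: c_def abs_mult power_mult_distrib)
  finally show "(\<integral>\<omega>. (max 0 (- grid_step \<mu> s h n \<omega>)) ^ 3 \<partial>M) \<le> 4 * under3 (lam * h) + 4 * \<bar>\<mu> - lam\<bar> ^ 3 * h ^ 3" .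
qed

end

section \<open>Riemann sums of monotone functions\<close>

lemma mono_riemann_sums:
  fixes a :: "real \<Rightarrow> real"
  assumes mono: "\<And>s t. 0 \<le> s \<Longrightarrow> s \<le> t \<Longrightarrow> t \<le> T \<Longrightarrow> a s \<le> a t"
    and "0 < h" "real n * h \<le> T"
  shows "h * (\<Sum>i<n. a (real i * h)) \<le> integral {0..real n * h} a"
    and "integral {0..real n * h} a \<le> h * (\<Sum>i<n. a (real i * h)) + h * (a (real n * h) - a 0)"
proof -
  have int: "a integrable_on {s..t}" if "0 \<le> s" "t \<le> T" for s t
    using that by (intro integrable_on_mono_on mono_onI mono) auto
  have "h * (\<Sum>i<n. a (real i * h)) \<le> integral {0..real n * h} a \<and>
    integral {0..real n * h} a \<le> h * (\<Sum>i<n. a (real (Suc i) * h))"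
    using \<open>real n * h \<le> T\<close>
  proof (induction n)
    case (Suc n)
    have le: "0 \<le> real n * h" "real n * h \<le> real (Suc n) * h"
      using \<open>0 < h\<close> by (auto simp: algebra_simps)
    have split: "integral {0..real (Suc n) * h} a = integral {0..real n * h} a + integral {real n * h..real (Suc n) * h} a"
      using le Suc.prems by (intro Henstock_Kurzweil_Integration.integral_combine[symmetric] int) auto
    have len: "real (Suc n) * h - real n * h = h" by (simp add: algebra_simps)
    have "integral {real n * h..real (Suc n) * h} (\<lambda>_. a (real n * h)) \<le> integral {real n * h..real (Suc n) * h} a"
      using le Suc.prems by (intro integral_le int mono) auto
    moreover have "integral {real n * h..real (Suc n) * h} a \<le> integral {real n * h..real (Suc n) * h} (\<lambda>_. a (real (Suc n) * h))"
      using le Suc.prems by (intro integral_le int mono) auto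
    ultimately have "h * a (real n * h) \<le> integral {real n * h..real (Suc n) * h} a"
      "integral {real n * h..real (Suc n) * h} a \<le> h * a (real (Suc n) * h)"
      using le(2) by (simp_all only: integral_const_real content_real len real_scaleR_def)
    then show ?case using Suc.IH Suc.prems le unfolding split
      by (simp add: distrib_left del: of_nat_Suc)
  qed simp
  moreover have "(\<Sum>i<n. a (real (Suc i) * h)) = (\<Sum>i<n. a (real i * h)) + (a (real n * h) - a 0)"
    by (induction n) auto
  ultimately show "h * (\<Sum>i<n. a (real i * h)) \<le> integral {0..real n * h} a"
    "integral {0..real n * h} a \<le> h * (\<Sum>i<n. a (real i * h)) + h * (a (real n * h) - a 0)"
    by (simp_all add: distrib_left)
qed

text \<open>The array approximates \<open>a\<close> from below, with convergence known only at
  points of a fixed coarse grid. Monotonicity in the second index bounds each block of a fine sum by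
  its left endpoint, so coarse sums suffice and no uniform convergence is involved.\<close>

lemma monotone_array_riemann_limit:
  fixes a :: "real \<Rightarrow> real" and A :: "nat \<Rightarrow> nat \<Rightarrow> real"
  assumes "0 < T" and mono: "\<And>s t. 0 \<le> s \<Longrightarrow> s \<le> t \<Longrightarrow> t \<le> T \<Longrightarrow> a s \<le> a t"
    and A_mono: "\<And>k i n. i \<le> n \<Longrightarrow> A k i \<le> A k n"
    and A_le: "\<And>k n. n \<le> 2 ^ k \<Longrightarrow> A k n \<le> a (real n * (T / 2 ^ k))"
    and lim: "\<And>K j. (\<lambda>m. A (K + m) (j * 2 ^ m)) \<longlonglongrightarrow> a (real j * (T / 2 ^ K))"
  shows "(\<lambda>k. T / 2 ^ k * (\<Sum>n<2 ^ k. A k n)) \<longlonglongrightarrow> integral {0..T} a"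
proof -
  define h where "h k = T / 2 ^ k" for k :: nat
  have h: "0 < h k" "real (2 ^ k) * h k = T" for k using \<open>0 < T\<close> by (simp_all add: h_def)
  have upper: "h k * (\<Sum>n<2 ^ k. A k n) \<le> integral {0..T} a" for k
  proof -
    have "h k * (\<Sum>n<2 ^ k. A k n) \<le> h k * (\<Sum>n<2 ^ k. a (real n * h k))"
      using A_le[of _ k] h(1)[of k] by (intro mult_left_mono sum_mono) (auto simp: h_def)
    also have "\<dots> \<le> integral {0..real (2 ^ k) * h k} a"
      by (rule mono_riemann_sums(1)[OF mono h(1)]) (use h(2)[of k] in auto)
    finally show ?thesis unfolding h(2) .
  qed
  show ?thesis
    unfolding h_def[symmetric]
  proof (rule order_tendstoI)
    fix c assume "integral {0..T} a < c"
    then show "\<forall>\<^sub>F k in sequentially. h k * (\<Sum>n<2 ^ k. A k n) < c"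
      using upper by (intro always_eventually allI) (rule le_less_trans)
  next
    fix c assume c: "c < integral {0..T} a"
    have "(\<lambda>k. T * (1 / 2) ^ k * (a T - a 0)) \<longlonglongrightarrow> T * 0 * (a T - a 0)"
      by (intro tendsto_intros LIMSEQ_power_zero) auto
    then have "\<forall>\<^sub>F k in sequentially. T * (1 / 2) ^ k * (a T - a 0) < integral {0..T} a - c"
      by (rule order_tendstoD(2)) (use c in simp)
    \<comment> \<open>On this coarse grid the Riemann error is below the gap to \<open>c\<close>;
      the mesh of the array is refined afterwards with \<open>K\<close> fixed.\<close>
    then obtain K where "T * (1 / 2) ^ K * (a T - a 0) < integral {0..T} a - c"
      using eventually_happens'[OF sequentially_bot] by blast
    then have K: "h K * (a T - a 0) < integral {0..T} a - c" by (simp add: h_def power_divide)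
    have "integral {0..real (2 ^ K) * h K} a \<le> h K * (\<Sum>j<2 ^ K. a (real j * h K)) + h K * (a (real (2 ^ K) * h K) - a 0)"
      by (rule mono_riemann_sums(2)[OF mono h(1)]) (use h(2)[of K] in auto)
    then have "integral {0..T} a \<le> h K * (\<Sum>j<2 ^ K. a (real j * h K)) + h K * (a T - a 0)"
      unfolding h(2) .
    then have "c < h K * (\<Sum>j<2 ^ K. a (real j * h K))" using K by simp
    moreover have "(\<lambda>m. h K * (\<Sum>j<2 ^ K. A (K + m) (j * 2 ^ m))) \<longlonglongrightarrow> h K * (\<Sum>j<2 ^ K. a (real j * h K))"
      unfolding h_def by (intro tendsto_intros lim)
    ultimately have "\<forall>\<^sub>F m in sequentially. c < h K * (\<Sum>j<2 ^ K. A (K + m) (j * 2 ^ m))"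
      by (intro order_tendstoD(1))
    then have "\<forall>\<^sub>F m in sequentially. c < h (m + K) * (\<Sum>n<2 ^ (m + K). A (m + K) n)"
    proof eventually_elim
      case (elim m)
      \<comment> \<open>Each coarse cell contains \<open>2 ^ m\<close> fine ones, all given the
        value at the left end of the block.\<close>
      have "h K * (\<Sum>j<2 ^ K. A (K + m) (j * 2 ^ m)) = h (m + K) * (\<Sum>j<2 ^ K. 2 ^ m * A (m + K) (j * 2 ^ m))"
        by (simp add: h_def sum_distrib_left power_add add.commute)
      also have "\<dots> \<le> h (m + K) * (\<Sum>j<2 ^ K. \<Sum>n\<in>{j * 2 ^ m..<j * 2 ^ m + 2 ^ m}. A (m + K) n)"
      proof (intro mult_left_mono sum_mono)
        fix j :: nat
        have "(\<Sum>n\<in>{j * 2 ^ m..<j * 2 ^ m + 2 ^ m}. A (m + K) (j * 2 ^ m)) \<le> (\<Sum>n\<in>{j * 2 ^ m..<j * 2 ^ m + 2 ^ m}. A (m + K) n)"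
          by (intro sum_mono A_mono) auto
        then show "2 ^ m * A (m + K) (j * 2 ^ m) \<le> (\<Sum>n\<in>{j * 2 ^ m..<j * 2 ^ m + 2 ^ m}. A (m + K) n)"
          by simp
      qed (use h(1)[of "m + K"] in simp)
      also have "(\<Sum>j<2 ^ K. \<Sum>n\<in>{j * 2 ^ m..<j * 2 ^ m + 2 ^ m}. A (m + K) n) = (\<Sum>n<2 ^ (m + K). A (m + K) n)"
        using sum.nat_group[of "A (m + K)" "2 ^ m" "2 ^ K"] by (simp add: power_add mult.commute)
      finally show ?case using elim by simp
    qed
    then show "\<forall>\<^sub>F k in sequentially. c < h k * (\<Sum>n<2 ^ k. A k n)"
      unfolding eventually_sequentially_seg[where P = "\<lambda>k. c < h k * (\<Sum>n<2 ^ k. A k n)"] .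
  qed
qed

text \<open>The initial value enters through a single competitor, which makes the excess over the
  empty start explicit.\<close>

lemma grid_lindley_eq_max:
  assumes "0 \<le> q"
  shows "grid_lindley q f s h n = max (q + (f (s + real n * h) - f s)) (grid_lindley 0 f s h n)"
proof (induction n)
  case (Suc n)
  have 0: "0 \<le> grid_lindley 0 f s h n" by (rule grid_lindley_nonneg) simp
  show ?case using Suc by (simp add: grid_increment_def max_def)
qed (use assms in simp)

lemma grid_lindley_le_SUP:
  assumes "cadlag f" "0 \<le> s" "0 \<le> h" "t = s + real n * h"
  shows "grid_lindley 0 f s h n \<le> (SUP u\<in>{0..t}. f t - f u)"
proof -
  have t: "0 \<le> t" using assms by simp
  note bdd = cadlag_bdd_above[OF assms(1) t]
  show ?thesis using grid_lindley_cases[of 0 f s h n]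
  proof (elim disjE exE conjE)
    assume "grid_lindley 0 f s h n = 0 + (f (s + real n * h) - f s)"
    then show ?thesis using assms by (intro cSUP_upper2[OF bdd, of s]) auto
  next
    fix i assume "i \<le> n" "grid_lindley 0 f s h n = f (s + real n * h) - f (s + real i * h)"
    then show ?thesis
      using assms by (intro cSUP_upper2[OF bdd, of "s + real i * h"]) (auto intro!: mult_right_mono)
  qed
qed

lemma SUP_increment_le:
  assumes "cadlag f" "0 \<le> s" "s \<le> t"
  shows "f t - f s + (SUP u\<in>{0..s}. f s - f u) \<le> (SUP u\<in>{0..t}. f t - f u)"
proof -
  have bdd: "bdd_above ((\<lambda>u. f t - f u) ` {0..t})" using assms by (intro cadlag_bdd_above) auto
  have "(SUP u\<in>{0..s}. f s - f u) \<le> (SUP u\<in>{0..t}. f t - f u) - (f t - f s)"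
  proof (rule cSUP_least)
    fix u assume "u \<in> {0..s}"
    then have "f t - f u \<le> (SUP u\<in>{0..t}. f t - f u)" using assms by (intro cSUP_upper bdd) auto
    then show "f s - f u \<le> (SUP u\<in>{0..t}. f t - f u) - (f t - f s)" by simp
  qed (use assms in simp)
  then show ?thesis by simp
qed

text \<open>Time 0 is covered by \<open>j = 0\<close> with a positive \<open>H\<close>, so the grid
  limits need no separate case for it.\<close>

lemma dyadic_time:
  assumes "0 \<le> (t :: real)"
  obtains j :: nat and H :: real where "t = real j * H" "0 < H"
proof (cases "t = 0")
  case True
  then show ?thesis using that[of 0 1] by simp
next
  case False
  then show ?thesis using assms that[of 1 t] by simp
qed

section \<open>The workload and its moments as limits along dyadic grids\<close>

context levy_queue
begin

lemma empty_queue: "levy_queue M U lam (\<lambda>_. 0)"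
proof unfold_locales
  show "indep_of_process M (\<lambda>_. 0) U" by (rule indep_of_process_const[OF random_variable])
qed (use lam_pos in auto)

abbreviation "Q \<equiv> workload U q lam"
abbreviation "V \<equiv> workload U (\<lambda>_. 0) lam"

text \<open>The almost sure normalizations of path and initial workload, collected so that pathwise
  comparisons share one set of full measure.\<close>

definition good :: "'a \<Rightarrow> bool" where
  "good \<omega> \<longleftrightarrow> \<omega> \<in> space M \<and> 0 \<le> q \<omega> \<and> U 0 \<omega> = 0"

lemma AE_good: "AE \<omega> in M. good \<omega>"
  using q_nonneg start AE_space by eventually_elim (simp add: good_def)

lemma net_cadlag: "\<omega> \<in> space M \<Longrightarrow> cadlag (\<lambda>t. net_input U lam \<mu> t \<omega>)"
  unfolding net_input_def by (rule cadlag_rescale[OF cadlag_paths lam_pos])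

lemma workload_tendsto:
  assumes "\<omega> \<in> space M" "0 \<le> q \<omega>" "U 0 \<omega> = 0 \<or> q \<omega> = 0" "0 < H"
  shows "(\<lambda>m. grid_queue \<mu> 0 (H / 2 ^ m) (j * 2 ^ m) \<omega>) \<longlonglongrightarrow>
    max (q \<omega> + (net_input U lam \<mu> (real j * H) \<omega> - net_input U lam \<mu> 0 \<omega>))
      (SUP s\<in>{0..real j * H}. net_input U lam \<mu> (real j * H) \<omega> - net_input U lam \<mu> s \<omega>)"
  using grid_lindley_tendsto[OF net_cadlag[OF assms(1)] assms(2) assms(4), of \<mu> j]
  by (simp add: grid_queue_def add_diff_eq)

lemma SUP_nonneg:
  assumes "\<omega> \<in> space M" "0 \<le> t"
  shows "0 \<le> (SUP s\<in>{0..t}. net_input U lam \<mu> t \<omega> - net_input U lam \<mu> s \<omega>)"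
    "net_input U lam \<mu> t \<omega> - net_input U lam \<mu> 0 \<omega> \<le> (SUP s\<in>{0..t}. net_input U lam \<mu> t \<omega> - net_input U lam \<mu> s \<omega>)"
  using cadlag_bdd_above[OF net_cadlag[OF assms(1)] assms(2)] assms
  by (auto intro!: cSUP_upper2[of _ "{0..t}" t] cSUP_upper)

lemma workload_nonneg: "\<omega> \<in> space M \<Longrightarrow> 0 \<le> t \<Longrightarrow> 0 \<le> workload U q' lam \<mu> t \<omega>"
  using SUP_nonneg(1)[of \<omega> t \<mu>] by (simp add: workload_def)

text \<open>The supremum over an uncountable time set is a pointwise limit of measurable grid values
  for the empty start. The limit holds on all of \<open>space M\<close> since every path is
  cadlag.\<close>

lemma SUP_measurable:
  assumes "0 \<le> t"
  shows "(\<lambda>\<omega>. SUP s\<in>{0..t}. net_input U lam \<mu> t \<omega> - net_input U lam \<mu> s \<omega>) \<in> borel_measurable M"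
proof -
  interpret empty: levy_queue M U lam "\<lambda>_. 0" by (rule empty_queue)
  obtain j H where jH: "t = real j * H" "0 < H" using dyadic_time[OF assms] .
  have "empty.grid_queue \<mu> 0 (H / 2 ^ m) (j * 2 ^ m) \<in> borel_measurable M" for m
  proof -
    interpret C: lindley_chain M "empty.grid_queue \<mu> 0 (H / 2 ^ m)" "empty.grid_step \<mu> 0 (H / 2 ^ m)"
      using jH by (intro empty.grid_chain) auto
    show ?thesis by measurable
  qed
  then show ?thesis
  proof (rule borel_measurable_LIMSEQ_real[rotated])
    fix \<omega> assume \<omega>: "\<omega> \<in> space M"
    have "max (0 + (net_input U lam \<mu> t \<omega> - net_input U lam \<mu> 0 \<omega>))
        (SUP s\<in>{0..t}. net_input U lam \<mu> t \<omega> - net_input U lam \<mu> s \<omega>) =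
      (SUP s\<in>{0..t}. net_input U lam \<mu> t \<omega> - net_input U lam \<mu> s \<omega>)"
      using SUP_nonneg(2)[OF \<omega> assms, of \<mu>] by (simp add: max_def)
    then show "(\<lambda>m. empty.grid_queue \<mu> 0 (H / 2 ^ m) (j * 2 ^ m) \<omega>) \<longlonglongrightarrow>
        (SUP s\<in>{0..t}. net_input U lam \<mu> t \<omega> - net_input U lam \<mu> s \<omega>)"
      using empty.workload_tendsto[OF \<omega> _ _ jH(2), of \<mu> j] jH by simp
  qed
qed

lemma workload_measurable: "0 \<le> t \<Longrightarrow> Q \<mu> t \<in> borel_measurable M"
  unfolding workload_def
  using SUP_measurable net_input_measurable q_measurable
  by (intro borel_measurable_max borel_measurable_add) auto

lemma grid_queue_tendsto:
  assumes "good \<omega>" "0 < H"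
  shows "(\<lambda>m. grid_queue \<mu> 0 (H / 2 ^ m) (j * 2 ^ m) \<omega>) \<longlonglongrightarrow> Q \<mu> (real j * H) \<omega>"
  using workload_tendsto[of \<omega> H \<mu> j] assms by (simp add: good_def workload_def net_input_def)

lemma grid_queue_mono:
  assumes "good \<omega>"
  shows "mono (\<lambda>m. grid_queue \<mu> 0 (H / 2 ^ m) (j * 2 ^ m) \<omega>)"
  using assms unfolding grid_queue_def good_def by (intro monoI grid_lindley_dyadic_mono) auto

lemma grid_queue_nonneg: "good \<omega> \<Longrightarrow> 0 \<le> grid_queue \<mu> s h n \<omega>"
  unfolding grid_queue_def good_def by (intro grid_lindley_nonneg) auto

lemma grid_queue_le:
  assumes "good \<omega>" "0 < H"
  shows "grid_queue \<mu> 0 (H / 2 ^ m) (j * 2 ^ m) \<omega> \<le> Q \<mu> (real j * H) \<omega>"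
  using incseq_le[OF grid_queue_mono[OF assms(1)] grid_queue_tendsto[OF assms]] .

lemma q_sq_abs: "integrable M (\<lambda>\<omega>. \<bar>grid_queue \<mu> s h 0 \<omega>\<bar> ^ 2)"
  using q_sq by (simp add: grid_queue_def)

text \<open>For \<open>lam \<le> \<mu>\<close> the drift term and the loss term of the squared
  recursion are both nonpositive. The remaining bound is uniform under refinement of the
  grid.\<close>

lemma grid_queue_sq_le:
  assumes "lam \<le> \<mu>" "0 \<le> h"
  shows "(\<integral>\<omega>. grid_queue \<mu> 0 h n \<omega> ^ 2 \<partial>M) \<le> (\<integral>\<omega>. q \<omega> ^ 2 \<partial>M) + real n * h * (v + (\<mu> - lam) ^ 2 * h)"
proof -
  interpret C: lindley_chain M "grid_queue \<mu> 0 h" "grid_step \<mu> 0 h" using assms by (intro grid_chain) auto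
  note m = grid_step_moments[OF order_refl assms(2), of \<mu> 0]
  have q: "grid_queue \<mu> 0 h 0 = q" by (rule ext) (simp add: grid_queue_def)
  have c: "integrable M (\<lambda>\<omega>. \<bar>grid_step \<mu> 0 h 0 \<omega>\<bar> ^ 3)" using m(1) assms by simp
  have S: "0 \<le> (\<Sum>i<n. \<integral>\<omega>. grid_queue \<mu> 0 h i \<omega> \<partial>M)"
    by (intro sum_nonneg integral_nonneg_AE C.Q_nonneg)
  have "2 * (- (\<mu> - lam) * h) * (\<Sum>i<n. \<integral>\<omega>. grid_queue \<mu> 0 h i \<omega> \<partial>M) \<le> 0"
  proof -
    have "0 \<le> ((\<mu> - lam) * h) * (\<Sum>i<n. \<integral>\<omega>. grid_queue \<mu> 0 h i \<omega> \<partial>M)"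
      using assms S by (intro mult_nonneg_nonneg) auto
    then show ?thesis by (simp add: algebra_simps)
  qed
  moreover note C.Q_sq_sum[OF q_sq_abs c, of n, unfolded m(2,3) q] C.loss_sq_sum_nonneg[OF q_sq_abs c, of n]
  ultimately have "(\<integral>\<omega>. grid_queue \<mu> 0 h n \<omega> ^ 2 \<partial>M) \<le> (\<integral>\<omega>. q \<omega> ^ 2 \<partial>M) + real n * (v * h + (\<mu> - lam) ^ 2 * h ^ 2)"
    by linarith
  then show ?thesis by (simp add: algebra_simps power2_eq_square)
qed

lemma grid_queue_integrable:
  assumes "0 \<le> h"
  shows "integrable M (grid_queue \<mu> 0 h n)" "integrable M (\<lambda>\<omega>. grid_queue \<mu> 0 h n \<omega> ^ 2)"
proof -
  interpret C: lindley_chain M "grid_queue \<mu> 0 h" "grid_step \<mu> 0 h" using assms by (intro grid_chain) auto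
  have c: "integrable M (\<lambda>\<omega>. \<bar>grid_step \<mu> 0 h 0 \<omega>\<bar> ^ 3)" using grid_step_moments(1) assms by simp
  show "integrable M (grid_queue \<mu> 0 h n)" "integrable M (\<lambda>\<omega>. grid_queue \<mu> 0 h n \<omega> ^ 2)"
    using C.Q_integrable[OF q_sq_abs c] C.Q_sq_integrable(2)[OF q_sq_abs c] by auto
qed

text \<open>Monotone convergence along dyadic grids; the uniform bound of
  \<open>grid_queue_sq_le\<close> makes the limit integrable.\<close>

lemma workload_sq:
  assumes "lam \<le> \<mu>" "0 < H"
  shows "integrable M (\<lambda>\<omega>. Q \<mu> (real j * H) \<omega> ^ 2)"
    and "(\<lambda>m. \<integral>\<omega>. grid_queue \<mu> 0 (H / 2 ^ m) (j * 2 ^ m) \<omega> ^ 2 \<partial>M) \<longlonglongrightarrow> (\<integral>\<omega>. Q \<mu> (real j * H) \<omega> ^ 2 \<partial>M)"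
proof -
  let ?g = "\<lambda>m \<omega>. grid_queue \<mu> 0 (H / 2 ^ m) (j * 2 ^ m) \<omega>"
  have i: "integrable M (\<lambda>\<omega>. ?g m \<omega> ^ 2)" for m using grid_queue_integrable(2) \<open>0 < H\<close> by simp
  have mono: "AE \<omega> in M. mono (\<lambda>m. ?g m \<omega> ^ 2)"
    using AE_good
  proof eventually_elim
    case (elim \<omega>)
    show ?case
      using monoD[OF grid_queue_mono[OF elim]] grid_queue_nonneg[OF elim] by (intro monoI power_mono) auto
  qed
  have "incseq (\<lambda>m. \<integral>\<omega>. ?g m \<omega> ^ 2 \<partial>M)"
    using mono by (intro incseq_SucI integral_mono_AE i) (auto elim!: eventually_mono dest: incseq_SucD)
  moreover have "(\<integral>\<omega>. ?g m \<omega> ^ 2 \<partial>M) \<le> (\<integral>\<omega>. q \<omega> ^ 2 \<partial>M) + real j * H * (v + (\<mu> - lam) ^ 2 * H)" for m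
  proof -
    have "H / 2 ^ m \<le> H / 1" using \<open>0 < H\<close> by (intro divide_left_mono) auto
    then have le: "(\<mu> - lam) ^ 2 * (H / 2 ^ m) \<le> (\<mu> - lam) ^ 2 * H" by (intro mult_left_mono) auto
    have "real j * H * (v + (\<mu> - lam) ^ 2 * (H / 2 ^ m)) \<le> real j * H * (v + (\<mu> - lam) ^ 2 * H)"
      using \<open>0 < H\<close> by (intro mult_left_mono add_left_mono le) auto
    moreover have "real (j * 2 ^ m) * (H / 2 ^ m) = real j * H" by simp
    moreover have "(\<integral>\<omega>. ?g m \<omega> ^ 2 \<partial>M) \<le> (\<integral>\<omega>. q \<omega> ^ 2 \<partial>M) + real (j * 2 ^ m) * (H / 2 ^ m) * (v + (\<mu> - lam) ^ 2 * (H / 2 ^ m))"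
      using assms by (intro grid_queue_sq_le) auto
    ultimately show ?thesis by (simp only:)
  qed
  ultimately obtain L where L: "(\<lambda>m. \<integral>\<omega>. ?g m \<omega> ^ 2 \<partial>M) \<longlonglongrightarrow> L"
    using incseq_convergent[of "\<lambda>m. \<integral>\<omega>. ?g m \<omega> ^ 2 \<partial>M"] by blast
  have lim: "AE \<omega> in M. (\<lambda>m. ?g m \<omega> ^ 2) \<longlonglongrightarrow> Q \<mu> (real j * H) \<omega> ^ 2"
    using AE_good by eventually_elim (intro tendsto_power grid_queue_tendsto \<open>0 < H\<close>)
  have meas: "(\<lambda>\<omega>. Q \<mu> (real j * H) \<omega> ^ 2) \<in> borel_measurable M"
    using \<open>0 < H\<close> by (intro borel_measurable_power workload_measurable) simp
  note conv = integral_monotone_convergence_nonneg[OF i mono _ lim L meas]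
  show "integrable M (\<lambda>\<omega>. Q \<mu> (real j * H) \<omega> ^ 2)" by (rule conv) simp
  have "(\<integral>\<omega>. Q \<mu> (real j * H) \<omega> ^ 2 \<partial>M) = L" by (rule conv) simp
  then show "(\<lambda>m. \<integral>\<omega>. ?g m \<omega> ^ 2 \<partial>M) \<longlonglongrightarrow> (\<integral>\<omega>. Q \<mu> (real j * H) \<omega> ^ 2 \<partial>M)" using L by simp
qed

lemma workload_sq_integrable:
  assumes "lam \<le> \<mu>" "0 \<le> t"
  shows "integrable M (\<lambda>\<omega>. Q \<mu> t \<omega> ^ 2)"
proof -
  obtain j H where jH: "t = real j * H" "0 < H" using dyadic_time[OF assms(2)] .
  then show ?thesis using workload_sq(1)[OF assms(1) jH(2), of j] by simp
qed

text \<open>Lowering the speed adds at most the lost work. This carries integrability to speeds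
  below \<open>lam\<close>, so the cost is a genuine expectation on its whole domain and not the
  default 0 of a divergent integral.\<close>

lemma workload_le_shift:
  assumes "\<omega> \<in> space M" "0 \<le> t" "\<mu> \<le> \<mu>'"
  shows "Q \<mu> t \<omega> \<le> Q \<mu>' t \<omega> + (\<mu>' - \<mu>) * t"
proof -
  let ?f = "\<lambda>\<mu> t. net_input U lam \<mu> t \<omega>"
  have "(SUP s\<in>{0..t}. ?f \<mu> t - ?f \<mu> s) \<le> (SUP s\<in>{0..t}. ?f \<mu>' t - ?f \<mu>' s) + (\<mu>' - \<mu>) * t"
  proof (rule cSUP_least)
    fix s assume s: "s \<in> {0..t}"
    have "?f \<mu>' t - ?f \<mu>' s \<le> (SUP s\<in>{0..t}. ?f \<mu>' t - ?f \<mu>' s)"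
      by (rule cSUP_upper[OF s cadlag_bdd_above[OF net_cadlag[OF assms(1)] assms(2)]])
    moreover have "?f \<mu> t - ?f \<mu> s = ?f \<mu>' t - ?f \<mu>' s + (\<mu>' - \<mu>) * (t - s)"
      by (simp add: net_input_def algebra_simps)
    moreover have "(\<mu>' - \<mu>) * (t - s) \<le> (\<mu>' - \<mu>) * t"
      using s assms by (intro mult_left_mono) auto
    ultimately show "?f \<mu> t - ?f \<mu> s \<le> (SUP s\<in>{0..t}. ?f \<mu>' t - ?f \<mu>' s) + (\<mu>' - \<mu>) * t" by linarith
  qed (use assms in simp)
  moreover have "q \<omega> + ?f \<mu> t = q \<omega> + ?f \<mu>' t + (\<mu>' - \<mu>) * t"
    by (simp add: net_input_def algebra_simps)
  ultimately show ?thesis unfolding workload_def by linarith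
qed

lemma workload_integrable:
  assumes "0 \<le> t"
  shows "integrable M (Q \<mu> t)"
proof -
  define \<mu>' where "\<mu>' = max lam \<mu>"
  have "integrable M (Q \<mu>' t)"
    using integrable_power_le(1)[of "Q \<mu>' t" 2 1] workload_sq_integrable[of \<mu>' t] workload_measurable[OF assms] assms
    by (simp add: \<mu>'_def)
  then have "integrable M (\<lambda>\<omega>. Q \<mu>' t \<omega> + (\<mu>' - \<mu>) * t)" by simp
  then show ?thesis
  proof (rule Bochner_Integration.integrable_bound)
    show "AE \<omega> in M. norm (Q \<mu> t \<omega>) \<le> norm (Q \<mu>' t \<omega> + (\<mu>' - \<mu>) * t)"
    proof (rule AE_I2)
      fix \<omega> assume \<omega>: "\<omega> \<in> space M"
      show "norm (Q \<mu> t \<omega>) \<le> norm (Q \<mu>' t \<omega> + (\<mu>' - \<mu>) * t)"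
        using workload_le_shift[OF \<omega> assms, of \<mu> \<mu>'] workload_nonneg[OF \<omega> assms, of q \<mu>] by (simp add: \<mu>'_def)
    qed
  qed (rule workload_measurable[OF assms])
qed

lemma workload_mean_tendsto:
  assumes "0 < H"
  shows "(\<lambda>m. \<integral>\<omega>. grid_queue \<mu> 0 (H / 2 ^ m) (j * 2 ^ m) \<omega> \<partial>M) \<longlonglongrightarrow> (\<integral>\<omega>. Q \<mu> (real j * H) \<omega> \<partial>M)"
proof (rule integral_dominated_convergence[where w = "Q \<mu> (real j * H)"])
  show int: "integrable M (Q \<mu> (real j * H))" using assms by (intro workload_integrable) auto
  show "AE \<omega> in M. (\<lambda>m. grid_queue \<mu> 0 (H / 2 ^ m) (j * 2 ^ m) \<omega>) \<longlonglongrightarrow> Q \<mu> (real j * H) \<omega>"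
    using AE_good by eventually_elim (intro grid_queue_tendsto \<open>0 < H\<close>)
  show "AE \<omega> in M. norm (grid_queue \<mu> 0 (H / 2 ^ m) (j * 2 ^ m) \<omega>) \<le> Q \<mu> (real j * H) \<omega>" for m
    using AE_good by eventually_elim (use grid_queue_le grid_queue_nonneg \<open>0 < H\<close> in simp)
  show "grid_queue \<mu> 0 (H / 2 ^ m) (j * 2 ^ m) \<in> borel_measurable M" for m
    using grid_queue_integrable(1)[of "H / 2 ^ m" \<mu> "j * 2 ^ m"] \<open>0 < H\<close> by (auto dest: borel_measurable_integrable)
  show "Q \<mu> (real j * H) \<in> borel_measurable M" using int by (rule borel_measurable_integrable)
qed

end

locale idle_queue = levy_queue M U lam "\<lambda>_. 0"
  for M :: "'a measure" and U lam
begin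

lemma stationary_chain:
  assumes "lam < \<mu>" "0 \<le> s" "0 < h"
  shows "stationary_lindley M (grid_queue \<mu> s h) (grid_step \<mu> s h)"
proof (intro stationary_lindley.intro stationary_lindley_axioms.intro grid_chain)
  show "grid_queue \<mu> s h 0 \<omega> = 0" for \<omega> by (simp add: grid_queue_def)
  show "integrable M (\<lambda>\<omega>. \<bar>grid_step \<mu> s h 0 \<omega>\<bar> ^ 3)" using assms by (intro grid_step_moments) auto
  have "0 < (\<mu> - lam) * h" using assms by (intro mult_pos_pos) auto
  moreover have "(\<integral>\<omega>. grid_step \<mu> s h 0 \<omega> \<partial>M) = - (\<mu> - lam) * h"
    using assms by (intro grid_step_moments(2)) auto
  ultimately show "(\<integral>\<omega>. grid_step \<mu> s h 0 \<omega> \<partial>M) < 0" by (simp add: algebra_simps)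
qed (use assms in auto)

lemma grid_mean_mono:
  assumes "lam < \<mu>" "0 < h" "i \<le> n"
  shows "(\<integral>\<omega>. grid_queue \<mu> 0 h i \<omega> \<partial>M) \<le> (\<integral>\<omega>. grid_queue \<mu> 0 h n \<omega> \<partial>M)"
proof -
  interpret S: stationary_lindley M "grid_queue \<mu> 0 h" "grid_step \<mu> 0 h" using assms by (intro stationary_chain) auto
  show ?thesis
    by (rule lift_Suc_mono_le[OF _ \<open>i \<le> n\<close>]) (use S.moment_mono[of 1] in simp)
qed

text \<open>The empty chain run for \<open>n\<close> steps from time 0 has the law of one started
  empty at \<open>s\<close>, and the latter ends at time \<open>t\<close> below the true workload,
  whose supremum ranges over earlier starting points too.\<close>

lemma moment_le_workload:
  assumes "0 \<le> s" "0 \<le> h" "t = s + real n * h" "k \<in> {1, 2}" "integrable M (\<lambda>\<omega>. Q \<mu> t \<omega> ^ k)"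
  shows "(\<integral>\<omega>. grid_queue \<mu> 0 h n \<omega> ^ k \<partial>M) \<le> (\<integral>\<omega>. Q \<mu> t \<omega> ^ k \<partial>M)"
proof (rule lindley_chain_moment_mono[OF grid_chain grid_chain, where s1 = s and h1 = h and \<mu>1 = \<mu> and n = n])
  show "distr M borel (grid_step \<mu> 0 h 0) = distr M borel (grid_step \<mu> s h 0)"
    using assms by (simp add: grid_step_law)
  show "grid_queue \<mu> 0 h 0 \<omega> = 0" for \<omega> by (simp add: grid_queue_def)
  show "integrable M (\<lambda>\<omega>. grid_queue \<mu> 0 h n \<omega> ^ k)" using grid_queue_integrable[OF assms(2)] assms(4) by auto
  show "integrable M (\<lambda>\<omega>. Q \<mu> t \<omega> ^ k)" by (rule assms)
  show "AE \<omega> in M. grid_queue \<mu> s h n \<omega> \<le> Q \<mu> t \<omega>"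
  proof (rule AE_I2)
    fix \<omega> assume \<omega>: "\<omega> \<in> space M"
    show "grid_queue \<mu> s h n \<omega> \<le> Q \<mu> t \<omega>"
      using grid_lindley_le_SUP[OF net_cadlag[OF \<omega>] assms(1,2,3), of \<mu>]
      by (simp add: grid_queue_def workload_def)
  qed
qed (use assms in auto)

text \<open>Let the mesh of \<open>moment_le_workload\<close> tend to 0 while the number of steps
  covers a time span of length \<open>s\<close>.\<close>

lemma mean_mono:
  assumes "0 \<le> s" "s \<le> t"
  shows "(\<integral>\<omega>. Q \<mu> s \<omega> \<partial>M) \<le> (\<integral>\<omega>. Q \<mu> t \<omega> \<partial>M)"
proof -
  obtain j H where jH: "s = real j * H" "0 < H" using dyadic_time[OF assms(1)] .
  have "(\<integral>\<omega>. grid_queue \<mu> 0 (H / 2 ^ m) (j * 2 ^ m) \<omega> \<partial>M) \<le> (\<integral>\<omega>. Q \<mu> t \<omega> \<partial>M)" for m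
    using moment_le_workload[of "t - s" "H / 2 ^ m" t "j * 2 ^ m" 1 \<mu>] workload_integrable[of t \<mu>] assms jH by simp
  then show ?thesis
    using workload_mean_tendsto[OF jH(2), of \<mu> j] unfolding jH(1)
    by (intro LIMSEQ_le_const2) auto
qed

end

section \<open>The excess over the queue that starts empty\<close>

context levy_queue
begin

lemma idle: "idle_queue M U lam"
  using empty_queue by (simp add: idle_queue_def)

abbreviation idle_grid :: "real \<Rightarrow> real \<Rightarrow> real \<Rightarrow> nat \<Rightarrow> 'a \<Rightarrow> real" where
  "idle_grid \<mu> s h n \<omega> \<equiv> grid_lindley 0 (\<lambda>t. net_input U lam \<mu> t \<omega>) s h n"

lemma idle_grid_eq: "levy_queue.grid_queue U lam (\<lambda>_. 0) \<mu> s h n = idle_grid \<mu> s h n"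
  by (rule ext) (simp add: levy_queue.grid_queue_def[OF empty_queue])

text \<open>Both queues receive the same steps and the smaller one is pushed up at 0 at least as
  much, so the gap never widens.\<close>

lemma excess_grid_antimono:
  assumes "good \<omega>" "i \<le> n"
  shows "grid_queue \<mu> s h n \<omega> - idle_grid \<mu> s h n \<omega> \<le> grid_queue \<mu> s h i \<omega> - idle_grid \<mu> s h i \<omega>"
proof (rule lift_Suc_antimono_le[OF _ \<open>i \<le> n\<close>])
  fix n
  have "idle_grid \<mu> s h n \<omega> \<le> grid_queue \<mu> s h n \<omega>"
    using grid_lindley_eq_max[of "q \<omega>"] assms(1) unfolding grid_queue_def good_def by (metis max.cobounded2)
  then show "grid_queue \<mu> s h (Suc n) \<omega> - idle_grid \<mu> s h (Suc n) \<omega> \<le> grid_queue \<mu> s h n \<omega> - idle_grid \<mu> s h n \<omega>"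
    by (simp add: grid_queue_def max_def)
qed

lemma workload_eq:
  assumes "good \<omega>" "0 \<le> t"
  shows "Q \<mu> t \<omega> = max (q \<omega> + net_input U lam \<mu> t \<omega>) (V \<mu> t \<omega>)"
    and "V \<mu> t \<omega> = (SUP s\<in>{0..t}. net_input U lam \<mu> t \<omega> - net_input U lam \<mu> s \<omega>)"
proof -
  have "net_input U lam \<mu> 0 \<omega> = 0" using assms by (simp add: good_def net_input_def)
  then show V: "V \<mu> t \<omega> = (SUP s\<in>{0..t}. net_input U lam \<mu> t \<omega> - net_input U lam \<mu> s \<omega>)"
    using SUP_nonneg(2)[of \<omega> t \<mu>] assms by (simp add: workload_def good_def max_def)
  show "Q \<mu> t \<omega> = max (q \<omega> + net_input U lam \<mu> t \<omega>) (V \<mu> t \<omega>)"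
    unfolding V by (simp add: workload_def)
qed

text \<open>The grid underestimates the empty queue but has the same competitor coming from
  \<open>q\<close>, so it overestimates the excess. Minus the excess is thus approximated from
  below, as \<open>monotone_array_riemann_limit\<close> demands.\<close>

lemma excess_le_grid:
  assumes "good \<omega>" "0 \<le> h" "t = real n * h"
  shows "Q \<mu> t \<omega> - V \<mu> t \<omega> \<le> grid_queue \<mu> 0 h n \<omega> - idle_grid \<mu> 0 h n \<omega>"
proof -
  have t: "0 \<le> t" using assms by simp
  have f0: "net_input U lam \<mu> 0 \<omega> = 0" using assms by (simp add: good_def net_input_def)
  have "grid_queue \<mu> 0 h n \<omega> = max (q \<omega> + net_input U lam \<mu> t \<omega>) (idle_grid \<mu> 0 h n \<omega>)"
    using grid_lindley_eq_max[of "q \<omega>" "\<lambda>t. net_input U lam \<mu> t \<omega>" 0 h n] assms f0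
    by (simp add: grid_queue_def good_def)
  moreover have "idle_grid \<mu> 0 h n \<omega> \<le> V \<mu> t \<omega>"
    unfolding workload_eq(2)[OF assms(1) t] using assms
    by (intro grid_lindley_le_SUP net_cadlag) (auto simp: good_def)
  ultimately show ?thesis using workload_eq(1)[OF assms(1) t, of \<mu>] by (simp add: max_def)
qed

lemma excess_antimono:
  assumes "good \<omega>" "0 \<le> s" "s \<le> t"
  shows "Q \<mu> t \<omega> - V \<mu> t \<omega> \<le> Q \<mu> s \<omega> - V \<mu> s \<omega>"
proof -
  have t: "0 \<le> t" using assms by simp
  have "net_input U lam \<mu> t \<omega> - net_input U lam \<mu> s \<omega> + V \<mu> s \<omega> \<le> V \<mu> t \<omega>"
    unfolding workload_eq(2)[OF assms(1,2)] workload_eq(2)[OF assms(1) t]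
    using assms by (intro SUP_increment_le net_cadlag) (auto simp: good_def)
  then show ?thesis
    unfolding workload_eq(1)[OF assms(1,2)] workload_eq(1)[OF assms(1) t] by (simp add: max_def)
qed

lemma excess_bounds:
  assumes "good \<omega>" "0 \<le> t"
  shows "0 \<le> Q \<mu> t \<omega> - V \<mu> t \<omega>" "Q \<mu> t \<omega> - V \<mu> t \<omega> \<le> q \<omega>"
    "Q \<mu> t \<omega> - V \<mu> t \<omega> \<le> max 0 (q \<omega> + net_input U lam \<mu> t \<omega>)"
proof -
  have V0: "0 \<le> V \<mu> t \<omega>" "net_input U lam \<mu> t \<omega> \<le> V \<mu> t \<omega>"
    using assms SUP_nonneg[of \<omega> t \<mu>] unfolding workload_eq(2)[OF assms] by (auto simp: good_def net_input_def)
  have "0 \<le> q \<omega>" using assms by (simp add: good_def)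
  then show "0 \<le> Q \<mu> t \<omega> - V \<mu> t \<omega>" "Q \<mu> t \<omega> - V \<mu> t \<omega> \<le> q \<omega>"
    "Q \<mu> t \<omega> - V \<mu> t \<omega> \<le> max 0 (q \<omega> + net_input U lam \<mu> t \<omega>)"
    using V0 unfolding workload_eq(1)[OF assms] by (auto simp: max_def)
qed

text \<open>With \<open>mean_mono\<close> for the empty queue this exhibits the mean workload as a
  difference of two nondecreasing functions of time.\<close>

lemma excess_mean_antimono:
  assumes "0 \<le> s" "s \<le> t"
  shows "(\<integral>\<omega>. V \<mu> s \<omega> \<partial>M) - (\<integral>\<omega>. Q \<mu> s \<omega> \<partial>M) \<le> (\<integral>\<omega>. V \<mu> t \<omega> \<partial>M) - (\<integral>\<omega>. Q \<mu> t \<omega> \<partial>M)"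
proof -
  interpret Z: idle_queue M U lam by (rule idle)
  have t: "0 \<le> t" using assms by simp
  note i = workload_integrable[OF t, of \<mu>] workload_integrable[OF assms(1), of \<mu>]
    Z.workload_integrable[OF t, of \<mu>] Z.workload_integrable[OF assms(1), of \<mu>]
  have "(\<integral>\<omega>. Q \<mu> t \<omega> - V \<mu> t \<omega> \<partial>M) \<le> (\<integral>\<omega>. Q \<mu> s \<omega> - V \<mu> s \<omega> \<partial>M)"
    using AE_good i by (intro integral_mono_AE) (auto elim!: eventually_mono intro: excess_antimono assms)
  then show ?thesis using i by simp
qed

lemma workload_mean_integrable_on: "(\<lambda>t. \<integral>\<omega>. Q \<mu> t \<omega> \<partial>M) integrable_on {0..T}"
proof -
  interpret Z: idle_queue M U lam by (rule idle)
  have "(\<lambda>t. \<integral>\<omega>. V \<mu> t \<omega> \<partial>M) integrable_on {0..T}"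
    "(\<lambda>t. (\<integral>\<omega>. V \<mu> t \<omega> \<partial>M) - (\<integral>\<omega>. Q \<mu> t \<omega> \<partial>M)) integrable_on {0..T}"
    by (intro integrable_on_mono_on mono_onI Z.mean_mono excess_mean_antimono; simp)+
  from integrable_diff[OF this] show ?thesis by simp
qed

text \<open>The array lemma is applied to the empty queue and to minus the excess; subtracting the
  limits gives the queue itself.\<close>

lemma riemann_limit:
  assumes "lam < \<mu>" "0 < T"
  shows "(\<lambda>k. T / 2 ^ k * (\<Sum>n<2 ^ k. \<integral>\<omega>. grid_queue \<mu> 0 (T / 2 ^ k) n \<omega> \<partial>M))
      \<longlonglongrightarrow> integral {0..T} (\<lambda>t. \<integral>\<omega>. Q \<mu> t \<omega> \<partial>M)"
proof -
  interpret Z: idle_queue M U lam by (rule idle)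
  have le: "lam \<le> \<mu>" using assms by simp
  define h where "h k = T / 2 ^ k" for k :: nat
  have h: "0 < h k" "0 \<le> h k" for k using \<open>0 < T\<close> by (simp_all add: h_def)
  define a where "a t = (\<integral>\<omega>. V \<mu> t \<omega> \<partial>M)" for t
  define b where "b t = (\<integral>\<omega>. V \<mu> t \<omega> \<partial>M) - (\<integral>\<omega>. Q \<mu> t \<omega> \<partial>M)" for t
  define A where "A k n = (\<integral>\<omega>. idle_grid \<mu> 0 (h k) n \<omega> \<partial>M)" for k n
  define G where "G k n = (\<integral>\<omega>. grid_queue \<mu> 0 (h k) n \<omega> \<partial>M)" for k n
  have iA: "integrable M (idle_grid \<mu> 0 (h k) n)" for k n
    using Z.grid_queue_integrable(1)[OF h(2)] unfolding idle_grid_eq .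
  have iG: "integrable M (grid_queue \<mu> 0 (h k) n)" for k n by (rule grid_queue_integrable(1)[OF h(2)])
  have iV: "integrable M (V \<mu> t)" and iQ: "integrable M (Q \<mu> t)" if "0 \<le> t" for t
    using Z.workload_integrable[OF that] workload_integrable[OF that] by auto
  have scale: "h (K + m) = h K / 2 ^ m" for K m by (simp add: h_def power_add)
  have a_mono: "a s \<le> a t" if "0 \<le> s" "s \<le> t" "t \<le> T" for s t
    unfolding a_def using that by (intro Z.mean_mono)
  have b_mono: "b s \<le> b t" if "0 \<le> s" "s \<le> t" "t \<le> T" for s t
    unfolding b_def using that by (intro excess_mean_antimono)
  have limA: "(\<lambda>k. T / 2 ^ k * (\<Sum>n<2 ^ k. A k n)) \<longlonglongrightarrow> integral {0..T} a"
  proof (rule monotone_array_riemann_limit[OF \<open>0 < T\<close> a_mono])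
    show "A k i \<le> A k n" if "i \<le> n" for k i n
      using Z.grid_mean_mono[OF assms(1) h(1) that] unfolding A_def idle_grid_eq .
    show "A k n \<le> a (real n * (T / 2 ^ k))" for k n
      using Z.moment_le_workload[OF order_refl h(2), of "real n * (T / 2 ^ k)" n k 1 \<mu>] iV[of "real n * (T / 2 ^ k)"] \<open>0 < T\<close>
      unfolding A_def a_def idle_grid_eq by (simp add: h_def)
    show "(\<lambda>m. A (K + m) (j * 2 ^ m)) \<longlonglongrightarrow> a (real j * (T / 2 ^ K))" for K j
      using Z.workload_mean_tendsto[OF h(1), of \<mu> K j] unfolding A_def a_def scale idle_grid_eq by (simp add: h_def)
  qed
  have limB: "(\<lambda>k. T / 2 ^ k * (\<Sum>n<2 ^ k. A k n - G k n)) \<longlonglongrightarrow> integral {0..T} b"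
  proof (rule monotone_array_riemann_limit[OF \<open>0 < T\<close> b_mono])
    show "A k i - G k i \<le> A k n - G k n" if "i \<le> n" for k i n
    proof -
      have "(\<integral>\<omega>. grid_queue \<mu> 0 (h k) n \<omega> - idle_grid \<mu> 0 (h k) n \<omega> \<partial>M) \<le>
        (\<integral>\<omega>. grid_queue \<mu> 0 (h k) i \<omega> - idle_grid \<mu> 0 (h k) i \<omega> \<partial>M)"
        using AE_good iA iG by (intro integral_mono_AE) (auto elim!: eventually_mono intro: excess_grid_antimono that)
      then show ?thesis using iA iG by (simp add: A_def G_def)
    qed
    show "A k n - G k n \<le> b (real n * (T / 2 ^ k))" for k n
    proof -
      have t: "0 \<le> real n * h k" using h(2)[of k] by simp
      have "(\<integral>\<omega>. Q \<mu> (real n * h k) \<omega> - V \<mu> (real n * h k) \<omega> \<partial>M) \<le>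
        (\<integral>\<omega>. grid_queue \<mu> 0 (h k) n \<omega> - idle_grid \<mu> 0 (h k) n \<omega> \<partial>M)"
        using AE_good iA iG iQ[OF t] iV[OF t]
        by (intro integral_mono_AE) (auto elim!: eventually_mono intro: excess_le_grid h)
      then show ?thesis using iA iG iQ[OF t] iV[OF t] by (simp add: A_def G_def b_def h_def)
    qed
    show "(\<lambda>m. A (K + m) (j * 2 ^ m) - G (K + m) (j * 2 ^ m)) \<longlonglongrightarrow> b (real j * (T / 2 ^ K))" for K j
    proof (unfold b_def, intro tendsto_diff)
      show "(\<lambda>m. A (K + m) (j * 2 ^ m)) \<longlonglongrightarrow> (\<integral>\<omega>. V \<mu> (real j * (T / 2 ^ K)) \<omega> \<partial>M)"
        using Z.workload_mean_tendsto[OF h(1), of \<mu> K j] unfolding A_def scale idle_grid_eq by (simp add: h_def)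
      show "(\<lambda>m. G (K + m) (j * 2 ^ m)) \<longlonglongrightarrow> (\<integral>\<omega>. Q \<mu> (real j * (T / 2 ^ K)) \<omega> \<partial>M)"
        using workload_mean_tendsto[OF h(1), of \<mu> K j] unfolding G_def scale by (simp add: h_def)
    qed
  qed
  have ia: "a integrable_on {0..T}" and ib: "b integrable_on {0..T}"
    by (intro integrable_on_mono_on mono_onI a_mono b_mono; simp)+
  have ab: "a t - b t = (\<integral>\<omega>. Q \<mu> t \<omega> \<partial>M)" for t by (simp add: a_def b_def)
  have "(\<lambda>k. T / 2 ^ k * (\<Sum>n<2 ^ k. A k n) - T / 2 ^ k * (\<Sum>n<2 ^ k. A k n - G k n)) \<longlonglongrightarrow> integral {0..T} a - integral {0..T} b"
    by (rule tendsto_diff[OF limA limB])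
  moreover have "integral {0..T} a - integral {0..T} b = integral {0..T} (\<lambda>t. \<integral>\<omega>. Q \<mu> t \<omega> \<partial>M)"
    using Henstock_Kurzweil_Integration.integral_diff[OF ia ib] by (simp add: ab)
  moreover have "T / 2 ^ k * (\<Sum>n<2 ^ k. A k n) - T / 2 ^ k * (\<Sum>n<2 ^ k. A k n - G k n) =
      T / 2 ^ k * (\<Sum>n<2 ^ k. G k n)" for k
    by (simp add: sum_subtractf algebra_simps)
  ultimately show "(\<lambda>k. T / 2 ^ k * (\<Sum>n<2 ^ k. \<integral>\<omega>. grid_queue \<mu> 0 (T / 2 ^ k) n \<omega> \<partial>M))
      \<longlonglongrightarrow> integral {0..T} (\<lambda>t. \<integral>\<omega>. Q \<mu> t \<omega> \<partial>M)"
    by (simp add: G_def h_def)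
qed

end

section \<open>Second moment of the workload\<close>

lemma dyadic_mesh: "0 < (T :: real) \<Longrightarrow> filterlim (\<lambda>k. T / 2 ^ k) (at_right 0) sequentially"
proof -
  assume "0 < T"
  have "(\<lambda>k. T * (1 / 2) ^ k) \<longlonglongrightarrow> T * 0" by (intro tendsto_intros LIMSEQ_power_zero) auto
  then have "(\<lambda>k. T / 2 ^ k) \<longlonglongrightarrow> 0" by (simp add: power_divide)
  then show ?thesis using \<open>0 < T\<close> by (auto simp: filterlim_at intro!: always_eventually)
qed

context levy_queue
begin

text \<open>The bound on the cubed undershoot of one grid step, per unit of time. Spectral
  positivity enters all later estimates through its limit at 0.\<close>

definition undershoot_rate :: "real \<Rightarrow> real \<Rightarrow> real" where
  "undershoot_rate \<mu> h = (4 * under3 (lam * h) + 4 * \<bar>\<mu> - lam\<bar> ^ 3 * h ^ 3) / h"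

lemma undershoot_rate_tendsto_0:
  assumes sp: "spectrally_positive M U"
  shows "(undershoot_rate \<mu> \<longlongrightarrow> 0) (at_right 0)"
proof -
  have "((\<lambda>h. under3 (lam * h) / h) \<longlongrightarrow> 0) (at_right 0)"
  proof (rule tendstoI)
    fix e :: real assume "0 < e"
    define r where "r = e / (2 * lam)"
    have r: "0 < r" "r * lam < e" using \<open>0 < e\<close> lam_pos by (simp_all add: r_def)
    obtain s0 where s0: "0 < s0" "\<And>s. 0 < s \<Longrightarrow> s < s0 \<Longrightarrow> under3 s \<le> r * s"
      by (rule under3_small_o[OF sp r(1)]) (blast intro: that)
    have "\<forall>\<^sub>F h in at_right 0. 0 < h \<and> h < s0 / lam"
      using s0 lam_pos by (intro eventually_at_rightI[of 0 "s0 / lam"]) auto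
    then show "\<forall>\<^sub>F h in at_right 0. dist (under3 (lam * h) / h) 0 < e"
    proof eventually_elim
      case (elim h)
      then have "under3 (lam * h) \<le> r * (lam * h)" using lam_pos by (intro s0) (auto simp: field_simps)
      then have "under3 (lam * h) / h \<le> r * lam" using elim by (simp add: field_simps)
      moreover have "0 \<le> under3 (lam * h) / h" using elim by (simp add: under3_def)
      ultimately show ?case using r by simp
    qed
  qed
  then have "((\<lambda>h. 4 * (under3 (lam * h) / h) + 4 * \<bar>\<mu> - lam\<bar> ^ 3 * h ^ 2) \<longlongrightarrow> 4 * 0 + 4 * \<bar>\<mu> - lam\<bar> ^ 3 * 0 ^ 2) (at_right 0)"
    by (intro tendsto_add tendsto_mult_left tendsto_power tendsto_ident_at)
  moreover have "\<forall>\<^sub>F h in at_right 0. 4 * (under3 (lam * h) / h) + 4 * \<bar>\<mu> - lam\<bar> ^ 3 * h ^ 2 = undershoot_rate \<mu> h"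
    using eventually_at_right_less[of 0]
    by eventually_elim (simp add: undershoot_rate_def field_simps power2_eq_square power3_eq_cube)
  ultimately have "(undershoot_rate \<mu> \<longlongrightarrow> 4 * 0 + 4 * \<bar>\<mu> - lam\<bar> ^ 3 * 0 ^ 2) (at_right 0)"
    by (rule Lim_transform_eventually)
  then show ?thesis by simp
qed

lemma undershoot_le_rate:
  assumes "0 \<le> s" "0 < h"
  shows "(\<integral>\<omega>. (max 0 (- grid_step \<mu> s h n \<omega>)) ^ 3 \<partial>M) \<le> h * undershoot_rate \<mu> h"
  using grid_step_moments(5)[of s h \<mu> n] assms by (simp add: undershoot_rate_def)

text \<open>Squaring the Lindley recursion and summing over the grid. The losses at the boundary vanish
  in the limit because spectral positivity makes the cubes of the undershoots negligible.\<close>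

lemma workload_sq_identity:
  assumes sp: "spectrally_positive M U" and "lam < \<mu>" "0 < T"
  shows "(\<integral>\<omega>. Q \<mu> T \<omega> ^ 2 \<partial>M) =
    (\<integral>\<omega>. q \<omega> ^ 2 \<partial>M) - 2 * (\<mu> - lam) * integral {0..T} (\<lambda>t. \<integral>\<omega>. Q \<mu> t \<omega> \<partial>M) + v * T"
proof -
  define d where "d = \<mu> - lam"
  have d: "0 < d" using assms by (simp add: d_def)
  have le: "lam \<le> \<mu>" using assms by simp
  define h where "h k = T / 2 ^ k" for k :: nat
  have h: "0 < h k" "0 \<le> h k" "real (2 ^ k) * h k = T" for k using \<open>0 < T\<close> by (simp_all add: h_def)
  define G where "G k n \<omega> = grid_queue \<mu> 0 (h k) n \<omega>" for k n \<omega>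
  define loss where "loss k n \<omega> = max 0 (- (G k n \<omega> + grid_step \<mu> 0 (h k) n \<omega>))" for k n \<omega>
  define S where "S k = (\<Sum>n<2 ^ k. \<integral>\<omega>. loss k n \<omega> ^ 2 \<partial>M)" for k
  have sum: "(\<integral>\<omega>. G k (2 ^ k) \<omega> ^ 2 \<partial>M) = (\<integral>\<omega>. q \<omega> ^ 2 \<partial>M)
      - 2 * d * (h k * (\<Sum>n<2 ^ k. \<integral>\<omega>. G k n \<omega> \<partial>M)) + (v * T + d ^ 2 * T * h k) - S k"
    and S0: "0 \<le> S k"
    and S_le: "\<And>e. 0 < e \<Longrightarrow> S k \<le> e * ((\<integral>\<omega>. Q \<mu> T \<omega> \<partial>M) + d * T) + T * undershoot_rate \<mu> (h k) / e" for k
  proof -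
    interpret C: lindley_chain M "grid_queue \<mu> 0 (h k)" "grid_step \<mu> 0 (h k)" by (rule grid_chain[OF order_refl h(2)])
    note m = grid_step_moments[OF order_refl h(2), of \<mu> k 0, folded d_def]
    have q: "grid_queue \<mu> 0 (h k) 0 = q" by (rule ext) (simp add: grid_queue_def)
    have S: "S k = (\<Sum>n<2 ^ k. \<integral>\<omega>. C.loss n \<omega> ^ 2 \<partial>M)"
      by (simp add: S_def loss_def C.loss_def G_def)
    have e: "real (2 ^ k) * (v * h k + d ^ 2 * h k ^ 2) = v * (real (2 ^ k) * h k) + d ^ 2 * (real (2 ^ k) * h k) * h k"
      by (simp add: algebra_simps power2_eq_square)
    show "0 \<le> S k" unfolding S by (rule C.loss_sq_sum_nonneg[OF q_sq_abs m(1)])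
    have "(\<integral>\<omega>. G k (2 ^ k) \<omega> ^ 2 \<partial>M) = (\<integral>\<omega>. q \<omega> ^ 2 \<partial>M)
      + 2 * (- d * h k) * (\<Sum>n<2 ^ k. \<integral>\<omega>. G k n \<omega> \<partial>M) + real (2 ^ k) * (v * h k + d ^ 2 * h k ^ 2) - S k"
      using C.Q_sq_sum[OF q_sq_abs m(1), of "2 ^ k"] unfolding m(2,3) q S G_def .
    then show "(\<integral>\<omega>. G k (2 ^ k) \<omega> ^ 2 \<partial>M) = (\<integral>\<omega>. q \<omega> ^ 2 \<partial>M)
      - 2 * d * (h k * (\<Sum>n<2 ^ k. \<integral>\<omega>. G k n \<omega> \<partial>M)) + (v * T + d ^ 2 * T * h k) - S k"
      unfolding e h(3) by (simp add: mult.assoc)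
    fix e :: real assume "0 < e"
    have GQ: "(\<integral>\<omega>. G k (2 ^ k) \<omega> \<partial>M) \<le> (\<integral>\<omega>. Q \<mu> T \<omega> \<partial>M)"
      using AE_good grid_queue_integrable(1)[OF h(2)] workload_integrable[of T \<mu>] \<open>0 < T\<close>
        grid_queue_le[OF _ \<open>0 < T\<close>, of _ \<mu> k 1]
      unfolding G_def h_def by (intro integral_mono_AE) (auto elim!: eventually_mono)
    have q0: "0 \<le> (\<integral>\<omega>. q \<omega> \<partial>M)" by (rule integral_nonneg_AE[OF q_nonneg])
    have "S k \<le> e * ((\<integral>\<omega>. G k (2 ^ k) \<omega> \<partial>M) - (\<integral>\<omega>. q \<omega> \<partial>M) - real (2 ^ k) * (- d * h k)) + real (2 ^ k) * C.undershoot3 / e"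
      using C.loss_sq_sum_le[OF q_sq_abs m(1) \<open>0 < e\<close>, of "2 ^ k"] unfolding m(2) q S G_def .
    also have "\<dots> \<le> e * ((\<integral>\<omega>. Q \<mu> T \<omega> \<partial>M) + d * T) + real (2 ^ k) * (h k * undershoot_rate \<mu> (h k)) / e"
    proof (intro add_mono mult_left_mono divide_right_mono)
      have "real (2 ^ k) * (- d * h k) = - d * T" unfolding h(3)[of k, symmetric] by (simp add: algebra_simps)
      then show "(\<integral>\<omega>. G k (2 ^ k) \<omega> \<partial>M) - (\<integral>\<omega>. q \<omega> \<partial>M) - real (2 ^ k) * (- d * h k) \<le> (\<integral>\<omega>. Q \<mu> T \<omega> \<partial>M) + d * T"
        using GQ q0 by linarith
      show "C.undershoot3 \<le> h k * undershoot_rate \<mu> (h k)" by (rule undershoot_le_rate[OF order_refl h(1)])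
    qed (use \<open>0 < e\<close> in auto)
    also have "real (2 ^ k) * (h k * undershoot_rate \<mu> (h k)) = T * undershoot_rate \<mu> (h k)"
      unfolding mult.assoc[symmetric] h(3) ..
    finally show "S k \<le> e * ((\<integral>\<omega>. Q \<mu> T \<omega> \<partial>M) + d * T) + T * undershoot_rate \<mu> (h k) / e" .
  qed
  have rate: "(\<lambda>k. undershoot_rate \<mu> (h k)) \<longlonglongrightarrow> 0"
    using undershoot_rate_tendsto_0[OF sp] dyadic_mesh[OF \<open>0 < T\<close>] unfolding h_def by (rule filterlim_compose)
  have "S \<longlonglongrightarrow> 0"
  proof (rule tendstoI)
    fix e :: real assume "0 < e"
    define B where "B = (\<integral>\<omega>. Q \<mu> T \<omega> \<partial>M) + d * T"
    have "0 \<le> (\<integral>\<omega>. Q \<mu> T \<omega> \<partial>M)"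
      using workload_nonneg \<open>0 < T\<close> by (intro integral_nonneg_AE AE_I2) auto
    then have B: "0 \<le> B" using d \<open>0 < T\<close> by (simp add: B_def)
    \<comment> \<open>First \<open>x\<close> makes the telescoped part small, then the mesh makes
      the undershoot part small for this fixed \<open>x\<close>.\<close>
    define x where "x = e / (2 * (B + 1))"
    have x: "0 < x" "x * B < e / 2" using \<open>0 < e\<close> B by (auto simp: x_def field_simps)
    have "(\<lambda>k. T * undershoot_rate \<mu> (h k) / x) \<longlonglongrightarrow> T * 0 / x" by (intro tendsto_intros rate) (use x in simp)
    then have "\<forall>\<^sub>F k in sequentially. T * undershoot_rate \<mu> (h k) / x < e / 2"
      by (rule order_tendstoD(2)) (use \<open>0 < e\<close> in simp)
    then show "\<forall>\<^sub>F k in sequentially. dist (S k) 0 < e"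
    proof eventually_elim
      case (elim k)
      then have "S k < e" using S_le[OF x(1), of k] x(2) unfolding B_def[symmetric] by linarith
      then show ?case using S0[of k] by simp
    qed
  qed
  moreover have "h \<longlonglongrightarrow> 0"
    using dyadic_mesh[OF \<open>0 < T\<close>] by (simp add: h_def[abs_def] filterlim_at)
  moreover have "(\<lambda>k. h k * (\<Sum>n<2 ^ k. \<integral>\<omega>. G k n \<omega> \<partial>M)) \<longlonglongrightarrow> integral {0..T} (\<lambda>t. \<integral>\<omega>. Q \<mu> t \<omega> \<partial>M)"
    using riemann_limit[OF assms(2,3)] by (simp add: h_def G_def)
  ultimately have "(\<lambda>k. (\<integral>\<omega>. q \<omega> ^ 2 \<partial>M)
      - 2 * d * (h k * (\<Sum>n<2 ^ k. \<integral>\<omega>. G k n \<omega> \<partial>M)) + (v * T + d ^ 2 * T * h k) - S k) \<longlonglongrightarrow>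
      (\<integral>\<omega>. q \<omega> ^ 2 \<partial>M) - 2 * d * integral {0..T} (\<lambda>t. \<integral>\<omega>. Q \<mu> t \<omega> \<partial>M) + (v * T + d ^ 2 * T * 0) - 0"
    by (intro tendsto_intros)
  moreover have "(\<lambda>k. \<integral>\<omega>. G k (2 ^ k) \<omega> ^ 2 \<partial>M) \<longlonglongrightarrow> (\<integral>\<omega>. Q \<mu> T \<omega> ^ 2 \<partial>M)"
    using workload_sq(2)[OF le \<open>0 < T\<close>, of 1] by (simp add: G_def h_def)
  ultimately have "(\<integral>\<omega>. Q \<mu> T \<omega> ^ 2 \<partial>M) =
      (\<integral>\<omega>. q \<omega> ^ 2 \<partial>M) - 2 * d * integral {0..T} (\<lambda>t. \<integral>\<omega>. Q \<mu> t \<omega> \<partial>M) + (v * T + d ^ 2 * T * 0) - 0"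
    unfolding sum by (rule LIMSEQ_unique[rotated])
  then show ?thesis by (simp add: d_def)
qed

text \<open>The Pollaczek-Khinchine value: balancing squares gives the mean
  \<open>v / (2 * d)\<close> with \<open>d = \<mu> - lam\<close>, and balancing cubes makes
  \<open>3 * d\<close> times the second moment equal to \<open>3 * v\<close> times the mean plus
  \<open>w\<close>.\<close>

definition "stationary_second_moment \<mu> = w / (3 * (\<mu> - lam)) + v ^ 2 / (2 * (\<mu> - lam) ^ 2)"

end

context idle_queue
begin

context
  fixes \<mu> :: real
  assumes sp: "spectrally_positive M U" and stable: "lam < \<mu>"
begin

text \<open>The chain estimates with drift \<open>d * h\<close> and step moments written as rates
  times \<open>h\<close>, so that the mesh cancels. As \<open>h\<close> tends to 0 the upper bound
  becomes the equilibrium value, and the lower one does so up to \<open>e\<close> and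
  \<open>y\<close>.\<close>

lemma stationary_bounds:
  assumes "0 < h"
  defines "d \<equiv> \<mu> - lam"
  shows "(\<integral>\<omega>. grid_queue \<mu> 0 h n \<omega> ^ 2 \<partial>M) \<le>
      (v + d ^ 2 * h) ^ 2 / (2 * d ^ 2) + (w - 3 * v * d * h - d ^ 3 * h ^ 2) / (3 * d) + undershoot_rate \<mu> h / (3 * d)"
    and "0 < e \<Longrightarrow> 0 < y \<Longrightarrow> \<exists>n. (v + d ^ 2 * h) * (v + d ^ 2 * h - e * d - undershoot_rate \<mu> h / e) / (2 * d ^ 2)
      + (w - 3 * v * d * h - d ^ 3 * h ^ 2) / (3 * d) - y \<le> (\<integral>\<omega>. grid_queue \<mu> 0 h n \<omega> ^ 2 \<partial>M)"
proof -
  interpret S: stationary_lindley M "grid_queue \<mu> 0 h" "grid_step \<mu> 0 h" using stable assms by (intro stationary_chain) auto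
  have h: "0 \<le> h" "h \<noteq> 0" using assms by auto
  have d: "0 < d" using stable by (simp add: d_def)
  note m = grid_step_moments[OF order_refl h(1), of \<mu> 0, folded d_def]
  have Sd: "S.d = d * h" unfolding S.d_def m(2) by simp
  define a where "a = v + d ^ 2 * h"
  define b where "b = w - 3 * v * d * h - d ^ 3 * h ^ 2"
  have e2: "S.e2 = a * h" unfolding m(3) a_def by (simp add: algebra_simps power2_eq_square)
  have e3: "S.e3 = b * h" unfolding m(4) b_def by (simp add: algebra_simps power2_eq_square power3_eq_cube)
  define r where "r = undershoot_rate \<mu> h"
  have u: "S.undershoot3 \<le> h * r" unfolding r_def by (rule undershoot_le_rate[OF order_refl \<open>0 < h\<close>])
  have a: "0 \<le> a" using v_nonneg h by (simp add: a_def)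
  have "(\<integral>\<omega>. grid_queue \<mu> 0 h n \<omega> ^ 2 \<partial>M) \<le> (3 * (a * h) * (a * h / (2 * (d * h))) + b * h + S.undershoot3) / (3 * (d * h))"
    using S.second_moment_le[of n] unfolding e2 e3 Sd .
  also have "\<dots> \<le> (3 * (a * h) * (a * h / (2 * (d * h))) + b * h + h * r) / (3 * (d * h))"
    using u d \<open>0 < h\<close> by (intro divide_right_mono add_left_mono) auto
  also have "\<dots> = a ^ 2 / (2 * d ^ 2) + b / (3 * d) + r / (3 * d)"
    using d h(2) by (simp add: field_simps power2_eq_square)
  finally show "(\<integral>\<omega>. grid_queue \<mu> 0 h n \<omega> ^ 2 \<partial>M) \<le>
      (v + d ^ 2 * h) ^ 2 / (2 * d ^ 2) + (w - 3 * v * d * h - d ^ 3 * h ^ 2) / (3 * d) + undershoot_rate \<mu> h / (3 * d)"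
    unfolding a_def b_def r_def .
  assume "0 < e" "0 < y"
  obtain n where n: "(3 * (a * h) * ((a * h - e * (d * h) - S.undershoot3 / e) / (2 * (d * h))) + b * h) / (3 * (d * h)) - y
    \<le> (\<integral>\<omega>. grid_queue \<mu> 0 h n \<omega> ^ 2 \<partial>M)"
    using S.second_moment_limit_ge[OF \<open>0 < e\<close> \<open>0 < y\<close>] unfolding e2 e3 Sd by blast
  have "a * (a - e * d - r / e) / (2 * d ^ 2) + b / (3 * d) =
      (3 * (a * h) * ((a * h - e * (d * h) - (h * r) / e) / (2 * (d * h))) + b * h) / (3 * (d * h))"
    using d h(2) \<open>0 < e\<close> by (simp add: field_simps power2_eq_square)
  also have "\<dots> \<le> (3 * (a * h) * ((a * h - e * (d * h) - S.undershoot3 / e) / (2 * (d * h))) + b * h) / (3 * (d * h))"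
    using u d h(1) a \<open>0 < e\<close> by (intro divide_right_mono add_right_mono mult_left_mono diff_left_mono) auto
  finally show "\<exists>n. (v + d ^ 2 * h) * (v + d ^ 2 * h - e * d - undershoot_rate \<mu> h / e) / (2 * d ^ 2)
      + (w - 3 * v * d * h - d ^ 3 * h ^ 2) / (3 * d) - y \<le> (\<integral>\<omega>. grid_queue \<mu> 0 h n \<omega> ^ 2 \<partial>M)"
    using n unfolding a_def b_def r_def by (intro exI[of _ n]) linarith
qed

text \<open>The bound for the chain is uniform in the number of steps, so \<open>T\<close> may stay
  fixed while the mesh \<open>T / 2 ^ k\<close> tends to 0.\<close>

lemma second_moment_le_stationary:
  assumes "0 < T"
  shows "(\<integral>\<omega>. Q \<mu> T \<omega> ^ 2 \<partial>M) \<le> stationary_second_moment \<mu>"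
proof -
  define d where "d = \<mu> - lam"
  have d: "0 < d" using stable by (simp add: d_def)
  have id: "((\<lambda>h. h) \<longlongrightarrow> (0 :: real)) (at_right 0)" by (rule tendsto_ident_at)
  have "((\<lambda>h. (v + d ^ 2 * h) ^ 2 / (2 * d ^ 2) + (w - 3 * v * d * h - d ^ 3 * h ^ 2) / (3 * d) + undershoot_rate \<mu> h / (3 * d)) \<longlongrightarrow>
      (v + d ^ 2 * 0) ^ 2 / (2 * d ^ 2) + (w - 3 * v * d * 0 - d ^ 3 * 0 ^ 2) / (3 * d) + 0 / (3 * d)) (at_right 0)"
    using d by (intro tendsto_intros undershoot_rate_tendsto_0[OF sp] id) auto
  from filterlim_compose[OF this dyadic_mesh[OF assms]]
  have lim: "(\<lambda>k. (v + d ^ 2 * (T / 2 ^ k)) ^ 2 / (2 * d ^ 2) + (w - 3 * v * d * (T / 2 ^ k) - d ^ 3 * (T / 2 ^ k) ^ 2) / (3 * d)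
      + undershoot_rate \<mu> (T / 2 ^ k) / (3 * d)) \<longlonglongrightarrow> stationary_second_moment \<mu>"
    by (simp add: stationary_second_moment_def d_def add.commute)
  have "(\<lambda>k. \<integral>\<omega>. grid_queue \<mu> 0 (T / 2 ^ k) (2 ^ k) \<omega> ^ 2 \<partial>M) \<longlonglongrightarrow> (\<integral>\<omega>. Q \<mu> T \<omega> ^ 2 \<partial>M)"
    using workload_sq(2)[of \<mu> T 1] stable assms by simp
  then show ?thesis
    using lim
  proof (rule LIMSEQ_le, intro exI allI impI)
    show "(\<integral>\<omega>. grid_queue \<mu> 0 (T / 2 ^ k) (2 ^ k) \<omega> ^ 2 \<partial>M) \<le>
      (v + d ^ 2 * (T / 2 ^ k)) ^ 2 / (2 * d ^ 2) + (w - 3 * v * d * (T / 2 ^ k) - d ^ 3 * (T / 2 ^ k) ^ 2) / (3 * d)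
      + undershoot_rate \<mu> (T / 2 ^ k) / (3 * d)" for k
      unfolding d_def by (rule stationary_bounds(1)) (use assms in simp)
  qed
qed

lemma second_moment_tendsto:
  "((\<lambda>T. \<integral>\<omega>. Q \<mu> T \<omega> ^ 2 \<partial>M) \<longlongrightarrow> stationary_second_moment \<mu>) at_top"
proof (rule order_tendstoI)
  fix c assume c: "stationary_second_moment \<mu> < c"
  show "\<forall>\<^sub>F T in at_top. (\<integral>\<omega>. Q \<mu> T \<omega> ^ 2 \<partial>M) < c"
    using eventually_gt_at_top[of 0]
    by eventually_elim (rule le_less_trans[OF second_moment_le_stationary c])
next
  fix c assume c: "c < stationary_second_moment \<mu>"
  define d where "d = \<mu> - lam"
  have d: "0 < d" using stable by (simp add: d_def)
  \<comment> \<open>One third of the gap each for the boundary parameter \<open>e\<close>, the mesh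
    \<open>h\<close> and the number of steps \<open>n\<close>.\<close>
  define y where "y = (stationary_second_moment \<mu> - c) / 3"
  have y: "0 < y" using c by (simp add: y_def)
  \<comment> \<open>In the limit of small mesh the boundary error is \<open>v * e / (2 * d)\<close>,
    at most \<open>y\<close> for this choice.\<close>
  define e where "e = y * (2 * d) / (v + 1)"
  have e: "0 < e" using y d v_nonneg by (auto simp: e_def intro!: divide_pos_pos)
  have ey: "v * (v - e * d - 0 / e) / (2 * d ^ 2) + w / (3 * d) > stationary_second_moment \<mu> - 2 * y"
  proof -
    have "v * e \<le> y * (2 * d)"
    proof -
      have "v * (y * (2 * d)) \<le> (v + 1) * (y * (2 * d))" using y d by (intro mult_right_mono) auto
      then show ?thesis using v_nonneg by (simp add: e_def field_simps)
    qed
    then have "v * e / (2 * d) \<le> y" using d by (simp add: field_simps)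
    moreover have "v * (v - e * d - 0 / e) / (2 * d ^ 2) + w / (3 * d) = stationary_second_moment \<mu> - v * e / (2 * d)"
      using d e unfolding stationary_second_moment_def d_def[symmetric] by (simp add: field_simps power2_eq_square)
    ultimately show ?thesis using y by linarith
  qed
  have id: "((\<lambda>h. h) \<longlongrightarrow> (0 :: real)) (at_right 0)" by (rule tendsto_ident_at)
  have "((\<lambda>h. (v + d ^ 2 * h) * (v + d ^ 2 * h - e * d - undershoot_rate \<mu> h / e) / (2 * d ^ 2)
      + (w - 3 * v * d * h - d ^ 3 * h ^ 2) / (3 * d)) \<longlongrightarrow>
      (v + d ^ 2 * 0) * (v + d ^ 2 * 0 - e * d - 0 / e) / (2 * d ^ 2) + (w - 3 * v * d * 0 - d ^ 3 * 0 ^ 2) / (3 * d)) (at_right 0)"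
    using d e by (intro tendsto_intros undershoot_rate_tendsto_0[OF sp] id) auto
  then have "\<forall>\<^sub>F h in at_right 0. stationary_second_moment \<mu> - 2 * y <
      (v + d ^ 2 * h) * (v + d ^ 2 * h - e * d - undershoot_rate \<mu> h / e) / (2 * d ^ 2)
      + (w - 3 * v * d * h - d ^ 3 * h ^ 2) / (3 * d)"
    by (rule order_tendstoD(1)) (use ey in simp)
  then have "\<forall>\<^sub>F h in at_right 0. 0 < h \<and> stationary_second_moment \<mu> - 2 * y <
      (v + d ^ 2 * h) * (v + d ^ 2 * h - e * d - undershoot_rate \<mu> h / e) / (2 * d ^ 2)
      + (w - 3 * v * d * h - d ^ 3 * h ^ 2) / (3 * d)"
    using eventually_at_right_less[of 0] by eventually_elim simp
  then obtain h where h: "0 < h" "stationary_second_moment \<mu> - 2 * y <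
      (v + d ^ 2 * h) * (v + d ^ 2 * h - e * d - undershoot_rate \<mu> h / e) / (2 * d ^ 2)
      + (w - 3 * v * d * h - d ^ 3 * h ^ 2) / (3 * d)"
    using eventually_happens'[OF trivial_limit_at_right_real] by blast
  obtain n where "(v + d ^ 2 * h) * (v + d ^ 2 * h - e * d - undershoot_rate \<mu> h / e) / (2 * d ^ 2)
      + (w - 3 * v * d * h - d ^ 3 * h ^ 2) / (3 * d) - y \<le> (\<integral>\<omega>. grid_queue \<mu> 0 h n \<omega> ^ 2 \<partial>M)"
    using stationary_bounds(2)[OF h(1) e y] unfolding d_def by blast
  moreover have "3 * y = stationary_second_moment \<mu> - c" by (simp add: y_def)
  ultimately have n: "c < (\<integral>\<omega>. grid_queue \<mu> 0 h n \<omega> ^ 2 \<partial>M)" using h(2) by linarith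
  \<comment> \<open>Mesh and number of steps are now fixed; starting the chain at
    \<open>T - n * h\<close> serves all later \<open>T\<close>.\<close>
  show "\<forall>\<^sub>F T in at_top. c < (\<integral>\<omega>. Q \<mu> T \<omega> ^ 2 \<partial>M)"
    using eventually_ge_at_top[of "real n * h"]
  proof eventually_elim
    case (elim T)
    have "0 \<le> real n * h" using h(1) by simp
    then have "integrable M (\<lambda>\<omega>. Q \<mu> T \<omega> ^ 2)" using stable elim by (intro workload_sq_integrable) auto
    then have "(\<integral>\<omega>. grid_queue \<mu> 0 h n \<omega> ^ 2 \<partial>M) \<le> (\<integral>\<omega>. Q \<mu> T \<omega> ^ 2 \<partial>M)"
      using elim h(1) by (intro moment_le_workload[where s = "T - real n * h"]) auto
    then show ?case using n by simp
  qed
qed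

end

end

section \<open>Convexity of the cost\<close>

context levy_queue
begin

text \<open>The excess is at most \<open>q\<close> and vanishes once the net input has fallen below
  \<open>- q\<close>. Large \<open>q\<close> is handled by its truncated second moment; otherwise a
  positive excess forces a deviation of order \<open>T\<close> from the drift, and the variance
  grows only linearly.\<close>

lemma excess_sq_tendsto_0:
  assumes "lam < \<mu>"
  shows "((\<lambda>T. \<integral>\<omega>. (Q \<mu> T \<omega> - V \<mu> T \<omega>) ^ 2 \<partial>M) \<longlongrightarrow> 0) at_top"
proof (rule tendstoI)
  fix e :: real assume "0 < e"
  interpret Z: idle_queue M U lam by (rule idle)
  define d where "d = \<mu> - lam"
  have d: "0 < d" using assms by (simp add: d_def)
  have iq: "integrable M (\<lambda>\<omega>. q \<omega> ^ 2 * indicator {real k<..} (q \<omega>))" for k :: nat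
    by (rule Bochner_Integration.integrable_bound[OF q_sq]) (auto simp: indicator_def)
  have "(\<lambda>k :: nat. \<integral>\<omega>. q \<omega> ^ 2 * indicator {real k<..} (q \<omega>) \<partial>M) \<longlonglongrightarrow> (\<integral>\<omega>. 0 \<partial>M)"
  proof (rule integral_dominated_convergence[OF _ _ q_sq])
    show "AE \<omega> in M. (\<lambda>k :: nat. q \<omega> ^ 2 * indicator {real k<..} (q \<omega>)) \<longlonglongrightarrow> 0"
    proof (rule AE_I2)
      fix \<omega>
      obtain k0 :: nat where k0: "q \<omega> \<le> real k0" using real_arch_simple by blast
      have "\<forall>\<^sub>F k in sequentially. q \<omega> ^ 2 * indicator {real k<..} (q \<omega>) = 0"
        using eventually_ge_at_top[of k0] by eventually_elim (use k0 in \<open>auto simp: indicator_def\<close>)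
      then show "(\<lambda>k :: nat. q \<omega> ^ 2 * indicator {real k<..} (q \<omega>)) \<longlonglongrightarrow> 0" by (rule tendsto_eventually)
    qed
  qed (auto simp: indicator_def)
  then have "\<forall>\<^sub>F k :: nat in sequentially. (\<integral>\<omega>. q \<omega> ^ 2 * indicator {real k<..} (q \<omega>) \<partial>M) < e / 2"
    by (intro order_tendstoD(2)) (use \<open>0 < e\<close> in auto)
  then obtain k :: nat where k: "(\<integral>\<omega>. q \<omega> ^ 2 * indicator {real k<..} (q \<omega>) \<partial>M) < e / 2"
    using eventually_happens'[OF sequentially_bot] by blast
  define K where "K = real k"
  have K: "0 \<le> K" by (simp add: K_def)
  have "((\<lambda>T. K ^ 2 * 4 * v / d ^ 2 * inverse T) \<longlongrightarrow> K ^ 2 * 4 * v / d ^ 2 * 0) at_top"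
    by (intro tendsto_intros tendsto_inverse_0_at_top filterlim_ident)
  then have "\<forall>\<^sub>F T in at_top. K ^ 2 * 4 * v / d ^ 2 * inverse T < e / 2"
    by (rule order_tendstoD(2)) (use \<open>0 < e\<close> in simp)
  then show "\<forall>\<^sub>F T in at_top. dist (\<integral>\<omega>. (Q \<mu> T \<omega> - V \<mu> T \<omega>) ^ 2 \<partial>M) 0 < e"
    using eventually_ge_at_top[of "2 * K / d"] eventually_gt_at_top[of 0]
  proof eventually_elim
    case (elim T)
    have T: "0 \<le> T" "0 < d * T" "K \<le> d * T / 2" using elim d by (auto simp: field_simps)
    have lT: "0 \<le> lam * T" using lam_pos T by simp
    define Y where "Y \<omega> = U (lam * T) \<omega> - lam * T" for \<omega>
    have Y2: "integrable M (\<lambda>\<omega>. Y \<omega> ^ 2)" "(\<integral>\<omega>. Y \<omega> ^ 2 \<partial>M) = v * T"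
      using shifted_power_integrable[OF lT, of 2 "lam * T"] cent_2[OF lT] mean_eq[OF lT]
      by (simp_all add: Y_def cent_def v_def)
    \<comment> \<open>Chosen so that \<open>c * Y^2 \<ge> K^2\<close> whenever
      \<open>Y \<ge> d * T / 2\<close>.\<close>
    define c where "c = K ^ 2 * 4 / (d * T) ^ 2"
    have le: "AE \<omega> in M. (Q \<mu> T \<omega> - V \<mu> T \<omega>) ^ 2 \<le> q \<omega> ^ 2 * indicator {real k<..} (q \<omega>) + c * Y \<omega> ^ 2"
      using AE_good
    proof eventually_elim
      case (elim \<omega>)
      define D where "D = Q \<mu> T \<omega> - V \<mu> T \<omega>"
      note D = excess_bounds[OF elim T(1), of \<mu>, folded D_def]
      have D2: "D ^ 2 \<le> q \<omega> ^ 2" using D by (intro power_mono) auto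
      have c0: "0 \<le> c * Y \<omega> ^ 2" by (simp add: c_def)
      show "D ^ 2 \<le> q \<omega> ^ 2 * indicator {real k<..} (q \<omega>) + c * Y \<omega> ^ 2"
      proof (cases "real k < q \<omega>")
        case True
        then show ?thesis using D2 c0 by simp
      next
        case qK: False
        show ?thesis
        proof (cases "net_input U lam \<mu> T \<omega> \<le> - K")
          case True
          then have "D = 0" using D qK by (simp add: K_def)
          then show ?thesis using c0 by simp
        next
          case False
          have "Y \<omega> = net_input U lam \<mu> T \<omega> + d * T"
            by (simp add: Y_def net_input_def d_def algebra_simps)
          then have "d * T / 2 \<le> Y \<omega>" using False T(3) by linarith
          then have "(d * T / 2) ^ 2 \<le> Y \<omega> ^ 2" using T by (intro power_mono) auto
          then have "c * (d * T / 2) ^ 2 \<le> c * Y \<omega> ^ 2" by (intro mult_left_mono) (auto simp: c_def)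
          moreover have "c * (d * T / 2) ^ 2 = K ^ 2" using T(2) by (auto simp: c_def power_divide)
          moreover have "D ^ 2 \<le> K ^ 2" using D qK by (intro power_mono) (auto simp: K_def)
          ultimately show ?thesis using qK by simp
        qed
      qed
    qed
    have "(\<integral>\<omega>. (Q \<mu> T \<omega> - V \<mu> T \<omega>) ^ 2 \<partial>M) \<le> (\<integral>\<omega>. q \<omega> ^ 2 * indicator {real k<..} (q \<omega>) + c * Y \<omega> ^ 2 \<partial>M)"
    proof (rule integral_mono_AE[OF _ _ le])
      show i: "integrable M (\<lambda>\<omega>. q \<omega> ^ 2 * indicator {real k<..} (q \<omega>) + c * Y \<omega> ^ 2)"
        using iq Y2 by simp
      show "integrable M (\<lambda>\<omega>. (Q \<mu> T \<omega> - V \<mu> T \<omega>) ^ 2)"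
      proof (rule Bochner_Integration.integrable_bound[OF i])
        show "AE \<omega> in M. norm ((Q \<mu> T \<omega> - V \<mu> T \<omega>) ^ 2) \<le> norm (q \<omega> ^ 2 * indicator {real k<..} (q \<omega>) + c * Y \<omega> ^ 2)"
          using le by eventually_elim simp
        show "(\<lambda>\<omega>. (Q \<mu> T \<omega> - V \<mu> T \<omega>) ^ 2) \<in> borel_measurable M"
          by (intro borel_measurable_power borel_measurable_diff workload_measurable Z.workload_measurable T)
      qed
    qed
    also have "\<dots> = (\<integral>\<omega>. q \<omega> ^ 2 * indicator {real k<..} (q \<omega>) \<partial>M) + c * (v * T)"
      using iq Y2 by simp
    also have "c * (v * T) = K ^ 2 * 4 * v / d ^ 2 * inverse T"
      using elim(3) d by (simp add: c_def field_simps power2_eq_square)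
    finally have "(\<integral>\<omega>. (Q \<mu> T \<omega> - V \<mu> T \<omega>) ^ 2 \<partial>M) < e" using k elim(1) by linarith
    then show ?case by (simp add: abs_of_nonneg)
  qed
qed

text \<open>Adding the excess changes the square by at most \<open>(1 + 1 / x)\<close> times its own
  square plus \<open>x\<close> times the square of the empty workload, whose mean is bounded
  uniformly in time.\<close>

lemma second_moment_tendsto:
  assumes sp: "spectrally_positive M U" and "lam < \<mu>"
  shows "((\<lambda>T. \<integral>\<omega>. Q \<mu> T \<omega> ^ 2 \<partial>M) \<longlongrightarrow> stationary_second_moment \<mu>) at_top"
proof -
  interpret Z: idle_queue M U lam by (rule idle)
  have le: "lam \<le> \<mu>" using assms by simp
  define m where "m = \<bar>stationary_second_moment \<mu>\<bar>"
  have "((\<lambda>T. (\<integral>\<omega>. Q \<mu> T \<omega> ^ 2 \<partial>M) - (\<integral>\<omega>. V \<mu> T \<omega> ^ 2 \<partial>M)) \<longlongrightarrow> 0) at_top"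
  proof (rule tendstoI)
    fix e :: real assume "0 < e"
    define x where "x = e / (2 * (m + 1))"
    have x: "0 < x" "x * m < e / 2" using \<open>0 < e\<close> by (auto simp: x_def m_def field_simps)
    have "((\<lambda>T. (1 + 1 / x) * (\<integral>\<omega>. (Q \<mu> T \<omega> - V \<mu> T \<omega>) ^ 2 \<partial>M)) \<longlongrightarrow> (1 + 1 / x) * 0) at_top"
      by (intro tendsto_mult_left excess_sq_tendsto_0 assms)
    then have "\<forall>\<^sub>F T in at_top. (1 + 1 / x) * (\<integral>\<omega>. (Q \<mu> T \<omega> - V \<mu> T \<omega>) ^ 2 \<partial>M) < e / 2"
      by (rule order_tendstoD(2)) (use \<open>0 < e\<close> in simp)
    then show "\<forall>\<^sub>F T in at_top. dist ((\<integral>\<omega>. Q \<mu> T \<omega> ^ 2 \<partial>M) - (\<integral>\<omega>. V \<mu> T \<omega> ^ 2 \<partial>M)) 0 < e"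
      using eventually_gt_at_top[of 0]
    proof eventually_elim
      case (elim T)
      have T: "0 \<le> T" using elim by simp
      have iQ: "integrable M (\<lambda>\<omega>. Q \<mu> T \<omega> ^ 2)" and iV: "integrable M (\<lambda>\<omega>. V \<mu> T \<omega> ^ 2)"
        using workload_sq_integrable[OF le T] Z.workload_sq_integrable[OF le T] by auto
      have iD: "integrable M (\<lambda>\<omega>. (Q \<mu> T \<omega> - V \<mu> T \<omega>) ^ 2)"
      proof (rule Bochner_Integration.integrable_bound[OF q_sq])
        show "AE \<omega> in M. norm ((Q \<mu> T \<omega> - V \<mu> T \<omega>) ^ 2) \<le> norm (q \<omega> ^ 2)"
          using AE_good
        proof eventually_elim
          case (elim \<omega>)
          show ?case using excess_bounds(1,2)[OF elim T, of \<mu>] by (simp add: power_mono)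
        qed
        show "(\<lambda>\<omega>. (Q \<mu> T \<omega> - V \<mu> T \<omega>) ^ 2) \<in> borel_measurable M"
          by (intro borel_measurable_power borel_measurable_diff workload_measurable Z.workload_measurable T)
      qed
      have upper: "Q \<mu> T \<omega> ^ 2 \<le> V \<mu> T \<omega> ^ 2 + ((1 + 1 / x) * (Q \<mu> T \<omega> - V \<mu> T \<omega>) ^ 2 + x * V \<mu> T \<omega> ^ 2)" for \<omega>
      proof -
        define D where "D = Q \<mu> T \<omega> - V \<mu> T \<omega>"
        have QD: "Q \<mu> T \<omega> = V \<mu> T \<omega> + D" by (simp add: D_def)
        have "0 \<le> (D - x * V \<mu> T \<omega>) ^ 2 / x" using x by simp
        also have "(D - x * V \<mu> T \<omega>) ^ 2 / x = D ^ 2 / x + x * V \<mu> T \<omega> ^ 2 - 2 * D * V \<mu> T \<omega>"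
          using x by (simp add: field_simps power2_eq_square)
        finally show ?thesis unfolding D_def[symmetric] unfolding QD by (simp add: algebra_simps power2_eq_square)
      qed
      have lower: "AE \<omega> in M. V \<mu> T \<omega> ^ 2 \<le> Q \<mu> T \<omega> ^ 2"
        using AE_good
      proof eventually_elim
        case (elim \<omega>)
        then show ?case using excess_bounds(1)[OF elim T, of \<mu>] workload_nonneg[of \<omega> T "\<lambda>_. 0" \<mu>] T
          by (intro power_mono) (auto simp: good_def)
      qed
      have "(\<integral>\<omega>. V \<mu> T \<omega> ^ 2 \<partial>M) \<le> (\<integral>\<omega>. Q \<mu> T \<omega> ^ 2 \<partial>M)" by (rule integral_mono_AE[OF iV iQ lower])
      moreover have "(\<integral>\<omega>. Q \<mu> T \<omega> ^ 2 \<partial>M) \<le> (\<integral>\<omega>. V \<mu> T \<omega> ^ 2 + ((1 + 1 / x) * (Q \<mu> T \<omega> - V \<mu> T \<omega>) ^ 2 + x * V \<mu> T \<omega> ^ 2) \<partial>M)"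
        using iQ iV iD by (intro integral_mono upper) auto
      moreover have "\<dots> = (\<integral>\<omega>. V \<mu> T \<omega> ^ 2 \<partial>M) + ((1 + 1 / x) * (\<integral>\<omega>. (Q \<mu> T \<omega> - V \<mu> T \<omega>) ^ 2 \<partial>M) + x * (\<integral>\<omega>. V \<mu> T \<omega> ^ 2 \<partial>M))"
        using iV iD by simp
      moreover have "x * (\<integral>\<omega>. V \<mu> T \<omega> ^ 2 \<partial>M) \<le> x * m"
        using Z.second_moment_le_stationary[OF sp assms(2) elim(2)] x by (intro mult_left_mono) (auto simp: m_def)
      ultimately show ?case using elim(1) x(2) unfolding dist_real_def by linarith
    qed
  qed
  from tendsto_add[OF this Z.second_moment_tendsto[OF sp assms(2)]] show ?thesis by simp
qed

text \<open>The cost is a Lebesgue integral and the grid limit a gauge integral. Bridging them takes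
  Borel measurability of the mean workload, available for a difference of monotone
  functions.\<close>

lemma mean_set_integrable: "set_integrable lborel {0..T} (\<lambda>t. \<integral>\<omega>. Q \<mu> t \<omega> \<partial>M)"
proof -
  interpret Z: idle_queue M U lam by (rule idle)
  let ?f = "\<lambda>t. indicator {0..T} t *\<^sub>R (\<integral>\<omega>. Q \<mu> t \<omega> \<partial>M)"
  \<comment> \<open>Freezing the value at negative times makes the function monotone on the whole
    line.\<close>
  define a where "a t = (\<integral>\<omega>. V \<mu> (max 0 t) \<omega> \<partial>M)" for t
  define b where "b t = (\<integral>\<omega>. V \<mu> (max 0 t) \<omega> \<partial>M) - (\<integral>\<omega>. Q \<mu> (max 0 t) \<omega> \<partial>M)" for t
  have "mono a" unfolding a_def by (intro monoI Z.mean_mono) auto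
  moreover have "mono b" unfolding b_def by (intro monoI excess_mean_antimono) auto
  ultimately have [measurable]: "a \<in> borel_measurable borel" "b \<in> borel_measurable borel"
    by (auto intro: borel_measurable_mono)
  have "?f = (\<lambda>t. indicator {0..T} t *\<^sub>R (a t - b t))"
    by (auto simp: a_def b_def fun_eq_iff indicator_def)
  then have meas: "?f \<in> borel_measurable lborel" by simp
  have "(\<lambda>t. \<integral>\<omega>. Q \<mu> t \<omega> \<partial>M) absolutely_integrable_on {0..T}"
    by (intro nonnegative_absolutely_integrable_1 workload_mean_integrable_on integral_nonneg_AE AE_I2 workload_nonneg) auto
  then have "integrable lebesgue ?f" by (simp add: set_integrable_def)
  then show ?thesis using integrable_completion[OF meas] by (simp add: set_integrable_def)
qed

abbreviation "cost \<equiv> finite_horizon_cost M U q lam"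

lemma cost_eq: "cost \<alpha> T \<mu> = 1 / T * integral {0..T} (\<lambda>t. \<integral>\<omega>. Q \<mu> t \<omega> \<partial>M) + \<alpha> * \<mu>"
  unfolding finite_horizon_cost_def using set_borel_integral_eq_integral(2)[OF mean_set_integrable] by simp

lemma workload_convex:
  assumes \<omega>: "\<omega> \<in> space M" and t: "0 \<le> t" and u: "0 \<le> u" "u \<le> 1"
  shows "Q ((1 - u) * \<mu> + u * \<mu>') t \<omega> \<le> (1 - u) * Q \<mu> t \<omega> + u * Q \<mu>' t \<omega>"
proof -
  let ?f = "\<lambda>\<mu> t. net_input U lam \<mu> t \<omega>"
  let ?m = "(1 - u) * \<mu> + u * \<mu>'"
  have aff: "?f ?m s = (1 - u) * ?f \<mu> s + u * ?f \<mu>' s" for s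
    by (simp add: net_input_def algebra_simps)
  have 1: "q \<omega> + ?f \<mu> t \<le> Q \<mu> t \<omega>" for \<mu> by (simp add: workload_def)
  have 2: "?f \<mu> t - ?f \<mu> s \<le> Q \<mu> t \<omega>" if "s \<in> {0..t}" for \<mu> s
    unfolding workload_def using that
    by (intro max.coboundedI2 cSUP_upper cadlag_bdd_above net_cadlag \<omega> t)
  have conv: "(1 - u) * x + u * y \<le> (1 - u) * Q \<mu> t \<omega> + u * Q \<mu>' t \<omega>" if "x \<le> Q \<mu> t \<omega>" "y \<le> Q \<mu>' t \<omega>" for x y
    using that u by (intro add_mono mult_left_mono) auto
  have "q \<omega> + ?f ?m t \<le> (1 - u) * Q \<mu> t \<omega> + u * Q \<mu>' t \<omega>"
    using conv[OF 1 1] unfolding aff by (simp add: algebra_simps)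
  moreover have "(SUP s\<in>{0..t}. ?f ?m t - ?f ?m s) \<le> (1 - u) * Q \<mu> t \<omega> + u * Q \<mu>' t \<omega>"
  proof (rule cSUP_least)
    fix s assume s: "s \<in> {0..t}"
    show "?f ?m t - ?f ?m s \<le> (1 - u) * Q \<mu> t \<omega> + u * Q \<mu>' t \<omega>"
      using conv[OF 2[OF s] 2[OF s]] unfolding aff by (simp add: algebra_simps)
  qed (use t in simp)
  ultimately show ?thesis by (subst workload_def) simp
qed

lemma mean_convex:
  assumes t: "0 \<le> t" and u: "0 \<le> u" "u \<le> 1"
  shows "(\<integral>\<omega>. Q ((1 - u) * \<mu> + u * \<mu>') t \<omega> \<partial>M) \<le> (1 - u) * (\<integral>\<omega>. Q \<mu> t \<omega> \<partial>M) + u * (\<integral>\<omega>. Q \<mu>' t \<omega> \<partial>M)"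
proof -
  note i = workload_integrable[OF t]
  have "(\<integral>\<omega>. Q ((1 - u) * \<mu> + u * \<mu>') t \<omega> \<partial>M) \<le> (\<integral>\<omega>. (1 - u) * Q \<mu> t \<omega> + u * Q \<mu>' t \<omega> \<partial>M)"
    using i by (intro integral_mono workload_convex t u) auto
  also have "\<dots> = (1 - u) * (\<integral>\<omega>. Q \<mu> t \<omega> \<partial>M) + u * (\<integral>\<omega>. Q \<mu>' t \<omega> \<partial>M)"
    using i by simp
  finally show ?thesis .
qed

lemma cost_convex:
  assumes "0 < T"
  shows "convex_on UNIV (cost \<alpha> T)"
proof (rule convex_onI)
  fix u \<mu> \<mu>' :: real assume u: "0 < u" "u < 1"
  let ?m = "(1 - u) * \<mu> + u * \<mu>'"
  note i = workload_mean_integrable_on[of _ T]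
  have "integral {0..T} (\<lambda>t. \<integral>\<omega>. Q ?m t \<omega> \<partial>M) \<le>
      integral {0..T} (\<lambda>t. (1 - u) * (\<integral>\<omega>. Q \<mu> t \<omega> \<partial>M) + u * (\<integral>\<omega>. Q \<mu>' t \<omega> \<partial>M))"
    using u by (intro integral_le i integrable_add integrable_on_mult_right mean_convex) auto
  also have "\<dots> = (1 - u) * integral {0..T} (\<lambda>t. \<integral>\<omega>. Q \<mu> t \<omega> \<partial>M) + u * integral {0..T} (\<lambda>t. \<integral>\<omega>. Q \<mu>' t \<omega> \<partial>M)"
    by (subst Henstock_Kurzweil_Integration.integral_add) (auto intro: integrable_on_mult_right i)
  finally have "1 / T * integral {0..T} (\<lambda>t. \<integral>\<omega>. Q ?m t \<omega> \<partial>M) \<le>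
      1 / T * ((1 - u) * integral {0..T} (\<lambda>t. \<integral>\<omega>. Q \<mu> t \<omega> \<partial>M) + u * integral {0..T} (\<lambda>t. \<integral>\<omega>. Q \<mu>' t \<omega> \<partial>M))"
    using assms by (intro mult_left_mono) auto
  moreover have "1 / T * ((1 - u) * x + u * y) + \<alpha> * ?m = (1 - u) * (1 / T * x + \<alpha> * \<mu>) + u * (1 / T * y + \<alpha> * \<mu>')" for x y
    by (simp add: algebra_simps add_divide_distrib diff_divide_distrib)
  ultimately show "cost \<alpha> T ((1 - u) *\<^sub>R \<mu> + u *\<^sub>R \<mu>') \<le> (1 - u) * cost \<alpha> T \<mu> + u * cost \<alpha> T \<mu>'"
    unfolding cost_eq real_scaleR_def by (metis add_right_mono)
qed simp

lemma second_moment_convex: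
  assumes "0 < T"
  shows "convex_on {lam<..} (\<lambda>\<mu>. \<integral>\<omega>. Q \<mu> T \<omega> ^ 2 \<partial>M)"
proof (rule convex_onI)
  fix u \<mu> \<mu>' :: real assume u: "0 < u" "u < 1" and \<mu>: "\<mu> \<in> {lam<..}" "\<mu>' \<in> {lam<..}"
  let ?m = "(1 - u) * \<mu> + u * \<mu>'"
  have T: "0 \<le> T" using assms by simp
  have "(1 - u) * lam + u * lam \<le> ?m" using u \<mu> by (intro add_mono mult_left_mono) auto
  then have m: "lam \<le> ?m" by (simp add: algebra_simps)
  have sq: "((1 - u) * x + u * y) ^ 2 \<le> (1 - u) * x ^ 2 + u * y ^ 2" for x y :: real
  proof -
    have "(1 - u) * x ^ 2 + u * y ^ 2 - ((1 - u) * x + u * y) ^ 2 = u * (1 - u) * (x - y) ^ 2"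
      by (simp add: power2_eq_square algebra_simps)
    also have "0 \<le> \<dots>" using u by simp
    finally show ?thesis by simp
  qed
  have "(\<integral>\<omega>. Q ?m T \<omega> ^ 2 \<partial>M) \<le> (\<integral>\<omega>. (1 - u) * Q \<mu> T \<omega> ^ 2 + u * Q \<mu>' T \<omega> ^ 2 \<partial>M)"
  proof (rule integral_mono)
    fix \<omega> assume \<omega>: "\<omega> \<in> space M"
    have "Q ?m T \<omega> ^ 2 \<le> ((1 - u) * Q \<mu> T \<omega> + u * Q \<mu>' T \<omega>) ^ 2"
      using workload_nonneg[OF \<omega> T] u by (intro power_mono workload_convex[OF \<omega> T]) auto
    then show "Q ?m T \<omega> ^ 2 \<le> (1 - u) * Q \<mu> T \<omega> ^ 2 + u * Q \<mu>' T \<omega> ^ 2" using sq by (rule order_trans)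
  qed (use workload_sq_integrable[OF m T] workload_sq_integrable[of \<mu> T] workload_sq_integrable[of \<mu>' T] \<mu> T in auto)
  also have "\<dots> = (1 - u) * (\<integral>\<omega>. Q \<mu> T \<omega> ^ 2 \<partial>M) + u * (\<integral>\<omega>. Q \<mu>' T \<omega> ^ 2 \<partial>M)"
    using workload_sq_integrable[of \<mu> T] workload_sq_integrable[of \<mu>' T] \<mu> T by simp
  finally show "(\<integral>\<omega>. Q ((1 - u) *\<^sub>R \<mu> + u *\<^sub>R \<mu>') T \<omega> ^ 2 \<partial>M) \<le>
      (1 - u) * (\<integral>\<omega>. Q \<mu> T \<omega> ^ 2 \<partial>M) + u * (\<integral>\<omega>. Q \<mu>' T \<omega> ^ 2 \<partial>M)" by simp
qed simp

text \<open>The cost is at least \<open>\<alpha> * \<mu>\<close>, so speeds above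
  \<open>cost \<alpha> T 0 / \<alpha>\<close> cannot beat speed 0. Continuity up to the boundary
  point 0 comes from convexity on the open set of all reals.\<close>

lemma cost_minimizer_exists:
  assumes "0 < T" "0 < \<alpha>"
  shows "\<exists>\<mu>. is_arg_min (cost \<alpha> T) (\<lambda>\<mu>. 0 \<le> \<mu>) \<mu>"
proof -
  have cont: "continuous_on UNIV (cost \<alpha> T)"
    by (rule convex_on_continuous[OF open_UNIV cost_convex[OF assms(1)]])
  have ge: "\<alpha> * \<mu> \<le> cost \<alpha> T \<mu>" for \<mu>
  proof -
    have "0 \<le> integral {0..T} (\<lambda>t. \<integral>\<omega>. Q \<mu> t \<omega> \<partial>M)"
      by (intro Henstock_Kurzweil_Integration.integral_nonneg workload_mean_integrable_on integral_nonneg_AE AE_I2 workload_nonneg) auto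
    then show ?thesis using assms by (simp add: cost_eq)
  qed
  define B where "B = cost \<alpha> T 0 / \<alpha>"
  have B: "0 \<le> B" using ge[of 0] assms by (simp add: B_def)
  have "compact {0..B}" "{0..B} \<noteq> {}" "continuous_on {0..B} (cost \<alpha> T)"
    using B cont by (auto intro: continuous_on_subset)
  then obtain \<mu> where \<mu>: "\<mu> \<in> {0..B}" "\<And>y. y \<in> {0..B} \<Longrightarrow> cost \<alpha> T \<mu> \<le> cost \<alpha> T y"
    using continuous_attains_inf[of "{0..B}" "cost \<alpha> T"] by blast
  have "cost \<alpha> T \<mu> \<le> cost \<alpha> T y" if "0 \<le> y" for y
  proof (cases "y \<le> B")
    case True
    then show ?thesis using \<mu>(2) that by simp
  next
    case False
    have "cost \<alpha> T \<mu> \<le> cost \<alpha> T 0" using \<mu>(2) B by simp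
    also have "\<dots> = \<alpha> * B" using assms by (simp add: B_def)
    also have "\<dots> \<le> \<alpha> * y" using False assms by (intro mult_left_mono) auto
    also have "\<dots> \<le> cost \<alpha> T y" by (rule ge)
    finally show ?thesis .
  qed
  then show ?thesis using \<mu>(1) by (intro exI[of _ \<mu>]) (auto simp: is_arg_min_def not_less)
qed

end

section \<open>Expansion of the minimizer\<close>

lemma stationary_cost_argmin:
  assumes "0 < \<alpha>" "0 < lam" "0 < u2"
  shows "is_arg_min (stationary_cost lam \<alpha> u2) (\<lambda>\<mu>. lam < \<mu>) (mu_infinity lam \<alpha> u2)"
proof -
  define d where "d = sqrt (lam * u2 / (2 * \<alpha>))"
  have d: "0 < d" using assms by (simp add: d_def)
  have "d ^ 2 = lam * u2 / (2 * \<alpha>)" using assms by (simp add: d_def)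
  then have u: "lam * u2 = 2 * \<alpha> * d ^ 2" using assms by (simp add: field_simps)
  have "stationary_cost lam \<alpha> u2 (lam + d) \<le> stationary_cost lam \<alpha> u2 \<mu>" if "lam < \<mu>" for \<mu>
  proof -
    define z where "z = \<mu> - lam"
    have z: "0 < z" "\<mu> = lam + z" using that by (auto simp: z_def)
    \<comment> \<open>Completing the square: this quotient is exactly the gap between the two
      costs.\<close>
    have "0 \<le> \<alpha> * (z - d) ^ 2 / z" using z assms by simp
    also have "\<alpha> * (z - d) ^ 2 / z = stationary_cost lam \<alpha> u2 \<mu> - stationary_cost lam \<alpha> u2 (lam + d)"
      unfolding stationary_cost_def u z(2) using z(1) d by (simp add: field_simps power2_eq_square)
    finally show ?thesis by simp
  qed
  then have "\<not> stationary_cost lam \<alpha> u2 \<mu> < stationary_cost lam \<alpha> u2 (lam + d)" if "lam < \<mu>" for \<mu>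
    using that by (simp add: not_less)
  moreover have "mu_infinity lam \<alpha> u2 = lam + d" by (simp add: mu_infinity_def d_def)
  ultimately show ?thesis using d by (auto simp: is_arg_min_def)
qed

context levy_queue
begin

lemma scaled_cost:
  assumes sp: "spectrally_positive M U" and "0 < T" "lam < \<mu>"
  shows "T * cost \<alpha> T \<mu> = T * (v / (2 * (\<mu> - lam)) + \<alpha> * \<mu>)
    + ((\<integral>\<omega>. q \<omega> ^ 2 \<partial>M) - (\<integral>\<omega>. Q \<mu> T \<omega> ^ 2 \<partial>M)) / (2 * (\<mu> - lam))"
proof -
  define I where "I = integral {0..T} (\<lambda>t. \<integral>\<omega>. Q \<mu> t \<omega> \<partial>M)"
  define z where "z = \<mu> - lam"
  have z: "0 < z" using assms by (simp add: z_def)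
  have "(\<integral>\<omega>. q \<omega> ^ 2 \<partial>M) - (\<integral>\<omega>. Q \<mu> T \<omega> ^ 2 \<partial>M) = 2 * z * I - v * T"
    using workload_sq_identity[OF sp assms(3,2)] by (simp add: I_def z_def)
  moreover have "T * (v / (2 * z)) + (2 * z * I - v * T) / (2 * z) = I" using z by (simp add: field_simps)
  moreover have "T * cost \<alpha> T \<mu> = I + T * (\<alpha> * \<mu>)"
    unfolding cost_eq I_def[symmetric] using assms(2) by (simp add: distrib_left)
  ultimately show ?thesis unfolding z_def[symmetric] by (simp add: distrib_left)
qed

text \<open>The linear coefficient collects the derivative at \<open>lam + \<delta>\<close> of the first-order correction
  \<open>(E Q(0)^2 - E Q(\<infinity>)^2) / (2 (\<mu> - lam))\<close> of the scaled cost.\<close>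

definition slope :: "real \<Rightarrow> real" where
  "slope \<delta> = (\<integral>\<omega>. q \<omega> ^ 2 \<partial>M) / (2 * \<delta> ^ 2) - w / (3 * \<delta> ^ 3) - 3 * v ^ 2 / (4 * \<delta> ^ 4)"

context
  fixes \<alpha> \<delta> :: real
  assumes sp: "spectrally_positive M U" and \<alpha>: "0 < \<alpha>" and \<delta>: "0 < \<delta>" and v_eq: "v = 2 * \<alpha> * \<delta> ^ 2"
begin

text \<open>At distance \<open>y / T\<close> the stationary cost, stationary at
  \<open>\<delta>\<close>, contributes the quadratic term. The linear term combines the difference
  quotient of the second moment with the change of the prefactor
  \<open>1 / (2 * (\<mu> - lam))\<close>.\<close>

lemma rescaled_cost_tendsto:
  "((\<lambda>T. T * (T * cost \<alpha> T (lam + \<delta> + y / T) - T * cost \<alpha> T (lam + \<delta>))) \<longlongrightarrow> \<alpha> / \<delta> * y ^ 2 - slope \<delta> * y) at_top"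
proof -
  define F where "F T \<mu> = (\<integral>\<omega>. Q \<mu> T \<omega> ^ 2 \<partial>M)" for T \<mu>
  define q2 where "q2 = (\<integral>\<omega>. q \<omega> ^ 2 \<partial>M)"
  define D where "D = - (w / (3 * \<delta> ^ 2)) - v ^ 2 / \<delta> ^ 3"
  have der: "(stationary_second_moment has_real_derivative D) (at (lam + \<delta>))"
  proof -
    have "((\<lambda>\<mu>. w / (3 * (\<mu> - lam)) + v ^ 2 / (2 * (\<mu> - lam) ^ 2)) has_real_derivative D) (at (lam + \<delta>))"
      using \<delta> by (auto intro!: derivative_eq_intros simp: D_def field_simps power2_eq_square power3_eq_cube)
    then show ?thesis by (simp add: stationary_second_moment_def[abs_def])
  qed
  have F_lim: "((\<lambda>T. F T z) \<longlongrightarrow> stationary_second_moment z) at_top" if "lam < z" for z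
    unfolding F_def by (rule second_moment_tendsto[OF sp that])
  have dq: "((\<lambda>T. T * (F T (lam + \<delta> + y / T) - F T (lam + \<delta>))) \<longlongrightarrow> D * y) at_top"
  proof (rule convex_difference_quotient_tendsto[OF _ _ F_lim der])
    show "convex_on {lam<..} (F T)" if "0 < T" for T unfolding F_def by (rule second_moment_convex[OF that])
  qed (use \<delta> in auto)
  have inv: "((\<lambda>T. y / T) \<longlongrightarrow> 0) at_top"
    by (rule real_tendsto_divide_at_top[OF tendsto_const filterlim_ident])
  have lim: "((\<lambda>T. \<alpha> * y ^ 2 / (\<delta> + y / T) - T * (F T (lam + \<delta> + y / T) - F T (lam + \<delta>)) / (2 * (\<delta> + y / T))
      - (q2 - F T (lam + \<delta>)) * y / (2 * \<delta> * (\<delta> + y / T))) \<longlongrightarrow>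
      \<alpha> * y ^ 2 / (\<delta> + 0) - D * y / (2 * (\<delta> + 0)) - (q2 - stationary_second_moment (lam + \<delta>)) * y / (2 * \<delta> * (\<delta> + 0))) at_top"
    using \<delta> by (intro tendsto_intros dq inv F_lim) auto
  have eq: "\<alpha> * y ^ 2 / (\<delta> + 0) - D * y / (2 * (\<delta> + 0)) - (q2 - stationary_second_moment (lam + \<delta>)) * y / (2 * \<delta> * (\<delta> + 0))
      = \<alpha> / \<delta> * y ^ 2 - slope \<delta> * y"
    using \<delta> unfolding D_def stationary_second_moment_def slope_def q2_def[symmetric]
    by (simp add: field_simps power2_eq_square power3_eq_cube power4_eq_xxxx)
  have ev: "\<forall>\<^sub>F T in at_top. \<alpha> * y ^ 2 / (\<delta> + y / T) - T * (F T (lam + \<delta> + y / T) - F T (lam + \<delta>)) / (2 * (\<delta> + y / T))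
      - (q2 - F T (lam + \<delta>)) * y / (2 * \<delta> * (\<delta> + y / T)) =
      T * (T * cost \<alpha> T (lam + \<delta> + y / T) - T * cost \<alpha> T (lam + \<delta>))"
  proof -
    have "\<forall>\<^sub>F T in at_top. - \<delta> < y / T" using inv by (rule order_tendstoD(1)) (use \<delta> in simp)
    then show ?thesis
      using eventually_gt_at_top[of 0]
    proof eventually_elim
      case (elim T)
      define z where "z = y / T"
      define A where "A = F T (lam + \<delta> + z)"
      define B where "B = F T (lam + \<delta>)"
      have z: "0 < \<delta> + z" "y = z * T" using elim by (auto simp: z_def)
      have c1: "T * cost \<alpha> T (lam + \<delta> + z) = T * (v / (2 * (\<delta> + z)) + \<alpha> * (lam + \<delta> + z)) + (q2 - A) / (2 * (\<delta> + z))"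
        using scaled_cost[OF sp elim(2), of "lam + \<delta> + z" \<alpha>] z by (simp add: A_def F_def q2_def)
      have c2: "T * cost \<alpha> T (lam + \<delta>) = T * (v / (2 * \<delta>) + \<alpha> * (lam + \<delta>)) + (q2 - B) / (2 * \<delta>)"
        using scaled_cost[OF sp elim(2), of "lam + \<delta>" \<alpha>] \<delta> by (simp add: B_def F_def q2_def)
      \<comment> \<open>The relation \<open>v = 2 * \<alpha> * \<delta> ^ 2\<close> cancels the
        terms linear in \<open>z\<close>.\<close>
      have k: "T * (\<alpha> * (lam + \<delta> + z) + v / (2 * (\<delta> + z))) - T * (\<alpha> * (lam + \<delta>) + v / (2 * \<delta>)) = T * (\<alpha> * z ^ 2 / (\<delta> + z))"
      proof -
        define s where "s = \<delta> + z"
        have s: "0 < s" "z = s - \<delta>" using z by (simp_all add: s_def)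
        show ?thesis unfolding v_eq s(2) using s(1) \<delta> by (simp add: field_simps power2_eq_square)
      qed
      have l: "(q2 - A) / (2 * (\<delta> + z)) - (q2 - B) / (2 * \<delta>) = - ((A - B) / (2 * (\<delta> + z))) - (q2 - B) * z / (2 * \<delta> * (\<delta> + z))"
      proof -
        define s where "s = \<delta> + z"
        have s: "0 < s" "z = s - \<delta>" using z by (simp_all add: s_def)
        show ?thesis unfolding s(2) using s(1) \<delta> by (simp add: field_simps)
      qed
      have "T * cost \<alpha> T (lam + \<delta> + z) - T * cost \<alpha> T (lam + \<delta>) =
          T * (\<alpha> * z ^ 2 / (\<delta> + z)) - (A - B) / (2 * (\<delta> + z)) - (q2 - B) * z / (2 * \<delta> * (\<delta> + z))"
        using c1 c2 k l by (simp add: algebra_simps)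
      then have "T * (T * cost \<alpha> T (lam + \<delta> + z) - T * cost \<alpha> T (lam + \<delta>)) =
          T * (T * (\<alpha> * z ^ 2 / (\<delta> + z)) - (A - B) / (2 * (\<delta> + z)) - (q2 - B) * z / (2 * \<delta> * (\<delta> + z)))"
        by simp
      also have "\<dots> = \<alpha> * y ^ 2 / (\<delta> + z) - T * (A - B) / (2 * (\<delta> + z)) - (q2 - B) * y / (2 * \<delta> * (\<delta> + z))"
        unfolding z(2) by (simp add: right_diff_distrib power_mult_distrib power2_eq_square ac_simps)
      finally show ?case unfolding z_def[symmetric] A_def B_def by simp
    qed
  qed
  show ?thesis using Lim_transform_eventually[OF lim ev] unfolding eq .
qed

text \<open>Here \<open>y\<close> minimizes the limiting parabola. Eventually the cost at
  \<open>y / T\<close> is below its values at \<open>(y - \<epsilon>) / T\<close> and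
  \<open>(y + \<epsilon>) / T\<close>, and convexity traps every minimizer between them; convergence
  at three points is enough.\<close>

lemma minimizer_expansion:
  assumes min: "\<And>T. 0 < T \<Longrightarrow> is_arg_min (cost \<alpha> T) (\<lambda>\<mu>. 0 \<le> \<mu>) (m T)" and "0 < \<epsilon>"
  shows "\<forall>\<^sub>F T in at_top. \<bar>m T - (lam + \<delta> + slope \<delta> * \<delta> / (2 * \<alpha>) / T)\<bar> \<le> \<epsilon> / T"
proof -
  define y where "y = slope \<delta> * \<delta> / (2 * \<alpha>)"
  define \<Psi> where "\<Psi> T y = T * (T * cost \<alpha> T (lam + \<delta> + y / T) - T * cost \<alpha> T (lam + \<delta>))" for T y
  define P where "P y = \<alpha> / \<delta> * y ^ 2 - slope \<delta> * y" for y
  have P: "(\<Psi> x y' - \<Psi> x y'' = x ^ 2 * (cost \<alpha> x (lam + \<delta> + y' / x) - cost \<alpha> x (lam + \<delta> + y'' / x)))" for x y' y''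
    by (simp add: \<Psi>_def power2_eq_square algebra_simps)
  have slope: "slope \<delta> = 2 * \<alpha> * y / \<delta>" using \<alpha> \<delta> by (simp add: y_def)
  have gap: "P (y + e) - P y = \<alpha> / \<delta> * e ^ 2" for e
    unfolding P_def slope using \<delta> by (simp add: field_simps power2_eq_square)
  have ev: "\<forall>\<^sub>F T in at_top. cost \<alpha> T (lam + \<delta> + y / T) < cost \<alpha> T (lam + \<delta> + (y + e) / T)" if "e \<noteq> 0" for e
  proof -
    have "((\<lambda>T. \<Psi> T (y + e) - \<Psi> T y) \<longlongrightarrow> P (y + e) - P y) at_top"
      unfolding \<Psi>_def P_def by (intro tendsto_diff rescaled_cost_tendsto)
    moreover have "0 < P (y + e) - P y" unfolding gap using that \<alpha> \<delta> by simp
    ultimately have "\<forall>\<^sub>F T in at_top. 0 < \<Psi> T (y + e) - \<Psi> T y" by (rule order_tendstoD(1))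
    then show ?thesis
      using eventually_gt_at_top[of 0]
      by eventually_elim (simp add: P zero_less_mult_iff)
  qed
  have inv: "((\<lambda>T. (y + e) / T) \<longlongrightarrow> 0) at_top" for e :: real
    by (rule real_tendsto_divide_at_top[OF tendsto_const filterlim_ident])
  \<comment> \<open>Keeps the left comparison point above \<open>lam\<close>, hence among the
    admissible speeds.\<close>
  have "\<forall>\<^sub>F T in at_top. - \<delta> < (y + - \<epsilon>) / T" using inv by (rule order_tendstoD(1)) (use \<delta> in simp)
  moreover have "\<forall>\<^sub>F T in at_top. cost \<alpha> T (lam + \<delta> + y / T) < cost \<alpha> T (lam + \<delta> + (y + - \<epsilon>) / T)"
    by (rule ev) (use \<open>0 < \<epsilon>\<close> in simp)
  moreover have "\<forall>\<^sub>F T in at_top. cost \<alpha> T (lam + \<delta> + y / T) < cost \<alpha> T (lam + \<delta> + (y + \<epsilon>) / T)"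
    by (rule ev) (use \<open>0 < \<epsilon>\<close> in simp)
  ultimately show ?thesis
    using eventually_gt_at_top[of 0]
  proof eventually_elim
    case (elim T)
    have lt: "(y + - \<epsilon>) / T < y / T" "y / T < (y + \<epsilon>) / T"
      using elim(4) \<open>0 < \<epsilon>\<close> by (simp_all add: divide_strict_right_mono)
    have mT: "0 \<le> m T" "\<And>x. 0 \<le> x \<Longrightarrow> cost \<alpha> T (m T) \<le> cost \<alpha> T x"
      using min[OF elim(4)] by (auto simp: is_arg_min_def not_less)
    have cvx: "convex_on {0..} (cost \<alpha> T)" by (rule convex_on_subset[OF cost_convex[OF elim(4)]]) auto
    have pos: "0 \<le> lam + \<delta> + (y + - \<epsilon>) / T" "0 \<le> lam + \<delta> + (y + \<epsilon>) / T" using elim(1) lt lam_pos by linarith+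
    have "lam + \<delta> + (y + - \<epsilon>) / T < m T" "m T < lam + \<delta> + (y + \<epsilon>) / T"
      using convex_minimizer_between[OF cvx, of "lam + \<delta> + (y + - \<epsilon>) / T" "lam + \<delta> + (y + \<epsilon>) / T" "m T" "lam + \<delta> + y / T"]
        pos mT lt elim(2,3) by auto
    then show ?case unfolding y_def[symmetric] by (simp add: abs_le_iff add_divide_distrib diff_divide_distrib)
  qed
qed

end

end

text \<open>The expansion is claimed for every selection of minimizers, and existence is included so
  that the claim is not vacuous. For \<open>u2 = 0\<close> the stationary optimum would leave the
  open half-line and \<open>mu_bullet\<close> would divide by 0, hence the positivity
  assumption.\<close>

theorem proposition3:
  fixes M :: "'a measure"
    and U :: "real \<Rightarrow> 'a \<Rightarrow> real"
    and Q0 :: "'a \<Rightarrow> real"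
    and lam \<alpha> u2 u3 :: real
  assumes "lam > 0" and "\<alpha> > 0"
    and "levy_process M U"
    and "spectrally_positive M U"
    and "integrable M (U 1)" and "(\<integral>\<omega>. U 1 \<omega> \<partial>M) = 1"
    and "integrable M (\<lambda>\<omega>. (U 1 \<omega> - (\<integral>\<omega>'. U 1 \<omega>' \<partial>M)) ^ 2)"
    and "integrable M (\<lambda>\<omega>. (U 1 \<omega> - (\<integral>\<omega>'. U 1 \<omega>' \<partial>M)) ^ 3)"
    and "u2 = central_moment M (U 1) 2" and "u3 = central_moment M (U 1) 3"
    and "u2 > 0"
    and "Q0 \<in> borel_measurable M" and "AE \<omega> in M. 0 \<le> Q0 \<omega>"
    and "integrable M (\<lambda>\<omega>. (Q0 \<omega>)\<^sup>2)"
    and "indep_of_process M Q0 U"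
  shows "is_arg_min (stationary_cost lam \<alpha> u2) (\<lambda>\<mu>. lam < \<mu>) (mu_infinity lam \<alpha> u2)
    \<and> (\<forall>T>0. \<exists>\<mu>. is_arg_min (finite_horizon_cost M U Q0 lam \<alpha> T) (\<lambda>\<mu>. 0 \<le> \<mu>) \<mu>)
    \<and> (\<forall>mu_star :: real \<Rightarrow> real.
         (\<forall>T>0. is_arg_min (finite_horizon_cost M U Q0 lam \<alpha> T) (\<lambda>\<mu>. 0 \<le> \<mu>) (mu_star T)) \<longrightarrow>
         (\<lambda>T. mu_star T -
            (mu_infinity lam \<alpha> u2 + mu_bullet lam \<alpha> u2 u3 (\<integral>\<omega>. (Q0 \<omega>)\<^sup>2 \<partial>M) / T))
           \<in> o[at_top](\<lambda>T. 1 / T))"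
proof -
  interpret L: levy_process M U by fact
  have [measurable]: "U 1 \<in> borel_measurable M" by (rule L.random_variable) simp
  have "integrable M (\<lambda>\<omega>. \<bar>(U 1 \<omega> - 1) ^ 3\<bar>)" using assms(6,8) by (intro integrable_abs) simp
  then have c: "integrable M (\<lambda>\<omega>. \<bar>U 1 \<omega> - 1\<bar> ^ 3)" by (simp add: power_abs)
  \<comment> \<open>The theorem assumes the centred third moment, whereas the locale works with the
    absolute one of \<open>U 1\<close> itself.\<close>
  have cube: "integrable M (\<lambda>\<omega>. \<bar>U 1 \<omega>\<bar> ^ 3)"
  proof (rule Bochner_Integration.integrable_bound)
    show "integrable M (\<lambda>\<omega>. 4 * \<bar>U 1 \<omega> - 1\<bar> ^ 3 + 4 * \<bar>1\<bar> ^ 3)" using c by simp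
    show "AE \<omega> in M. norm (\<bar>U 1 \<omega>\<bar> ^ 3) \<le> norm (4 * \<bar>U 1 \<omega> - 1\<bar> ^ 3 + 4 * \<bar>1\<bar> ^ 3)"
    proof (rule AE_I2)
      fix \<omega>
      show "norm (\<bar>U 1 \<omega>\<bar> ^ 3) \<le> norm (4 * \<bar>U 1 \<omega> - 1\<bar> ^ 3 + 4 * \<bar>1\<bar> ^ 3)"
        using abs_add_cube_le[of "U 1 \<omega> - 1" 1] by simp
    qed
  qed simp
  interpret levy_queue M U lam Q0
    using cube assms by unfold_locales auto
  have u2: "u2 = cent 2 1" and u3: "u3 = cent 3 1"
    using assms(9,10) by (simp_all add: central_moment_def cent_def mean_def)
  define \<delta> where "\<delta> = sqrt (lam * u2 / (2 * \<alpha>))"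
  have \<delta>: "0 < \<delta>" using assms by (simp add: \<delta>_def)
  have "\<delta> ^ 2 = lam * u2 / (2 * \<alpha>)" using assms by (simp add: \<delta>_def)
  then have vu: "lam * u2 = 2 * \<alpha> * \<delta> ^ 2" using assms by (simp add: field_simps)
  then have v: "v = 2 * \<alpha> * \<delta> ^ 2" by (simp add: v_def u2)
  define q2 where "q2 = (\<integral>\<omega>. (Q0 \<omega>)\<^sup>2 \<partial>M)"
  \<comment> \<open>With \<open>lam * u2 = 2 * \<alpha> * \<delta> ^ 2\<close> both radicands are
    squares, and the constant becomes the minimizer of the limiting parabola.\<close>
  have bullet: "mu_bullet lam \<alpha> u2 u3 q2 = slope \<delta> * \<delta> / (2 * \<alpha>)"
  proof -
    have "8 * lam * u2 * \<alpha> = (4 * \<alpha> * \<delta>) ^ 2"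
      using vu by (simp add: power2_eq_square algebra_simps)
    then have s1: "sqrt (8 * lam * u2 * \<alpha>) = 4 * \<alpha> * \<delta>"
      using \<delta> assms(2) by (simp only: real_sqrt_abs) simp
    have "\<alpha> * lam * u2 / 8 = (\<alpha> * \<delta> / 2) ^ 2"
      using vu by (simp add: power2_eq_square algebra_simps)
    then have s2: "sqrt (\<alpha> * lam * u2 / 8) = \<alpha> * \<delta> / 2"
      using \<delta> assms(2) by (simp only: real_sqrt_abs) simp
    have w: "w = lam * u3" by (simp add: w_def u3)
    have "u3 / (3 * u2) = w / (3 * v)" using assms(1) by (simp add: w v_def u2)
    also have "\<dots> = w / (6 * \<alpha> * \<delta> ^ 2)" by (simp add: v)
    finally have s3: "u3 / (3 * u2) = w / (6 * \<alpha> * \<delta> ^ 2)" .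
    show ?thesis
      unfolding mu_bullet_def s1 s2 s3 slope_def q2_def[symmetric] v using \<delta> assms(2)
      by (simp add: field_simps power2_eq_square power3_eq_cube power4_eq_xxxx)
  qed
  have "(\<lambda>T. mu_star T - (mu_infinity lam \<alpha> u2 + mu_bullet lam \<alpha> u2 u3 q2 / T)) \<in> o[at_top](\<lambda>T. 1 / T)"
    if min: "\<forall>T>0. is_arg_min (finite_horizon_cost M U Q0 lam \<alpha> T) (\<lambda>\<mu>. 0 \<le> \<mu>) (mu_star T)"
    for mu_star :: "real \<Rightarrow> real"
  proof (rule landau_o.smallI)
    fix c :: real assume "0 < c"
    have "\<forall>\<^sub>F T in at_top. \<bar>mu_star T - (lam + \<delta> + slope \<delta> * \<delta> / (2 * \<alpha>) / T)\<bar> \<le> c / T"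
      using min by (intro minimizer_expansion[OF assms(4,2) \<delta> v _ \<open>0 < c\<close>]) auto
    then show "\<forall>\<^sub>F T in at_top. norm (mu_star T - (mu_infinity lam \<alpha> u2 + mu_bullet lam \<alpha> u2 u3 q2 / T)) \<le> c * norm (1 / T)"
      using eventually_gt_at_top[of 0]
      by eventually_elim (simp add: bullet mu_infinity_def \<delta>_def[symmetric])
  qed
  then show ?thesis
    using stationary_cost_argmin[OF assms(2,1,11)] cost_minimizer_exists[OF _ assms(2)]
    unfolding q2_def by blast
qed

end
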